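(* Let $n\ge 1$ and $n+1\le k\le 2n+1$ be integers and put $k_m=k+1$. Let $E\subset\mathbb{H}^n$ be $\mathcal{H}^{k_m}$-measurable with $\mathcal{H}^{k_m}(E)<\infty$. Suppose that for $\mathcal{H}^{k_m}$-a.e. $p\in E$ there exists $V_p\in\mathcal{G}(\mathbb{H}^n,k)$ such that for every $0<s<1$, $$\lim_{r\to0^+}\frac{1}{r^{k_m}}\,\mathcal{H}^{k_m}\big(E\cap B(p,r)\setminus X(p,V_p,s)\big)=0 .$$ Then $E$ is $(k,\mathbb{H})$-rectifiable.
   Context: Heisenberg group: $\mathbb{H}^n=\mathbb{R}^{2n+1}$; write $p=(p',p_{2n+1})$ with $p'=(p_1,\dots,p_{2n})$. Group law $p\cdot q=(p'+q',\,p_{2n+1}+q_{2n+1}+2\omega(p',q'))$ with $\omega(p',q')=\sum_{i=1}^n(p_{i+n}q_i-p_iq_{i+n})$; identity $e=0$, inverse $p^{-1}=(-p',-p_{2n+1})$; dilations $\delta_r p=(rp',r^2p_{2n+1})$, $r>0$. Norm $\|p\|=\max\{\|p'\|_{\mathbb{R}^{2n}},|p_{2n+1}|^{1/2}\}$, left-invariant metric $d(p,q)=\|q^{-1}\cdot p\|$, $B(p,r)=\{q:d(p,q)\le r\}$. Left-invariant horizontal fields ($1\le j\le n$): $X_j=\partial_j+2p_{j+n}\partial_{2n+1}$, $Y_j=\partial_{j+n}-2p_j\partial_{2n+1}$. Hausdorff measure: $\mathcal{H}^{m}(E)=\sup_{\delta>0}\inf\{\sum_i2^{-m}\operatorname{diam}(E_i)^m: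 E\subset\bigcup_iE_i,\ \operatorname{diam}(E_i)\le\delta\}$, diameters with respect to $d$. Grassmannian: a homogeneous subgroup is a subgroup $S$ with $\delta_r(S)\subseteq S$ for all $r>0$. $\mathcal{G}(\mathbb{H}^n,k)$ is the set of homogeneous subgroups $V$ of (topological, i.e. linear) dimension $k$ for which there is a homogeneous subgroup $W$ of dimension $2n+1-k$ with $V\cap W=\{0\}$ and $\mathbb{H}^n=W\cdot V$. (For $n+1\le k\le 2n$ these are exactly the $k$-dimensional homogeneous subgroups containing the center $\{(0,t):t\in\mathbb{R}\}$; for $k=2n+1$ the only element is $\mathbb{H}^n$.) Cones: for $\alpha\in(0,1)$, $X(p,S,\alpha)=\{q\in\mathbb{H}^n: d(p^{-1}\cdot q,S)\le\alpha\, d(p,q)\}$, where $d(x,S)=\inf_{s\in S}d(x,s)$. $\mathbb{H}$-regular surfaces: for $\mathcal{U}\subset\mathbb{H}^n$ open, $f\in\mathbf{C}^1_H(\mathcal{U})$ means $f:\mathcal U\to\mathbb R$ is continuously Pansu differentiable, equivalently $f$ is continuous and the (distributional) derivatives $X_jf,Y_jf$ are continuous; $d_Hf_q$ denotes the Pansu differential at $q$. For $n+1\le k\le 2n$, $S\subset\mathbb{H}^n$ is a $k$-dimensional $\mathbb{H}$-regular surface if for every $p\in S$ there are an open set $\mathcal{U}\ni p$ and $f\in[\mathbf{C}^1_H(\mathcal{U})]^{2n+1-k}$ with $d_Hf_q:\mathbb{H}^n\to\mathbb{R}^{2n+1-k}$ surjective for every $q\in\mathcal{U}$ (equivalently, the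 horizontal gradients at $q$ of the components of $f$ are linearly independent) and $S\cap\mathcal{U}=\{q\in\mathcal{U}:f(q)=0\}$. For $k=2n+1$ (no equations) the $k$-dimensional $\mathbb{H}$-regular surfaces are the open subsets of $\mathbb{H}^n$. Rectifiability: for $n+1\le k\le 2n+1$ and $k_m=k+1$, a measurable set $E\subset\mathbb{H}^n$ is $(k,\mathbb{H})$-rectifiable if there are countably many $k$-dimensional $\mathbb{H}$-regular surfaces $S_i$, $i\in\mathbb{N}$, with $\mathcal{H}^{k_m}(E\setminus\bigcup_iS_i)=0$. *)

theory Defs
  imports "HOL-Analysis.Analysis" "HOL-Algebra.Coset"
begin

text \<open>
  The Heisenberg group of dimension \<open>2n + 1\<close> is modelled on \<open>\<real>\<^sup>n \<times> \<real>\<^sup>n \<times> \<real>\<close>, with \<open>n = CARD('n)\<close>: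
  the point \<open>(x, y, t)\<close> has \<open>p' = (x, y)\<close> and last coordinate \<open>t\<close>. The product topology and the
  linear structure of this type are those of Euclidean space; the metric \<open>hdist\<close> below is a
  different metric inducing the same topology.
\<close>

type_synonym 'n heis = "(real ^ 'n) \<times> (real ^ 'n) \<times> real"

definition hform :: "(real ^ 'n::finite) \<times> (real ^ 'n) \<Rightarrow> (real ^ 'n) \<times> (real ^ 'n) \<Rightarrow> real" where
  "hform p' q' = (\<Sum>i\<in>UNIV. snd p' $ i * fst q' $ i - fst p' $ i * snd q' $ i)"

fun hmult :: "'n::finite heis \<Rightarrow> 'n heis \<Rightarrow> 'n heis"  (infixl "\<odot>" 70) where
  "(x, y, t) \<odot> (x', y', t') = (x + x', y + y', t + t' + 2 * hform (x, y) (x', y'))"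

fun hinv :: "'n::finite heis \<Rightarrow> 'n heis" where
  "hinv (x, y, t) = (- x, - y, - t)"

fun dil :: "real \<Rightarrow> 'n::finite heis \<Rightarrow> 'n heis" where
  "dil r (x, y, t) = (r *\<^sub>R x, r *\<^sub>R y, r\<^sup>2 * t)"

definition heis_group :: "'n::finite heis monoid" where
  "heis_group = \<lparr>carrier = UNIV, mult = (\<odot>), one = 0\<rparr>"

lemma heis_group_simps [simp]:
  "carrier heis_group = UNIV" "mult heis_group = (\<odot>)" "one heis_group = 0"
  by (simp_all add: heis_group_def)

lemma hmult_assoc: "(p \<odot> q) \<odot> r = p \<odot> (q \<odot> r)"
  by (cases p; cases q; cases r)
     (simp add: hform_def algebra_simps sum.distrib sum_subtractf)

lemma hmult_zero: "0 \<odot> p = p" "p \<odot> 0 = p"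
  by (cases p; simp add: zero_prod_def hform_def)+

lemma hmult_hinv: "hinv p \<odot> p = 0" "p \<odot> hinv p = 0"
  by (cases p; simp add: zero_prod_def hform_def algebra_simps)+

lemma group_heis_group: "group (heis_group :: 'n::finite heis monoid)"
proof (rule groupI)
  show "\<exists>y\<in>carrier heis_group. y \<otimes>\<^bsub>heis_group\<^esub> p = \<one>\<^bsub>heis_group\<^esub>" for p :: "'n heis"
    by (rule bexI[of _ "hinv p"]) (auto simp: hmult_hinv)
qed (auto simp: hmult_assoc hmult_zero)

lemma inv_heis_group: "inv\<^bsub>heis_group\<^esub> p = hinv p"
  by (rule group.inv_equality[OF group_heis_group]) (auto simp: hmult_hinv)

fun hnorm :: "'n::finite heis \<Rightarrow> real" where
  "hnorm (x, y, t) = max (norm (x, y)) (sqrt \<bar>t\<bar>)"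

definition hdist :: "'n::finite heis \<Rightarrow> 'n heis \<Rightarrow> real" where
  "hdist p q = hnorm (hinv q \<odot> p)"

definition hball :: "'n::finite heis \<Rightarrow> real \<Rightarrow> 'n heis set" where
  "hball p r = {q. hdist p q \<le> r}"

definition hsetdist :: "'n::finite heis \<Rightarrow> 'n heis set \<Rightarrow> real" where
  "hsetdist p S = (INF s\<in>S. hdist p s)"

definition hcone :: "'n::finite heis \<Rightarrow> 'n heis set \<Rightarrow> real \<Rightarrow> 'n heis set" where
  "hcone p S \<alpha> = {q. hsetdist (hinv p \<odot> q) S \<le> \<alpha> * hdist p q}"


text \<open>
  Since \<open>ennreal\<close> is a complete lattice, \<open>hdiam {} = 0\<close>; for \<open>m \<ge> 1\<close> a sequence of covering sets
  padded with empty sets thus also represents a finite cover.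
\<close>

definition hdiam :: "'n::finite heis set \<Rightarrow> ennreal" where
  "hdiam A = (SUP p\<in>A. SUP q\<in>A. ennreal (hdist p q))"

definition hausdorff :: "nat \<Rightarrow> 'n::finite heis set \<Rightarrow> ennreal" where
  "hausdorff m E =
     (SUP \<delta>\<in>{0<..}. INF A\<in>{A :: nat \<Rightarrow> 'n heis set. E \<subseteq> (\<Union>i. A i) \<and> (\<forall>i. hdiam (A i) \<le> ennreal \<delta>)}.
        \<Sum>i. hdiam (A i) ^ m / 2 ^ m)"

text \<open>Measurability in the sense of Caratheodory for the outer measure \<open>hausdorff m\<close>.\<close>

definition hausdorff_measurable :: "nat \<Rightarrow> 'n::finite heis set \<Rightarrow> bool" where
  "hausdorff_measurable m E \<longleftrightarrow> E \<in> lambda_system UNIV UNIV (hausdorff m)"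


definition homogeneous_subgroup :: "'n::finite heis set \<Rightarrow> bool" where
  "homogeneous_subgroup S \<longleftrightarrow> subgroup S heis_group \<and> (\<forall>r>0. dil r ` S \<subseteq> S)"

text \<open>
  A homogeneous subgroup is a linear subspace of the underlying Euclidean space, so that \<open>dim\<close> is its
  linear (equivalently, topological) dimension. In particular \<open>k = dim V \<le> 2n + 1\<close> and the natural
  number subtraction is harmless.
\<close>

definition hgrassmannian :: "nat \<Rightarrow> 'n::finite heis set set" where
  "hgrassmannian k =
     {V. homogeneous_subgroup V \<and> dim V = k \<and>
         (\<exists>W. homogeneous_subgroup W \<and> dim W = 2 * CARD('n) + 1 - k \<and>
              V \<inter> W = {0} \<and> W <#>\<^bsub>heis_group\<^esub> V = UNIV)}"


text \<open>Homogeneous homomorphisms into the additive group of \<open>\<real>\<close>.\<close>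

definition hlinear :: "('n::finite heis \<Rightarrow> real) \<Rightarrow> bool" where
  "hlinear L \<longleftrightarrow> (\<forall>p q. L (p \<odot> q) = L p + L q) \<and> (\<forall>r>0. \<forall>p. L (dil r p) = r * L p)"

definition has_pansu_differential ::
    "('n::finite heis \<Rightarrow> real) \<Rightarrow> ('n heis \<Rightarrow> real) \<Rightarrow> 'n heis \<Rightarrow> bool" where
  "has_pansu_differential f L q \<longleftrightarrow>
     hlinear L \<and> ((\<lambda>p. (f p - f q - L (hinv q \<odot> p)) / hdist p q) \<longlongrightarrow> 0) (at q)"

definition pansu_differential :: "('n::finite heis \<Rightarrow> real) \<Rightarrow> 'n heis \<Rightarrow> 'n heis \<Rightarrow> real" where
  "pansu_differential f q = (THE L. has_pansu_differential f L q)"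

lemma has_pansu_differential_unique:
  fixes q :: "'n::finite heis"
  assumes L: "has_pansu_differential f L q" and M: "has_pansu_differential f M q"
  shows "L = M"
proof
  fix v
  have hom: "L 0 = 0" "M 0 = 0"
    using L M unfolding has_pansu_differential_def hlinear_def
    by (metis add_cancel_right_left hmult_zero(1))+
  show "L v = M v"
  proof (cases "v = 0")
    case True
    then show ?thesis using hom by simp
  next
    case False
    then have pos: "hnorm v > 0"
      by (cases v) (auto simp: zero_prod_def less_max_iff_disj)
    define c where "c r = q \<odot> dil r v" for r
    have shift: "hinv q \<odot> c r = dil r v" for r
      unfolding c_def by (simp add: hmult_assoc[symmetric] hmult_hinv hmult_zero)
    have dil_norm: "hnorm (dil r v) = r * hnorm v" if "r > 0" for r
    proof -
      obtain x y t where v: "v = (x, y, t)" by (cases v)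
      have "norm (r *\<^sub>R x, r *\<^sub>R y) = r * norm (x, y)"
        using that by (metis abs_of_pos norm_scaleR scaleR_Pair)
      then show ?thesis
        using that by (simp add: v abs_mult real_sqrt_mult max_mult_distrib_left)
    qed
    have dist: "hdist (c r) q = r * hnorm v" if "r > 0" for r
      using that by (simp add: hdist_def shift dil_norm)
    have ne: "c r \<noteq> q" if "r > 0" for r
    proof
      assume "c r = q"
      then have "hdist (c r) q = 0"
        by (simp add: hdist_def hmult_hinv zero_prod_def)
      then show False using dist[OF that] that pos by simp
    qed
    have "(c \<longlongrightarrow> q) (at_right 0)"
    proof -
      obtain x y t where v: "v = (x, y, t)" by (cases v)
      obtain x' y' t' where q: "q = (x', y', t')" by (cases q)
      have "((\<lambda>r. (x' + r *\<^sub>R x, y' + r *\<^sub>R y,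
               t' + r\<^sup>2 * t + 2 * (r * hform (x', y') (x, y)))) \<longlongrightarrow>
             (x' + 0 *\<^sub>R x, y' + 0 *\<^sub>R y,
               t' + 0\<^sup>2 * t + 2 * (0 * hform (x', y') (x, y)))) (at_right 0)"
        by (intro tendsto_intros)
      moreover have "c = (\<lambda>r. (x' + r *\<^sub>R x, y' + r *\<^sub>R y,
               t' + r\<^sup>2 * t + 2 * (r * hform (x', y') (x, y))))"
        by (auto simp: fun_eq_iff c_def v q hform_def sum_distrib_left algebra_simps)
      ultimately show ?thesis by (simp add: q)
    qed
    moreover have "eventually (\<lambda>r. c r \<noteq> q) (at_right 0)"
      using ne by (intro eventually_mono[OF eventually_at_right_less[of 0]])
    ultimately have c: "filterlim c (at q) (at_right 0)"
      by (simp add: filterlim_at)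
    have "((\<lambda>p. (f p - f q - L (hinv q \<odot> p)) / hdist p q
              - (f p - f q - M (hinv q \<odot> p)) / hdist p q) \<longlongrightarrow> 0 - 0) (at q)"
      using L M unfolding has_pansu_differential_def by (intro tendsto_diff) auto
    from filterlim_compose[OF this c]
    have lim: "((\<lambda>r. (f (c r) - f q - L (dil r v)) / hdist (c r) q
              - (f (c r) - f q - M (dil r v)) / hdist (c r) q) \<longlongrightarrow> 0) (at_right 0)"
      by (simp add: shift)
    have eq: "(f (c r) - f q - L (dil r v)) / hdist (c r) q
              - (f (c r) - f q - M (dil r v)) / hdist (c r) q = (M v - L v) / hnorm v"
      if "r > 0" for r
    proof -
      have "L (dil r v) = r * L v" "M (dil r v) = r * M v"
        using L M that unfolding has_pansu_differential_def hlinear_def by blast+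
      then show ?thesis using that pos by (simp add: dist field_simps)
    qed
    have "((\<lambda>r::real. (M v - L v) / hnorm v) \<longlongrightarrow> 0) (at_right 0)"
      by (rule Lim_transform_eventually[OF lim])
         (auto simp: eq intro: eventually_mono[OF eventually_at_right_less[of 0]])
    then have "(M v - L v) / hnorm v = 0"
      by (simp add: tendsto_const_iff)
    then show ?thesis using pos by simp
  qed
qed

lemma pansu_differential_eq:
  "has_pansu_differential f L q \<Longrightarrow> pansu_differential f q = L"
  unfolding pansu_differential_def by (blast intro: has_pansu_differential_unique)

text \<open>
  Continuity of the Pansu differential in its base point is with respect to the norm
  \<open>sup {\<bar>L v\<bar> | v. hnorm v \<le> 1}\<close> on the homogeneous homomorphisms.
\<close>

definition C1H_on :: "'n::finite heis set \<Rightarrow> ('n heis \<Rightarrow> real) \<Rightarrow> bool" where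
  "C1H_on U f \<longleftrightarrow>
     (\<forall>q\<in>U. \<exists>L. has_pansu_differential f L q) \<and>
     (\<forall>q\<in>U. uniform_limit {v. hnorm v \<le> 1} (pansu_differential f) (pansu_differential f q) (at q within U))"

text \<open>
  A map into \<open>\<real>\<^sup>m\<close>, \<open>m = 2n + 1 - k\<close>, is given by its components \<open>f 0, \<dots>, f (m - 1)\<close>; its Pansu
  differential at \<open>q\<close> is computed componentwise.
\<close>

definition H_regular :: "nat \<Rightarrow> 'n::finite heis set \<Rightarrow> bool" where
  "H_regular k S \<longleftrightarrow>
     (if k = 2 * CARD('n) + 1 then open S
      else \<forall>p\<in>S. \<exists>U. \<exists>f :: nat \<Rightarrow> 'n heis \<Rightarrow> real. let m = 2 * CARD('n) + 1 - k in
             open U \<and> p \<in> U \<and>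
             (\<forall>i<m. C1H_on U (f i)) \<and>
             (\<forall>q\<in>U. \<forall>c :: nat \<Rightarrow> real. \<exists>v. \<forall>i<m. pansu_differential (f i) q v = c i) \<and>
             S \<inter> U = {q \<in> U. \<forall>i<m. f i q = 0})"

definition H_rectifiable :: "nat \<Rightarrow> 'n::finite heis set \<Rightarrow> bool" where
  "H_rectifiable k E \<longleftrightarrow>
     hausdorff_measurable (k + 1) E \<and>
     (\<exists>S :: nat \<Rightarrow> 'n heis set. (\<forall>i. H_regular k (S i)) \<and> hausdorff (k + 1) (E - (\<Union>i. S i)) = 0)"

end

theory Submission
  imports Defs
begin

text \<open>
  For \<open>k \<le> 2n\<close> a complemented homogeneous subgroup \<open>V\<close> of dimension \<open>k\<close> is the preimage of a linear
  subspace of \<open>\<real>\<^sup>2\<^sup>n\<close>, so it is described by \<open>m = 2n + 1 - k\<close> orthonormal covectors, and a horizontal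
  complement \<open>W\<close> is isotropic.  Let \<open>N\<close> be the sum of the absolute values of the covectors.

  Suppose that, at every point of a set \<open>A\<close>, the part of \<open>A\<close> outside a narrow cone has small upper
  density, and consider a piece of diameter \<open>\<delta>\<close> of the bad points, those which see arbitrarily close
  points of \<open>A\<close> outside a wider cone.  Let \<open>h\<close> be the largest distance at most \<open>\<delta>\<close> at which this happens
  and attach to each bad point \<open>x\<close> the tube \<open>x \<cdot> B(0, ch) \<cdot> W\<^sub>\<delta>\<close>.  If the tubes of two bad points meet,
  then the smaller one is based at a point that lies outside the narrow cone of \<open>x\<close> or of its partner,
  a set of measure at most \<open>C \<epsilon> h\<^sup>k\<^sup>+\<^sup>1\<close>; and Lebesgue measure bounds the sum of \<open>h\<^sup>k\<^sup>+\<^sup>1\<close> over disjoint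
  tubes by \<open>C \<delta>\<^sup>k\<^sup>+\<^sup>1\<close>.  So the bad set \<open>B\<close> has measure at most \<open>C \<epsilon> diam\<^sup>k\<^sup>+\<^sup>1\<close> on small sets, which
  forces it to be null.  No lower density bound for \<open>E\<close> is needed.

  Hence, up to a null set, for every \<open>j\<close> the set \<open>E\<close> splits into countably many pieces on which the
  covectors and the horizontal increments are controlled up to \<open>2\<^sup>-\<^sup>j\<close>.  These pieces need not be
  measurable, and neither need the choice of \<open>V\<^sub>p\<close>; measurable envelopes nevertheless give compact sets
  of almost full measure on which limits of the covectors are continuous and satisfy Whitney's
  condition.  Whitney extension with horizontal gradients then produces the surfaces.
\<close>

section \<open>The Heisenberg group and its metric\<close>

text \<open>The exponents are balanced by \<open>d + m = 2 * CARD('n) + 2\<close>, the homogeneous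
  dimension, where \<open>d = k + 1\<close>: a tube of width h and length \<delta> has volume about
  \<open>h ^ d * \<delta> ^ m\<close> and lies in a ball of volume about
  \<open>\<delta> ^ (d + m)\<close>. This is why disjoint tubes bound a sum of d-th powers without
  reference to the measure of E. Isotropy of W makes tubes usable in a noncommutative group:
  translations by two lifts of elements of W combine to a single one with no central error. The cone
  geometry is horizontal, because V contains the centre and the distance to V dominates the
  covectors applied to the horizontal projection. The obstacle is that the transversality constant
  of W, and with it the admissible density \<epsilon>, depends on the point without any uniform
  bound. Countably many reference frames are therefore fixed first, and only then is a density
  threshold chosen for each of them. Working with the seminorm N instead of the distance to V turns
  the comparison of two nearby frames into a linear perturbation.\<close>

type_synonym 'n hvec = "(real ^ 'n) \<times> (real ^ 'n)"

definition hproj :: "'n::finite heis \<Rightarrow> 'n hvec" where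
  "hproj p = (fst p, fst (snd p))"

definition hcen :: "'n::finite heis \<Rightarrow> real" where
  "hcen p = snd (snd p)"

definition hlift :: "'n::finite hvec \<Rightarrow> 'n heis" where
  "hlift z = (fst z, snd z, 0)"

text \<open>Multiplication by -i when \<open>(x, y)\<close> is read as x + iy; it turns the
  symplectic form into a Euclidean inner product, to which Cauchy-Schwarz and orthogonality
  apply.\<close>

definition hrot :: "'n::finite hvec \<Rightarrow> 'n hvec" where
  "hrot z = (snd z, - fst z)"

lemma hproj_Pair [simp]: "hproj (x, y, t) = (x, y)"
  and hcen_Pair [simp]: "hcen (x, y, t) = t"
  by (simp_all add: hproj_def hcen_def)

lemma hproj_hlift [simp]: "hproj (hlift z) = z"
  and hcen_hlift [simp]: "hcen (hlift z) = 0"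
  by (simp_all add: hlift_def)

lemma heis_eqI: "hproj p = hproj q \<Longrightarrow> hcen p = hcen q \<Longrightarrow> p = q"
  by (cases p; cases q) simp

lemma hform_inner: "hform z w = hrot z \<bullet> w"
  by (simp add: hform_def hrot_def inner_prod_def inner_vec_def sum_subtractf sum_negf)

lemma norm_hrot [simp]: "norm (hrot z) = norm z"
  by (cases z) (simp add: hrot_def norm_Pair add.commute)

lemma bounded_linear_hrot: "bounded_linear hrot"
  by (rule bounded_linear_intro[where K = 1]) (auto simp: hrot_def norm_Pair add.commute)

lemma hform_abs_le: "\<bar>hform z w\<bar> \<le> norm z * norm w"
  unfolding hform_inner using Cauchy_Schwarz_ineq2[of "hrot z" w] by simp

lemma hform_self [simp]: "hform z z = 0"
  by (simp add: hform_def mult.commute)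

lemma hform_add: "hform (z + z') w = hform z w + hform z' w" "hform z (w + w') = hform z w + hform z w'"
  and hform_diff: "hform (z - z') w = hform z w - hform z' w" "hform z (w - w') = hform z w - hform z w'"
  and hform_minus: "hform (- z) w = - hform z w" "hform z (- w) = - hform z w"
  and hform_scale: "hform (c *\<^sub>R z) w = c * hform z w" "hform z (c *\<^sub>R w) = c * hform z w"
  and hform_zero [simp]: "hform 0 w = 0" "hform z 0 = 0"
  by (simp_all add: hform_def zero_prod_def algebra_simps sum.distrib sum_subtractf
      sum_distrib_left sum_negf split_beta flip: sum_negf)

lemma hform_commute: "hform z w = - hform w z"
  by (simp add: hform_def algebra_simps flip: sum_negf)

lemma hproj_hmult [simp]: "hproj (p \<odot> q) = hproj p + hproj q"
  and hcen_hmult [simp]: "hcen (p \<odot> q) = hcen p + hcen q + 2 * hform (hproj p) (hproj q)"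
  by (cases p; cases q; simp)+

lemma hproj_hinv [simp]: "hproj (hinv p) = - hproj p"
  and hcen_hinv [simp]: "hcen (hinv p) = - hcen p"
  by (cases p; simp)+

lemma hproj_dil [simp]: "hproj (dil r p) = r *\<^sub>R hproj p"
  and hcen_dil [simp]: "hcen (dil r p) = r\<^sup>2 * hcen p"
  by (cases p; simp)+

lemma hproj_zero [simp]: "hproj 0 = 0"
  and hcen_zero [simp]: "hcen 0 = 0"
  by (simp_all add: zero_prod_def hproj_def hcen_def)

lemma hnorm_eq: "hnorm p = max (norm (hproj p)) (sqrt \<bar>hcen p\<bar>)"
  by (cases p) simp

lemma hnorm_le_iff: "0 \<le> r \<Longrightarrow> hnorm p \<le> r \<longleftrightarrow> norm (hproj p) \<le> r \<and> \<bar>hcen p\<bar> \<le> r\<^sup>2"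
  by (auto simp: hnorm_eq real_sqrt_le_iff' real_le_lsqrt sqrt_le_D)

lemma norm_hproj_le: "norm (hproj p) \<le> hnorm p"
  by (simp add: hnorm_eq)

lemma hnorm_nonneg [simp]: "0 \<le> hnorm p"
  using norm_hproj_le[of p] norm_ge_zero[of "hproj p"] by linarith

lemma abs_hcen_le: "\<bar>hcen p\<bar> \<le> (hnorm p)\<^sup>2"
  using hnorm_le_iff[of "hnorm p" p] by simp

lemma hnorm_zero_iff [simp]: "hnorm p = 0 \<longleftrightarrow> p = 0"
proof
  assume "hnorm p = 0"
  then have "hproj p = 0" "hcen p = 0"
    using norm_hproj_le[of p] abs_hcen_le[of p] by auto
  then show "p = 0" by (intro heis_eqI) auto
qed (simp add: hnorm_eq)

lemma hnorm_hinv [simp]: "hnorm (hinv p) = hnorm p"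
  by (simp add: hnorm_eq)

lemma hnorm_hlift [simp]: "hnorm (hlift z) = norm z"
  by (simp add: hnorm_eq)

lemma hnorm_dil: "0 \<le> r \<Longrightarrow> hnorm (dil r p) = r * hnorm p"
  by (simp add: hnorm_eq abs_mult real_sqrt_mult max_mult_distrib_left)

text \<open>The factor 2 in the group law is exactly what completes the square: the central
  coordinates contribute at most a^2 + b^2 and the form at most 2ab.\<close>

lemma hnorm_hmult_le: "hnorm (p \<odot> q) \<le> hnorm p + hnorm q"
proof -
  have "\<bar>hcen (p \<odot> q)\<bar> \<le> \<bar>hcen p\<bar> + \<bar>hcen q\<bar> + 2 * \<bar>hform (hproj p) (hproj q)\<bar>"
    unfolding hcen_hmult by linarith
  also have "\<dots> \<le> (hnorm p)\<^sup>2 + (hnorm q)\<^sup>2 + 2 * (hnorm p * hnorm q)"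
    using abs_hcen_le[of p] abs_hcen_le[of q] hform_abs_le[of "hproj p" "hproj q"]
      mult_mono[OF norm_hproj_le[of p] norm_hproj_le[of q]] by auto
  also have "\<dots> = (hnorm p + hnorm q)\<^sup>2" by (simp add: power2_sum)
  finally have "\<bar>hcen (p \<odot> q)\<bar> \<le> (hnorm p + hnorm q)\<^sup>2" .
  moreover have "norm (hproj (p \<odot> q)) \<le> hnorm p + hnorm q"
    using norm_triangle_ineq[of "hproj p" "hproj q"] norm_hproj_le[of p] norm_hproj_le[of q] by simp
  ultimately show ?thesis by (simp add: hnorm_le_iff)
qed

lemma hinv_hmult: "hinv (p \<odot> q) = hinv q \<odot> hinv p"
  by (rule heis_eqI) (simp_all add: hform_minus hform_commute[of "hproj q"])

lemma hinv_hinv [simp]: "hinv (hinv p) = p"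
  by (rule heis_eqI) simp_all

lemma hmult_hinv_cancel [simp]: "p \<odot> (hinv p \<odot> q) = q" "hinv p \<odot> (p \<odot> q) = q"
  by (simp_all add: hmult_hinv hmult_zero flip: hmult_assoc)

lemma dil_hmult: "dil r (p \<odot> q) = dil r p \<odot> dil r q"
  by (rule heis_eqI) (simp_all add: hform_scale power2_eq_square algebra_simps)

lemma dil_hinv: "dil r (hinv p) = hinv (dil r p)"
  by (rule heis_eqI) simp_all

lemma hdist_eq: "hdist p q = max (norm (hproj p - hproj q))
    (sqrt \<bar>hcen p - hcen q - 2 * hform (hproj q) (hproj p)\<bar>)"
  by (simp add: hdist_def hnorm_eq hform_minus)

lemma norm_hproj_diff_le: "norm (hproj p - hproj q) \<le> hdist p q"
  by (simp add: hdist_eq)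

lemma hdist_nonneg [simp]: "0 \<le> hdist p q"
  by (simp add: hdist_def)

lemma hdist_zero_iff [simp]: "hdist p q = 0 \<longleftrightarrow> p = q"
proof -
  have "p = q" if "hinv q \<odot> p = 0"
    using hmult_hinv_cancel(1)[of q p] that by (simp add: hmult_zero)
  then show ?thesis unfolding hdist_def by (auto simp: hmult_hinv)
qed

lemma hdist_self [simp]: "hdist p p = 0"
  by simp

lemma hdist_pos: "p \<noteq> q \<Longrightarrow> 0 < hdist p q"
  using hdist_nonneg[of p q] hdist_zero_iff[of p q] by linarith

lemma hdist_commute: "hdist p q = hdist q p"
proof -
  have "hinv p \<odot> q = hinv (hinv q \<odot> p)" by (simp add: hinv_hmult)
  then show ?thesis unfolding hdist_def by simp
qed

lemma hdist_left [simp]: "hdist (a \<odot> p) (a \<odot> q) = hdist p q"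
  by (simp add: hdist_def hinv_hmult hmult_assoc)

lemma hdist_hmult_self [simp]: "hdist (p \<odot> q) p = hnorm q" "hdist p (p \<odot> q) = hnorm q"
  unfolding hdist_commute[of p] by (simp_all add: hdist_def)

lemma hdist_dil: "0 \<le> r \<Longrightarrow> hdist (dil r p) (dil r q) = r * hdist p q"
  by (simp add: hdist_def hnorm_dil flip: dil_hinv dil_hmult)

lemma hdist_triangle: "hdist p q \<le> hdist p r + hdist r q"
proof -
  have "hinv q \<odot> p = (hinv q \<odot> r) \<odot> (hinv r \<odot> p)" by (simp add: hmult_assoc)
  then show ?thesis unfolding hdist_def using hnorm_hmult_le[of "hinv q \<odot> r" "hinv r \<odot> p"] by simp
qed

section \<open>Continuity of the group operations; \<open>hdist\<close> against the Euclidean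
  topology\<close>

lemma continuous_on_hproj [continuous_intros]: "continuous_on S f \<Longrightarrow> continuous_on S (\<lambda>x. hproj (f x))"
  unfolding hproj_def by (intro continuous_intros)

lemma continuous_on_hcen [continuous_intros]: "continuous_on S f \<Longrightarrow> continuous_on S (\<lambda>x. hcen (f x))"
  unfolding hcen_def by (intro continuous_intros)

lemma continuous_on_hrot [continuous_intros]: "continuous_on S f \<Longrightarrow> continuous_on S (\<lambda>x. hrot (f x))"
  unfolding hrot_def by (intro continuous_intros)

lemma continuous_on_hform [continuous_intros]:
  "continuous_on S f \<Longrightarrow> continuous_on S g \<Longrightarrow> continuous_on S (\<lambda>x. hform (f x) (g x))"
  unfolding hform_inner by (intro continuous_intros)

lemma heis_cases: "p = (fst (hproj p), snd (hproj p), hcen p)"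
  by (cases p) simp

lemma continuous_on_hmult [continuous_intros]:
  assumes "continuous_on S f" "continuous_on S g"
  shows "continuous_on S (\<lambda>x. f x \<odot> g x)"
proof -
  have "(\<lambda>x. f x \<odot> g x) = (\<lambda>x. (fst (hproj (f x) + hproj (g x)), snd (hproj (f x) + hproj (g x)),
      hcen (f x) + hcen (g x) + 2 * hform (hproj (f x)) (hproj (g x))))"
    by (intro ext heis_eqI) (simp_all add: prod_eq_iff)
  then show ?thesis using assms by (simp only:) (intro continuous_intros)
qed

lemma continuous_on_hinv [continuous_intros]:
  assumes "continuous_on S f"
  shows "continuous_on S (\<lambda>x. hinv (f x))"
proof -
  have "(\<lambda>x. hinv (f x)) = (\<lambda>x. - f x)"
    by (intro ext heis_eqI) (simp_all, simp_all add: hproj_def hcen_def)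
  then show ?thesis using assms by (simp only:) (intro continuous_intros)
qed

lemma continuous_on_dil [continuous_intros]:
  assumes "continuous_on S f" "continuous_on S r"
  shows "continuous_on S (\<lambda>x. dil (r x) (f x))"
proof -
  have "(\<lambda>x. dil (r x) (f x)) = (\<lambda>x. (fst (r x *\<^sub>R hproj (f x)), snd (r x *\<^sub>R hproj (f x)), (r x)\<^sup>2 * hcen (f x)))"
    by (intro ext heis_eqI) (simp_all add: prod_eq_iff)
  then show ?thesis using assms by (simp only:) (intro continuous_intros)
qed

lemma continuous_on_hnorm [continuous_intros]:
  "continuous_on S f \<Longrightarrow> continuous_on S (\<lambda>x. hnorm (f x))"
  unfolding hnorm_eq by (intro continuous_intros)

lemma continuous_on_hdist [continuous_intros]:
  "continuous_on S f \<Longrightarrow> continuous_on S g \<Longrightarrow> continuous_on S (\<lambda>x. hdist (f x) (g x))"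
  unfolding hdist_def by (intro continuous_intros)

lemma tendsto_hdist [tendsto_intros]:
  fixes f g :: "'a \<Rightarrow> 'n::finite heis"
  assumes "(f \<longlongrightarrow> a) F" "(g \<longlongrightarrow> b) F"
  shows "((\<lambda>x. hdist (f x) (g x)) \<longlongrightarrow> hdist a b) F"
proof -
  have c: "continuous_on UNIV (\<lambda>z :: 'n heis \<times> 'n heis. hdist (fst z) (snd z))"
    by (intro continuous_intros)
  show ?thesis
    using continuous_on_tendsto_compose[OF c tendsto_Pair[OF assms]] by simp
qed

lemma norm_le_hnorm: "norm p \<le> hnorm p + (hnorm p)\<^sup>2"
proof -
  obtain x y t where p: "p = (x, y, t)" by (cases p)
  have "p = (x, y, 0) + (0, 0, t)" by (simp add: p)
  then have "norm p \<le> norm (x, y, 0::real) + norm (0::real^'a, 0::real^'a, t)"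
    by (metis norm_triangle_ineq)
  also have "\<dots> = norm (hproj p) + \<bar>hcen p\<bar>" by (simp add: p norm_Pair)
  also have "\<dots> \<le> hnorm p + (hnorm p)\<^sup>2" using norm_hproj_le abs_hcen_le by (intro add_mono)
  finally show ?thesis .
qed

text \<open>Left translation is continuous and preserves \<open>hdist\<close>, so only
  neighbourhoods of \<open>0\<close> matter, and there \<open>norm_le_hnorm\<close> compares the two
  topologies.\<close>

lemma open_hdist_ball:
  assumes "open U" "p \<in> U"
  obtains e where "e > 0" "\<And>q. hdist p q < e \<Longrightarrow> q \<in> U"
proof -
  have "continuous_on UNIV (\<lambda>v. p \<odot> v)" by (intro continuous_intros)
  then have "open ((\<lambda>v. p \<odot> v) -` U)" using assms by (intro open_vimage)
  moreover have "0 \<in> (\<lambda>v. p \<odot> v) -` U" using assms by (simp add: hmult_zero)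
  ultimately obtain d where d: "d > 0" "ball 0 d \<subseteq> (\<lambda>v. p \<odot> v) -` U"
    by (meson openE)
  \<comment> \<open>Below 1 the square in \<open>norm_le_hnorm\<close> is at most
    \<open>hnorm v\<close>, so the Euclidean norm is below \<open>2 * e\<close>, hence below
    d.\<close>
  define e where "e = min 1 (d / 2)"
  have e: "e > 0" using d by (simp add: e_def)
  show ?thesis
  proof (rule that[OF e])
    fix q assume q: "hdist p q < e"
    define v where "v = hinv p \<odot> q"
    have hv: "hnorm v < e" using q by (metis hdist_commute hdist_def v_def)
    have "(hnorm v)\<^sup>2 \<le> hnorm v"
      using hv by (simp add: power2_eq_square e_def mult_left_le)
    then have "norm v < d" using norm_le_hnorm[of v] hv by (simp add: e_def)
    then have "p \<odot> v \<in> U" using d by auto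
    then show "q \<in> U" by (simp add: v_def)
  qed
qed

lemma open_hdist_less: "open {q. hdist p q < r}"
proof -
  have "open ((\<lambda>q. hdist p q) -` {..<r})" by (intro open_vimage continuous_intros open_lessThan)
  then show ?thesis by (simp add: vimage_def)
qed

lemma eventually_at_hdist:
  fixes q :: "'n::finite heis"
  shows "eventually P (at q) \<longleftrightarrow> (\<exists>e>0. \<forall>p. p \<noteq> q \<longrightarrow> hdist p q < e \<longrightarrow> P p)"
proof
  assume "eventually P (at q)"
  then obtain S where S: "open S" "q \<in> S" "\<And>p. p \<in> S \<Longrightarrow> p \<noteq> q \<Longrightarrow> P p"
    by (auto simp: eventually_at_topological)
  obtain e where "e > 0" "\<And>p. hdist q p < e \<Longrightarrow> p \<in> S" using open_hdist_ball[OF S(1,2)] by blast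
  then show "\<exists>e>0. \<forall>p. p \<noteq> q \<longrightarrow> hdist p q < e \<longrightarrow> P p"
    using S(3) by (intro exI[of _ e]) (simp add: hdist_commute)
next
  assume "\<exists>e>0. \<forall>p. p \<noteq> q \<longrightarrow> hdist p q < e \<longrightarrow> P p"
  then obtain e where e: "e > 0" "\<And>p. p \<noteq> q \<Longrightarrow> hdist p q < e \<Longrightarrow> P p" by auto
  show "eventually P (at q)"
    unfolding eventually_at_topological
  proof (intro exI conjI ballI impI)
    show "open {p. hdist q p < e}" by (rule open_hdist_less)
    show "q \<in> {p. hdist q p < e}" using e by simp
    show "P p" if "p \<in> {p. hdist q p < e}" "p \<noteq> q" for p
      using that e(2)[of p] by (simp add: hdist_commute)
  qed
qed

section \<open>Hausdorff measures\<close>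

lemma hdist_le_hdiam: "p \<in> A \<Longrightarrow> q \<in> A \<Longrightarrow> ennreal (hdist p q) \<le> hdiam A"
  unfolding hdiam_def by (meson SUP_upper2 order_refl)

lemma hdiam_leI: "(\<And>p q. p \<in> A \<Longrightarrow> q \<in> A \<Longrightarrow> hdist p q \<le> r) \<Longrightarrow> hdiam A \<le> ennreal r"
  unfolding hdiam_def by (intro SUP_least ennreal_leI)

lemma hdiam_empty [simp]: "hdiam {} = 0"
  by (simp add: hdiam_def bot_ennreal)

text \<open>The approximating outer measures are named because covers can be combined only at a
  fixed mesh; the supremum over \<delta> is taken last.\<close>

definition hausdorff_pre :: "nat \<Rightarrow> real \<Rightarrow> 'n::finite heis set \<Rightarrow> ennreal" where
  "hausdorff_pre m \<delta> E =
     (INF A\<in>{A :: nat \<Rightarrow> 'n heis set. E \<subseteq> (\<Union>i. A i) \<and> (\<forall>i. hdiam (A i) \<le> ennreal \<delta>)}.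
        \<Sum>i. hdiam (A i) ^ m / 2 ^ m)"

lemma hausdorff_eq_pre: "hausdorff m E = (SUP \<delta>\<in>{0<..}. hausdorff_pre m \<delta> E)"
  by (simp add: hausdorff_def hausdorff_pre_def)

lemma hausdorff_pre_le: "0 < \<delta> \<Longrightarrow> hausdorff_pre m \<delta> E \<le> hausdorff m E"
  unfolding hausdorff_eq_pre by (intro SUP_upper) simp

lemma hausdorff_pre_le_cover:
  "E \<subseteq> (\<Union>i. A i) \<Longrightarrow> (\<And>i. hdiam (A i) \<le> ennreal \<delta>) \<Longrightarrow>
    hausdorff_pre m \<delta> E \<le> (\<Sum>i. hdiam (A i) ^ m / 2 ^ m)"
  unfolding hausdorff_pre_def by (intro INF_lower) simp

lemma hausdorff_pre_mono: "A \<subseteq> B \<Longrightarrow> hausdorff_pre m \<delta> A \<le> hausdorff_pre m \<delta> B"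
  unfolding hausdorff_pre_def by (intro INF_superset_mono) auto

lemma hausdorff_mono: "A \<subseteq> B \<Longrightarrow> hausdorff m A \<le> hausdorff m B"
  unfolding hausdorff_eq_pre by (intro SUP_mono) (auto intro: hausdorff_pre_mono)

lemma hausdorff_empty: "0 < m \<Longrightarrow> hausdorff m {} = 0"
proof -
  assume m: "0 < m"
  have "hausdorff_pre m \<delta> {} \<le> 0" for \<delta>
    using hausdorff_pre_le_cover[of "{}" "\<lambda>_. {}" \<delta> m] m by (simp add: zero_power)
  then have "hausdorff m {} \<le> 0"
    unfolding hausdorff_eq_pre by (intro SUP_least)
  then show ?thesis by simp
qed

lemma hausdorff_pre_countable_subadditive:
  "hausdorff_pre m \<delta> (\<Union>i::nat. E i) \<le> (\<Sum>i. hausdorff_pre m \<delta> (E i))"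
proof (rule ennreal_le_epsilon)
  fix e :: real
  assume fin: "(\<Sum>i. hausdorff_pre m \<delta> (E i)) < top_class.top" and e: "0 < e"
  have "\<exists>A. E i \<subseteq> (\<Union>j. A j) \<and> (\<forall>j. hdiam (A j) \<le> ennreal \<delta>) \<and>
      (\<Sum>j. hdiam (A j) ^ m / 2 ^ m) \<le> hausdorff_pre m \<delta> (E i) + ennreal (e * (1/2) ^ Suc i)" for i
  proof -
    have "hausdorff_pre m \<delta> (E i) \<noteq> \<infinity>"
      using fin ennreal_suminf_lessD[of "\<lambda>i. hausdorff_pre m \<delta> (E i)" \<infinity> i] by (simp add: less_top)
    from INF_approx_ennreal[of "e * (1/2) ^ Suc i", OF _ hausdorff_pre_def this] e
    show ?thesis by (auto simp: less_imp_le)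
  qed
  then obtain A where A: "\<And>i. E i \<subseteq> (\<Union>j. A i j)" "\<And>i j. hdiam (A i j) \<le> ennreal \<delta>"
    "\<And>i. (\<Sum>j. hdiam (A i j) ^ m / 2 ^ m) \<le> hausdorff_pre m \<delta> (E i) + ennreal (e * (1/2) ^ Suc i)"
    by metis
  define B where "B n = (case prod_decode n of (i, j) \<Rightarrow> A i j)" for n
  have "(\<Union>i. E i) \<subseteq> (\<Union>n. B n)"
  proof
    fix x assume "x \<in> (\<Union>i. E i)"
    then obtain i j where "x \<in> A i j" using A(1) by blast
    then have "x \<in> B (prod_encode (i, j))" by (simp add: B_def)
    then show "x \<in> (\<Union>n. B n)" by blast
  qed
  then have "hausdorff_pre m \<delta> (\<Union>i. E i) \<le> (\<Sum>n. hdiam (B n) ^ m / 2 ^ m)"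
    by (rule hausdorff_pre_le_cover) (auto simp: B_def A(2) split: prod.split)
  also have "\<dots> = (\<Sum>n. (\<lambda>(i, j). hdiam (A i j) ^ m / 2 ^ m) (prod_decode n))"
    by (simp add: B_def split_beta)
  also have "\<dots> = (\<Sum>i. \<Sum>j. hdiam (A i j) ^ m / 2 ^ m)"
    by (rule suminf_ennreal_2dimen) simp
  also have "\<dots> \<le> (\<Sum>i. hausdorff_pre m \<delta> (E i) + ennreal (e * (1/2) ^ Suc i))"
    by (intro suminf_le A(3) summableI)
  also have "\<dots> = (\<Sum>i. hausdorff_pre m \<delta> (E i)) + (\<Sum>i. ennreal (e * (1/2) ^ Suc i))"
    by (intro suminf_add[symmetric] summableI)
  also have "(\<Sum>i. ennreal (e * (1/2) ^ Suc i)) = ennreal e"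
    using sums_mult[OF power_half_series, of e] e
    by (intro suminf_ennreal_eq) auto
  finally show "hausdorff_pre m \<delta> (\<Union>i. E i) \<le> (\<Sum>i. hausdorff_pre m \<delta> (E i)) + ennreal e" .
qed

lemma hausdorff_countable_subadditive:
  "hausdorff m (\<Union>i::nat. E i) \<le> (\<Sum>i. hausdorff m (E i))"
  unfolding hausdorff_eq_pre[of m "\<Union>i. E i"]
proof (rule SUP_least)
  fix \<delta> :: real assume "\<delta> \<in> {0<..}"
  then have "(\<Sum>i. hausdorff_pre m \<delta> (E i)) \<le> (\<Sum>i. hausdorff m (E i))"
    by (intro suminf_le hausdorff_pre_le summableI) auto
  then show "hausdorff_pre m \<delta> (\<Union>i. E i) \<le> (\<Sum>i. hausdorff m (E i))"
    using hausdorff_pre_countable_subadditive order_trans by blast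
qed

lemma hausdorff_Un_le:
  assumes "0 < m"
  shows "hausdorff m (A \<union> B) \<le> hausdorff m A + hausdorff m B"
proof -
  define S where "S i = (if i = 0 then A else if i = 1 then B else {})" for i :: nat
  have "A \<union> B = (\<Union>i. S i)" by (auto simp: S_def split: if_splits) 
  moreover have "(\<Sum>i. hausdorff m (S i)) = (\<Sum>i<2. hausdorff m (S i))"
    by (intro suminf_finite) (auto simp: S_def hausdorff_empty assms)
  moreover have "\<dots> = hausdorff m A + hausdorff m B"
    by (simp add: S_def numeral_2_eq_2)
  ultimately show ?thesis using hausdorff_countable_subadditive[of m S] by simp
qed

lemma hausdorff_null_UN:
  assumes "\<And>i::nat. hausdorff m (E i) = 0"
  shows "hausdorff m (\<Union>i. E i) = 0"
  using hausdorff_countable_subadditive[of m E] assms by simp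

lemma hausdorff_null_subset: "hausdorff m B = 0 \<Longrightarrow> A \<subseteq> B \<Longrightarrow> hausdorff m A = 0"
  using hausdorff_mono[of A B m] by simp

text \<open>Applied to every set of a fine cover, the local bound compares the measure of B with the
  covering sum itself; \<open>2 ^ m\<close> undoes the normalisation of \<open>hausdorff\<close>.
  When \<open>c * 2 ^ m < 1\<close> and the measure is finite, this forces B to be null.\<close>

lemma hausdorff_le_of_local_bound:
  assumes "0 < \<delta>" "0 < c"
    and loc: "\<And>C. hdiam C \<le> ennreal \<delta> \<Longrightarrow> hausdorff m (B \<inter> C) \<le> ennreal c * hdiam C ^ m"
  shows "hausdorff m B \<le> ennreal (c * 2 ^ m) * hausdorff m B"
proof -
  have "hausdorff m B \<le> ennreal (c * 2 ^ m) * (\<Sum>i. hdiam (A i) ^ m / 2 ^ m)"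
    if A: "B \<subseteq> (\<Union>i. A i)" "\<forall>i. hdiam (A i) \<le> ennreal \<delta>" for A :: "nat \<Rightarrow> _"
  proof -
    have two: "ennreal (2 ^ m) = 2 ^ m" by (simp add: ennreal_power[symmetric])
    have "B = (\<Union>i. B \<inter> A i)" using A(1) by auto
    then have "hausdorff m B \<le> (\<Sum>i. hausdorff m (B \<inter> A i))"
      using hausdorff_countable_subadditive[of m "\<lambda>i. B \<inter> A i"] by simp
    also have "\<dots> \<le> (\<Sum>i. ennreal c * hdiam (A i) ^ m)"
      using A(2) by (intro suminf_le loc summableI) auto
    also have "(\<lambda>i. ennreal c * hdiam (A i) ^ m) = (\<lambda>i. ennreal (c * 2 ^ m) * (hdiam (A i) ^ m / 2 ^ m))"
    proof
      fix i
      have "ennreal (c * 2 ^ m) * (hdiam (A i) ^ m / 2 ^ m)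
          = ennreal c * hdiam (A i) ^ m * (2 ^ m / 2 ^ m)"
        using assms(2) by (simp add: ennreal_mult two ennreal_times_divide mult_ac)
      moreover have "(2 ^ m / 2 ^ m :: ennreal) = 1"
        by (rule ennreal_divide_self) (auto simp: two[symmetric] simp del: ennreal_numeral)
      ultimately show "ennreal c * hdiam (A i) ^ m = ennreal (c * 2 ^ m) * (hdiam (A i) ^ m / 2 ^ m)"
        by simp
    qed
    finally show ?thesis by (simp add: ennreal_suminf_cmult)
  qed
  \<comment> \<open>Dividing first lets the bound for each single cover pass to the infimum.\<close>
  then have "hausdorff m B / ennreal (c * 2 ^ m) \<le> hausdorff_pre m \<delta> B"
    unfolding hausdorff_pre_def using assms(2)
    by (intro INF_greatest divide_le_posI_ennreal) (auto simp: mult.commute)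
  then have "ennreal (c * 2 ^ m) * (hausdorff m B / ennreal (c * 2 ^ m))
      \<le> ennreal (c * 2 ^ m) * hausdorff_pre m \<delta> B"
    by (rule mult_left_mono) simp
  moreover have "ennreal (c * 2 ^ m) * (hausdorff m B / ennreal (c * 2 ^ m)) = hausdorff m B"
    using assms(2) by (simp add: ennreal_times_divide mult.commute[of "ennreal _"] ennreal_mult_divide_eq)
  ultimately have "hausdorff m B \<le> ennreal (c * 2 ^ m) * hausdorff_pre m \<delta> B" by simp
  also have "\<dots> \<le> ennreal (c * 2 ^ m) * hausdorff m B"
    using assms(1) by (intro mult_left_mono hausdorff_pre_le) auto
  finally show ?thesis .
qed

text \<open>A covering set of diameter below e cannot meet both A and B, so a fine cover of the
  union splits into covers of the two sets. This is the metric outer measure property behind the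
  measurability of closed sets.\<close>

lemma hausdorff_separated:
  assumes m: "0 < m" and e: "0 < e" and sep: "\<And>x y. x \<in> A \<Longrightarrow> y \<in> B \<Longrightarrow> e \<le> hdist x y"
  shows "hausdorff m A + hausdorff m B \<le> hausdorff m (A \<union> B)"
proof -
  have pre: "hausdorff_pre m \<delta> A + hausdorff_pre m \<delta> B \<le> hausdorff_pre m \<delta> (A \<union> B)"
    if d: "0 < \<delta>" "\<delta> < e" for \<delta>
    unfolding hausdorff_pre_def[of m \<delta> "A \<union> B"]
  proof (rule INF_greatest, clarify)
    fix C :: "nat \<Rightarrow> _" assume C: "A \<union> B \<subseteq> (\<Union>i. C i)" "\<forall>i. hdiam (C i) \<le> ennreal \<delta>"
    define CA CB where "CA i = (if C i \<inter> A = {} then {} else C i)"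
      and "CB i = (if C i \<inter> B = {} then {} else C i)" for i
    have disj: "C i \<inter> A = {} \<or> C i \<inter> B = {}" for i
    proof (rule ccontr)
      assume "\<not> ?thesis"
      then obtain x y where xy: "x \<in> C i" "x \<in> A" "y \<in> C i" "y \<in> B" by auto
      have "ennreal (hdist x y) \<le> ennreal \<delta>"
        using hdist_le_hdiam[OF xy(1,3)] C(2) order_trans by blast
      then have "hdist x y \<le> \<delta>" using d by simp
      then show False using sep[OF xy(2,4)] d by simp
    qed
    have "hausdorff_pre m \<delta> A \<le> (\<Sum>i. hdiam (CA i) ^ m / 2 ^ m)"
      using C by (intro hausdorff_pre_le_cover) (fastforce simp: CA_def)+
    moreover have "hausdorff_pre m \<delta> B \<le> (\<Sum>i. hdiam (CB i) ^ m / 2 ^ m)"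
      using C by (intro hausdorff_pre_le_cover) (fastforce simp: CB_def)+
    ultimately have "hausdorff_pre m \<delta> A + hausdorff_pre m \<delta> B
        \<le> (\<Sum>i. hdiam (CA i) ^ m / 2 ^ m) + (\<Sum>i. hdiam (CB i) ^ m / 2 ^ m)"
      by (rule add_mono)
    also have "\<dots> = (\<Sum>i. hdiam (CA i) ^ m / 2 ^ m + hdiam (CB i) ^ m / 2 ^ m)"
      by (intro suminf_add summableI)
    also have "\<dots> \<le> (\<Sum>i. hdiam (C i) ^ m / 2 ^ m)"
      using disj m by (intro suminf_le summableI) (auto simp: CA_def CB_def zero_power)
    finally show "hausdorff_pre m \<delta> A + hausdorff_pre m \<delta> B \<le> (\<Sum>i. hdiam (C i) ^ m / 2 ^ m)" .
  qed
  have anti: "hausdorff_pre m d2 X \<le> hausdorff_pre m d1 X" if "d1 \<le> d2" for d1 d2 and X :: "'a heis set"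
    unfolding hausdorff_pre_def
    using order_trans[OF _ ennreal_leI[OF that]] by (intro INF_superset_mono) auto
  have "hausdorff_pre m d1 A + hausdorff_pre m d2 B \<le> hausdorff m (A \<union> B)"
    if "0 < d1" "0 < d2" for d1 d2
  proof -
    \<comment> \<open>The two suprema have separate meshes; a common smaller one dominates both
      values and is fine enough for \<open>pre\<close>.\<close>
    define \<delta> where "\<delta> = min (min d1 d2) (e / 2)"
    have \<delta>: "0 < \<delta>" "\<delta> < e" "\<delta> \<le> d1" "\<delta> \<le> d2" using that e by (auto simp: \<delta>_def)
    have "hausdorff_pre m d1 A + hausdorff_pre m d2 B \<le> hausdorff_pre m \<delta> A + hausdorff_pre m \<delta> B"
      using \<delta> by (intro add_mono anti)
    also have "\<dots> \<le> hausdorff m (A \<union> B)"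
      using pre[OF \<delta>(1,2)] hausdorff_pre_le[OF \<delta>(1), of m "A \<union> B"] by simp
    finally show ?thesis .
  qed
  then show ?thesis
    unfolding hausdorff_eq_pre[of m A] hausdorff_eq_pre[of m B]
    by (simp add: ennreal_SUP_add_left[symmetric] ennreal_SUP_add_right SUP_le_iff)
qed

text \<open>The layers \<open>R n\<close> of \<open>X - C\<close> at distance about \<open>1 / n\<close> from \<open>C\<close> are mutually separated when their
  indices differ by at least two, so that their measures form a convergent series.\<close>

lemma hausdorff_closed_split:
  fixes X C :: "'n::finite heis set"
  assumes m: "0 < m" and C: "closed C" and fin: "hausdorff m X < \<infinity>"
  shows "hausdorff m (X \<inter> C) + hausdorff m (X - C) \<le> hausdorff m X"
proof -
  define Y where "Y n = {x\<in>X. \<forall>c\<in>C. 1 / real (Suc n) \<le> hdist x c}" for n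
  define R where "R n = Y (Suc n) - Y n" for n
  have Ymono: "Y n \<subseteq> Y k" if "n \<le> k" for n k
  proof -
    have "1 / real (Suc k) \<le> 1 / real (Suc n)" using that by (simp add: frac_le)
    then show ?thesis unfolding Y_def by (auto intro: order_trans)
  qed
  have YX: "Y n \<subseteq> X - C" for n
    by (force simp: Y_def)
  have cover: "X - C \<subseteq> Y n \<union> (\<Union>k. R (n + k))" for n
  proof
    fix x assume x: "x \<in> X - C"
    have "open (- C)" using C by auto
    then obtain e where e: "e > 0" "\<And>q. hdist x q < e \<Longrightarrow> q \<in> - C"
      using open_hdist_ball[of "- C" x] x by blast
    obtain k where k: "1 / real (Suc k) < e" using e(1) nat_approx_posE by blast
    have "x \<in> Y k" unfolding Y_def using x e(2) k by (auto simp: not_less[symmetric] dest: less_trans)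
    then have ex: "\<exists>k. x \<in> Y k" by blast
    define K where "K = (LEAST k. x \<in> Y k)"
    have K: "x \<in> Y K" unfolding K_def by (rule LeastI_ex[OF ex])
    show "x \<in> Y n \<union> (\<Union>k. R (n + k))"
    proof (cases "K \<le> n")
      case True then show ?thesis using K Ymono by blast
    next
      case False
      then obtain i where i: "K = Suc (n + i)" by (metis less_natE not_le_imp_less)
      have "x \<notin> Y (n + i)" using not_less_Least[of "n + i" "\<lambda>k. x \<in> Y k"] i K_def by simp
      then have "x \<in> R (n + i)" using K i by (simp add: R_def)
      then show ?thesis by blast
    qed
  qed
  \<comment> \<open>A point of layer i is at distance at least 1/(i + 2) from C, while a point of
    layer j has a point of C within 1/(j + 1).\<close>
  have R_sep: "1 / real (Suc (Suc i)) - 1 / real (Suc j) \<le> hdist x y"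
    if x: "x \<in> R i" and y: "y \<in> R j" for i j x y
  proof -
    obtain c where c: "c \<in> C" "hdist y c < 1 / real (Suc j)"
      using y by (auto simp: R_def Y_def)
    have "1 / real (Suc (Suc i)) \<le> hdist x c"
      using x c(1) by (auto simp: R_def Y_def)
    then show ?thesis using hdist_triangle[of x c y] c(2) by linarith
  qed
  have odd_sum: "(\<Sum>k<N. hausdorff m (R (2 * k + a))) \<le> hausdorff m (\<Union>k<N. R (2 * k + a))" for N a
  proof (induction N)
    case (Suc N)
    \<comment> \<open>The gap that \<open>R_sep\<close> gives between the layers 2k + a with k < N
      and the layer 2N + a. For N = 0 and a = 0 it is negative because \<open>1 / 0 = 0\<close>,
      hence the separate case, in which the union is empty.\<close>
    define e where "e = 1 / real (2 * N + a) - 1 / real (Suc (2 * N + a))"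
    have N: "(\<Union>k<Suc N. R (2 * k + a)) = (\<Union>k<N. R (2 * k + a)) \<union> R (2 * N + a)"
      by (auto simp: lessThan_Suc)
    have "hausdorff m (\<Union>k<N. R (2 * k + a)) + hausdorff m (R (2 * N + a))
        \<le> hausdorff m (\<Union>k<Suc N. R (2 * k + a))"
    proof (cases "N = 0")
      case False
      then have e: "e > 0" unfolding e_def by (simp add: divide_simps)
      show ?thesis unfolding N
      proof (rule hausdorff_separated[OF m e])
        fix x y assume "x \<in> (\<Union>k<N. R (2 * k + a))" and y: "y \<in> R (2 * N + a)"
        then obtain k where k: "k < N" "x \<in> R (2 * k + a)" by auto
        have "1 / real (2 * N + a) \<le> 1 / real (Suc (Suc (2 * k + a)))"
          using k(1) by (intro divide_left_mono) auto
        then show "e \<le> hdist x y" using R_sep[OF k(2) y] unfolding e_def by linarith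
      qed
    next
      case True
      have "(\<Union>k<N. R (2 * k + a)) = {}" using True by auto
      then show ?thesis unfolding N using True by (simp add: hausdorff_empty m)
    qed
    then show ?case
      unfolding sum.lessThan_Suc
      by (rule order_trans[OF add_right_mono[OF Suc]])
  qed (simp add: hausdorff_empty m)
  have RX: "R k \<subseteq> X" for k using YX by (auto simp: R_def)
  have fin_sum: "(\<Sum>k. hausdorff m (R k)) < \<infinity>"
  proof -
    have ha: "(\<Sum>k. hausdorff m (R (2 * k + a))) \<le> hausdorff m X" for a
    proof (rule suminf_le_const[OF summableI])
      fix N
      show "(\<Sum>k<N. hausdorff m (R (2 * k + a))) \<le> hausdorff m X"
        using odd_sum[where N=N and a=a] hausdorff_mono[of "\<Union>k<N. R (2 * k + a)" X m] RX
        by (meson UN_least order_trans)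
    qed
    have "(\<Sum>k<N. hausdorff m (R k)) \<le> hausdorff m X + hausdorff m X" for N
    proof -
      have "(\<Sum>k<N. hausdorff m (R k)) \<le> (\<Sum>k<2 * N. hausdorff m (R k))"
        by (intro sum_mono2) auto
      also have "\<dots> = (\<Sum>k<N. hausdorff m (R (2 * k + 0))) + (\<Sum>k<N. hausdorff m (R (2 * k + 1)))"
        by (induction N) (simp_all add: add_ac)
      also have "\<dots> \<le> (\<Sum>k. hausdorff m (R (2 * k + 0))) + (\<Sum>k. hausdorff m (R (2 * k + 1)))"
        by (intro add_mono sum_le_suminf summableI) auto
      also have "\<dots> \<le> hausdorff m X + hausdorff m X" by (intro add_mono ha)
      finally show ?thesis .
    qed
    then have "(\<Sum>k. hausdorff m (R k)) \<le> hausdorff m X + hausdorff m X"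
      by (intro suminf_le_const[OF summableI])
    also have "\<dots> < \<infinity>" using fin by simp
    finally show ?thesis .
  qed
  have step: "hausdorff m (X \<inter> C) + hausdorff m (X - C) \<le> hausdorff m X + (\<Sum>k. hausdorff m (R (k + n)))" for n
  proof -
    have "hausdorff m (X - C) \<le> hausdorff m (Y n \<union> (\<Union>k. R (n + k)))"
      by (rule hausdorff_mono[OF cover])
    also have "\<dots> \<le> hausdorff m (Y n) + hausdorff m (\<Union>k. R (n + k))"
      by (rule hausdorff_Un_le[OF m])
    also have "\<dots> \<le> hausdorff m (Y n) + (\<Sum>k. hausdorff m (R (n + k)))"
      by (intro add_left_mono hausdorff_countable_subadditive)
    finally have 1: "hausdorff m (X - C) \<le> hausdorff m (Y n) + (\<Sum>k. hausdorff m (R (k + n)))"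
      by (simp add: add.commute)
    have "hausdorff m (X \<inter> C) + hausdorff m (Y n) \<le> hausdorff m (X \<inter> C \<union> Y n)"
      by (rule hausdorff_separated[OF m, of "1 / real (Suc n)"]) (auto simp: Y_def hdist_commute)
    also have "\<dots> \<le> hausdorff m X" using YX by (intro hausdorff_mono) auto
    finally have 2: "hausdorff m (X \<inter> C) + hausdorff m (Y n) \<le> hausdorff m X" .
    have "hausdorff m (X \<inter> C) + hausdorff m (X - C)
        \<le> (hausdorff m (X \<inter> C) + hausdorff m (Y n)) + (\<Sum>k. hausdorff m (R (k + n)))"
      unfolding add.assoc by (rule add_left_mono[OF 1])
    also have "\<dots> \<le> hausdorff m X + (\<Sum>k. hausdorff m (R (k + n)))"
      by (rule add_right_mono[OF 2])
    finally show ?thesis .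
  qed
  have "(\<lambda>n. \<Sum>k. hausdorff m (R (k + n))) \<longlonglongrightarrow> 0"
  proof -
    have "\<exists>r. r \<ge> 0 \<and> hausdorff m (R k) = ennreal r" for k
      using ennreal_suminf_lessD[OF fin_sum, of k] by (cases "hausdorff m (R k)") auto
    then obtain r where r: "\<And>k. r k \<ge> 0" "\<And>k. hausdorff m (R k) = ennreal (r k)" by metis
    have s: "summable r"
      using fin_sum r by (auto intro!: summable_suminf_not_top simp: less_top)
    have eq: "(\<Sum>k. hausdorff m (R (k + n))) = ennreal (\<Sum>k. r (k + n))" for n
      using r s by (simp add: suminf_ennreal2 summable_iff_shift)
    show ?thesis unfolding eq using tendsto_ennrealI[OF suminf_exist_split2[OF s]] by simp
  qed
  then have "(\<lambda>n. hausdorff m X + (\<Sum>k. hausdorff m (R (k + n)))) \<longlonglongrightarrow> hausdorff m X + 0"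
    by (intro tendsto_intros)
  then show ?thesis
    using step by (intro LIMSEQ_le_const[where X = "\<lambda>n. hausdorff m X + (\<Sum>k. hausdorff m (R (k + n)))"]) auto
qed

text \<open>Restricting the outer measure to E gives one of finite total mass. Closed sets are
  Caratheodory measurable for it, since \<open>hausdorff_closed_split\<close> applies to every
  \<open>E \<inter> X\<close>, and they generate the Borel sets.\<close>

lemma hausdorff_borel_measure:
  fixes E :: "'n::finite heis set"
  assumes m: "0 < m" and fin: "hausdorff m E < \<infinity>"
  obtains M :: "'n heis measure"
  where "sets M = sets borel" "\<And>B. B \<in> sets borel \<Longrightarrow> emeasure M B = hausdorff m (E \<inter> B)"
proof -
  define f where "f B = hausdorff m (E \<inter> B)" for B
  interpret U: sigma_algebra UNIV "UNIV :: 'n heis set set"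
    using sigma_algebra_Pow[of UNIV] by simp
  have oms: "outer_measure_space UNIV f"
    unfolding outer_measure_space_def positive_def increasing_def countably_subadditive_def
  proof (intro conjI allI impI ballI)
    show "f {} = 0" by (simp add: f_def hausdorff_empty m)
    show "f x \<le> f y" if "x \<subseteq> y" for x y
      unfolding f_def using that by (intro hausdorff_mono) auto
    show "f (\<Union>i. A i) \<le> (\<Sum>i. f (A i))" for A :: "nat \<Rightarrow> _"
      unfolding f_def using hausdorff_countable_subadditive[of m "\<lambda>i. E \<inter> A i"] by simp
  qed
  from U.caratheodory_lemma[OF oms]
  have ms: "measure_space UNIV (lambda_system UNIV UNIV f) f" .
  then have sa: "sigma_algebra UNIV (lambda_system UNIV UNIV f)"
    by (simp add: measure_space_def)
  have "C \<in> lambda_system UNIV UNIV f" if "closed C" for C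
    unfolding lambda_system_def
  proof (intro CollectI conjI ballI)
    fix X :: "'n heis set"
    have "hausdorff m (E \<inter> X) < \<infinity>"
      using hausdorff_mono[of "E \<inter> X" E m] fin by (simp add: order_le_less_trans)
    moreover have "E \<inter> (C \<inter> X) = E \<inter> X \<inter> C" "E \<inter> ((UNIV - C) \<inter> X) = E \<inter> X - C" by auto
    ultimately have "f (C \<inter> X) + f ((UNIV - C) \<inter> X) \<le> f X"
      unfolding f_def using hausdorff_closed_split[OF m that, of "E \<inter> X"] by simp
    moreover have "f X \<le> f (C \<inter> X) + f ((UNIV - C) \<inter> X)"
    proof -
      have "E \<inter> X = E \<inter> (C \<inter> X) \<union> E \<inter> ((UNIV - C) \<inter> X)" by auto
      then show ?thesis
        using hausdorff_Un_le[OF m, of "E \<inter> (C \<inter> X)" "E \<inter> ((UNIV - C) \<inter> X)"]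
        unfolding f_def by simp
    qed
    ultimately show "f (C \<inter> X) + f ((UNIV - C) \<inter> X) = f X" by (rule antisym)
  qed simp
  then have "sigma_sets UNIV (Collect closed) \<subseteq> lambda_system UNIV UNIV f"
    by (intro sigma_algebra.sigma_sets_subset[OF sa]) auto
  then have sub: "sets borel \<subseteq> lambda_system UNIV UNIV f"
    by (simp add: borel_eq_closed)
  have pos: "positive (sets borel) f"
    using oms by (simp add: outer_measure_space_def positive_def)
  have ca: "countably_additive (sets borel) f"
    using ms sub unfolding measure_space_def countably_additive_def by blast
  define M where "M = measure_of UNIV (sets borel) f"
  have "sets M = sets borel"
    unfolding M_def using sets.sigma_sets_eq[of borel] by simp
  moreover have "emeasure M B = f B" if "B \<in> sets borel" for B
    unfolding M_def using pos ca that sets.sigma_algebra_axioms[of borel]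
    by (intro emeasure_measure_of_sigma) auto
  ultimately show ?thesis using that[of M] unfolding f_def by blast
qed

section \<open>Locally constant selection on compact sets\<close>

text \<open>Neither \<open>A\<close> nor the labels \<open>l\<close> are measurable.  The cylinders \<open>P \<tau>\<close> of points with a given initial
  label sequence \<open>\<tau>\<close> (stored in reverse order) are replaced by measurable envelopes \<open>G \<tau>\<close> inside their
  closures, which are then made disjoint along the tree of label sequences.\<close>

lemma locally_constant_selection:
  fixes M :: "'a::polish_space measure" and l :: "nat \<Rightarrow> 'a \<Rightarrow> nat"
  assumes sets: "sets M = sets borel" and fin: "emeasure M (space M) \<noteq> \<infinity>" and \<eta>: "0 < \<eta>"
  obtains K l' where "compact K" "outer_measure_of M A \<le> emeasure M K + ennreal \<eta>"
    "\<And>j x. x \<in> K \<Longrightarrow> x \<in> closure {p\<in>A. \<forall>i<j. l i p = l' i x}"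
    "\<And>j :: nat. \<exists>e>0. \<forall>x\<in>K. \<forall>y\<in>K. dist x y < e \<longrightarrow> (l' j x :: nat) = l' j y"
proof -
  interpret finite_measure M using fin by (rule finite_measureI)
  have [measurable_cong]: "sets M = sets borel" by (rule sets)
  have sp: "space M = UNIV" using sets_eq_imp_space_eq[OF sets] by simp
  \<comment> \<open>The newest label sits at the head, so that extending a label sequence is
    \<open>Cons\<close> and recursion on lists follows the tree.\<close>
  define code where "code p j = rev (map (\<lambda>i. l i p) [0..<j])" for p j
  have code_simps: "code p 0 = []" "code p (Suc j) = l j p # code p j" for p j
    by (simp_all add: code_def)
  define P where "P \<tau> = {p\<in>A. code p (length \<tau>) = \<tau>}" for \<tau>
  have P_split: "P \<tau> = (\<Union>v. P (v # \<tau>))" for \<tau>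
    by (auto simp: P_def code_simps)
  \<comment> \<open>A measurable part of the envelope that misses \<open>P \<tau>\<close> could be
    removed from it; as the envelope already has no more than the outer measure of
    \<open>P \<tau>\<close>, that part is null.\<close>
  have "\<exists>G. G \<in> sets M \<and> P \<tau> \<subseteq> G \<and> G \<subseteq> closure (P \<tau>) \<and>
      (\<forall>B\<in>sets M. B \<subseteq> G \<longrightarrow> P \<tau> \<inter> B = {} \<longrightarrow> B \<in> null_sets M)" for \<tau>
  proof -
    obtain E where E: "E \<in> sets M" "P \<tau> \<subseteq> E" "outer_measure_of M (P \<tau>) = emeasure M E"
      using outer_measure_of_attain[of "P \<tau>" M] sp by auto
    define G where "G = E \<inter> closure (P \<tau>)"
    have G: "G \<in> sets M" "P \<tau> \<subseteq> G" "G \<subseteq> closure (P \<tau>)" "G \<subseteq> E"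
      using E closure_subset[of "P \<tau>"] by (auto simp: G_def sets)
    have "B \<in> null_sets M" if B: "B \<in> sets M" "B \<subseteq> G" "P \<tau> \<inter> B = {}" for B
    proof -
      have "emeasure M G \<le> emeasure M E" using G E by (intro emeasure_mono)
      also have "\<dots> \<le> outer_measure_of M (G - B)"
        unfolding E(3)[symmetric] using G B by (intro outer_measure_of_mono) auto
      also have "\<dots> = emeasure M (G - B)" using G B by (intro outer_measure_of_eq) auto
      also have "\<dots> = emeasure M G - emeasure M B" using G B by (intro emeasure_Diff) auto
      finally have "emeasure M G \<le> emeasure M G - emeasure M B" .
      moreover have "emeasure M B \<le> emeasure M G" using G B by (intro emeasure_mono)
      ultimately have "measure M G \<le> measure M G - measure M B"
        by (simp add: emeasure_eq_measure ennreal_minus)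
      then have "measure M B = 0" using measure_nonneg[of M B] by linarith
      then show ?thesis using B(1) by (simp add: null_sets_def emeasure_eq_measure)
    qed
    then show ?thesis using G by blast
  qed
  then obtain G where G: "\<And>\<tau>. G \<tau> \<in> sets M" "\<And>\<tau>. P \<tau> \<subseteq> G \<tau>" "\<And>\<tau>. G \<tau> \<subseteq> closure (P \<tau>)"
    and G_null: "\<And>\<tau> B. B \<in> sets M \<Longrightarrow> B \<subseteq> G \<tau> \<Longrightarrow> P \<tau> \<inter> B = {} \<Longrightarrow> B \<in> null_sets M"
    by metis
  \<comment> \<open>Among the children of a node the least admissible label wins: envelopes of
    smaller labels are removed. Sets of one level become disjoint, at the price that points of
    \<open>D \<tau>\<close> need not belong to \<open>P \<tau>\<close>, only to its closure.\<close>
  define D where "D = rec_list (G []) (\<lambda>v \<tau> S. S \<inter> G (v # \<tau>) - (\<Union>u\<in>{..<v}. G (u # \<tau>)))"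
  have D_Nil: "D [] = G []" and D_Cons: "D (v # \<tau>) = D \<tau> \<inter> G (v # \<tau>) - (\<Union>u\<in>{..<v}. G (u # \<tau>))" for v \<tau>
    by (simp_all add: D_def)
  have D_sets: "D \<tau> \<in> sets M" for \<tau>
    by (induction \<tau>) (auto simp: D_Nil D_Cons G(1) intro!: sets.Diff sets.Int sets.finite_UN)
  have DG: "D \<tau> \<subseteq> G \<tau>" for \<tau>
    by (cases \<tau>) (auto simp: D_Nil D_Cons)
  have D_disj: "x \<in> D \<tau> \<Longrightarrow> x \<in> D \<sigma> \<Longrightarrow> length \<tau> = length \<sigma> \<Longrightarrow> \<tau> = \<sigma>" for x \<tau> \<sigma>
  proof (induction \<tau> arbitrary: \<sigma>)
    case (Cons v \<tau>)
    then obtain u \<rho> where \<sigma>: "\<sigma> = u # \<rho>" by (cases \<sigma>) auto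
    have "\<tau> = \<rho>" using Cons \<sigma> by (auto simp: D_Cons)
    moreover have "\<not> u < v" "\<not> v < u" using Cons.prems \<sigma> calculation by (auto simp: D_Cons)
    ultimately show ?case using \<sigma> by simp
  qed simp
  \<comment> \<open>A point of \<open>P \<tau>\<close> in \<open>D \<tau>\<close> lies in the
    envelope of some child and is caught by the least one. So the uncovered part of
    \<open>D \<tau>\<close> misses \<open>P \<tau>\<close> and is null by
    \<open>G_null\<close>.\<close>
  have D_split: "D \<tau> - (\<Union>v. D (v # \<tau>)) \<in> null_sets M" for \<tau>
  proof (rule G_null[of _ \<tau>])
    show "D \<tau> - (\<Union>v. D (v # \<tau>)) \<in> sets M" using D_sets by auto
    show "D \<tau> - (\<Union>v. D (v # \<tau>)) \<subseteq> G \<tau>" using DG by auto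
    have "x \<in> (\<Union>v. D (v # \<tau>))" if x: "x \<in> P \<tau>" "x \<in> D \<tau>" for x
    proof -
      have ex: "\<exists>v. x \<in> G (v # \<tau>)" using x(1) P_split[of \<tau>] G(2) by blast
      define v where "v = (LEAST v. x \<in> G (v # \<tau>))"
      have "x \<in> G (v # \<tau>)" unfolding v_def by (rule LeastI_ex[OF ex])
      moreover have "x \<notin> G (u # \<tau>)" if "u < v" for u using not_less_Least that unfolding v_def by blast
      ultimately have "x \<in> D (v # \<tau>)" using x(2) by (auto simp: D_Cons)
      then show ?thesis by blast
    qed
    then show "P \<tau> \<inter> (D \<tau> - (\<Union>v. D (v # \<tau>))) = {}" by auto
  qed
  define L where "L j = {\<tau> :: nat list. length \<tau> = j}" for j
  have cover: "G [] - (\<Union>\<tau>\<in>L j. D \<tau>) \<in> null_sets M" for j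
  proof (induction j)
    case 0 then show ?case by (simp add: L_def D_Nil)
  next
    case (Suc j)
    have *: "(G [] - (\<Union>\<tau>\<in>L j. D \<tau>)) \<union> (\<Union>\<tau>\<in>L j. D \<tau> - (\<Union>v. D (v # \<tau>))) \<in> null_sets M"
      using Suc D_split by (intro null_sets.Un null_sets_UN') auto
    have "G [] - (\<Union>\<tau>\<in>L (Suc j). D \<tau>) \<subseteq> (G [] - (\<Union>\<tau>\<in>L j. D \<tau>)) \<union> (\<Union>\<tau>\<in>L j. D \<tau> - (\<Union>v. D (v # \<tau>)))"
      by (fastforce simp: L_def)
    moreover have "G [] - (\<Union>\<tau>\<in>L (Suc j). D \<tau>) \<in> sets M"
      using G(1) D_sets by (intro sets.Diff sets.countable_UN'') auto
    ultimately show ?case using * null_sets_subset by blast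
  qed
  have "\<exists>C. compact C \<and> C \<subseteq> D \<tau> \<and> emeasure M (D \<tau> - C) \<le> ennreal e" if e: "e > 0" for \<tau> e
  proof -
    have "emeasure M (D \<tau>) = (SUP K\<in>{K. K \<subseteq> D \<tau> \<and> compact K}. emeasure M K)"
      using sets fin D_sets[of \<tau>] by (intro inner_regular) auto
    moreover have "{K. K \<subseteq> D \<tau> \<and> compact K} \<noteq> {}" by auto
    moreover have "emeasure M (D \<tau>) \<noteq> \<infinity>" by (simp add: emeasure_eq_measure)
    ultimately have "\<exists>C\<in>{K. K \<subseteq> D \<tau> \<and> compact K}. emeasure M (D \<tau>) < emeasure M C + e"
      by (intro SUP_approx_ennreal[OF e])
    then obtain C where C: "C \<subseteq> D \<tau>" "compact C" "emeasure M (D \<tau>) < emeasure M C + e" by auto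
    have Cs: "C \<in> sets M" using C(2) by (simp add: sets borel_compact)
    have "emeasure M (D \<tau> - C) = emeasure M (D \<tau>) - emeasure M C"
      using C Cs D_sets by (intro emeasure_Diff) auto
    also have "\<dots> \<le> ennreal e"
      using C(3) by (simp add: ennreal_minus_le_iff add.commute less_imp_le)
    finally show ?thesis using C by blast
  qed
  then have C_ex: "\<exists>C. \<forall>\<tau>. compact (C \<tau>) \<and> C \<tau> \<subseteq> D \<tau> \<and> emeasure M (D \<tau> - C \<tau>) \<le> ennreal (e * (1/2) ^ Suc (to_nat \<tau>))"
    if "e > 0" for e using that by (intro choice allI) simp
  have fin_cover: "\<exists>F C. finite F \<and> F \<subseteq> L j \<and> (\<forall>\<tau>\<in>F. compact (C \<tau>) \<and> C \<tau> \<subseteq> D \<tau>) \<and>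
      emeasure M (G [] - (\<Union>\<tau>\<in>F. C \<tau>)) \<le> ennreal (2 * e)" if e: "e > 0" for j e
  proof -
    obtain C where C: "\<And>\<tau>. compact (C \<tau>)" "\<And>\<tau>. C \<tau> \<subseteq> D \<tau>"
      "\<And>\<tau>. emeasure M (D \<tau> - C \<tau>) \<le> ennreal (e * (1/2) ^ Suc (to_nat \<tau>))"
      using C_ex[OF e] by metis
    have C_sets: "C \<tau> \<in> sets M" for \<tau> using C(1) by (simp add: sets borel_compact)
    \<comment> \<open>The guard \<open>to_nat (from_nat n) = n\<close> lets each list count once, at
      its own code, where its geometric weight belongs.\<close>
    define R where "R n = (if from_nat n \<in> L j \<and> to_nat (from_nat n :: nat list) = n
        then D (from_nat n) - C (from_nat n) else {})" for n
    define N where "N = (G [] - (\<Union>\<tau>\<in>L j. D \<tau>)) \<union> (\<Union>n. R n)"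
    have R_sets: "R n \<in> sets M" for n using D_sets C_sets by (auto simp: R_def)
    have N_sets: "N \<in> sets M" unfolding N_def using R_sets cover[of j] by auto
    have "emeasure M N \<le> emeasure M (\<Union>n. R n)"
      unfolding N_def using cover[of j] R_sets by (simp add: emeasure_Un_null_set Un_commute[of "G [] - _"])
    also have "\<dots> \<le> (\<Sum>n. emeasure M (R n))"
      using R_sets by (intro emeasure_subadditive_countably) auto
    also have "\<dots> \<le> (\<Sum>n. ennreal (e * (1/2) ^ Suc n))"
    proof (intro suminf_le summableI)
      show "emeasure M (R n) \<le> ennreal (e * (1/2) ^ Suc n)" for n
        using C(3)[of "from_nat n"] by (cases "to_nat (from_nat n :: nat list) = n") (auto simp: R_def)
    qed
    also have "\<dots> = ennreal e"
      using sums_mult[OF power_half_series, of e] e by (intro suminf_ennreal_eq) auto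
    finally have Ne: "emeasure M N \<le> ennreal e" .
    \<comment> \<open>Continuity from above along these decreasing sets replaces the countable
      family by finitely many compact sets, at the cost of doubling e.\<close>
    define U where "U n = G [] - (\<Union>\<tau>\<in>{\<tau>\<in>L j. to_nat \<tau> < n}. C \<tau>)" for n
    have finF: "finite {\<tau>\<in>L j. to_nat \<tau> < n}" for n
      by (rule finite_imageD[of to_nat]) (auto intro: finite_subset[of _ "{..<n}"] inj_on_subset[OF inj_to_nat])
    have U_sets: "U n \<in> sets M" for n unfolding U_def using G(1) C_sets finF by auto
    have "(\<lambda>n. emeasure M (U n)) \<longlonglongrightarrow> emeasure M (\<Inter>n. U n)"
      using U_sets by (intro Lim_emeasure_decseq) (auto simp: decseq_def U_def emeasure_finite)
    moreover have "(\<Inter>n. U n) \<subseteq> N"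
    proof
      fix x assume x: "x \<in> (\<Inter>n. U n)"
      show "x \<in> N"
      proof (cases "x \<in> (\<Union>\<tau>\<in>L j. D \<tau>)")
        case True
        then obtain \<tau> where \<tau>: "\<tau> \<in> L j" "x \<in> D \<tau>" by auto
        have "x \<in> U (Suc (to_nat \<tau>))" using x by blast
        then have "x \<notin> C \<tau>" using \<tau> by (auto simp: U_def)
        then have "x \<in> R (to_nat \<tau>)" using \<tau> by (simp add: R_def)
        then show ?thesis unfolding N_def by blast
      next
        case False then show ?thesis using x by (auto simp: N_def U_def)
      qed
    qed
    then have "emeasure M (\<Inter>n. U n) \<le> ennreal e"
      using emeasure_mono[OF _ N_sets] Ne order_trans by blast
    then have "emeasure M (\<Inter>n. U n) < ennreal (2 * e)"
      using e by (auto intro: order_le_less_trans simp: ennreal_less_iff)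
    ultimately have "eventually (\<lambda>n. emeasure M (U n) < ennreal (2 * e)) sequentially"
      by (rule order_tendstoD(2))
    then obtain n where "emeasure M (U n) < ennreal (2 * e)" by (auto simp: eventually_sequentially)
    then show ?thesis using finF[of n] C(1,2)
      by (intro exI[of _ "{\<tau>\<in>L j. to_nat \<tau> < n}"] exI[of _ C]) (auto simp: U_def less_imp_le)
  qed
  have "\<exists>F C. finite F \<and> F \<subseteq> L j \<and> (\<forall>\<tau>\<in>F. compact (C \<tau>) \<and> C \<tau> \<subseteq> D \<tau>) \<and>
      emeasure M (G [] - (\<Union>\<tau>\<in>F. C \<tau>)) \<le> ennreal (\<eta> * (1/2) ^ Suc j)" for j
    using fin_cover[of "\<eta> * (1/2) ^ Suc j / 2" j] \<eta> by simp
  then obtain F C where F: "\<And>j. finite (F j)" "\<And>j. F j \<subseteq> L j"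
    and C: "\<And>j \<tau>. \<tau> \<in> F j \<Longrightarrow> compact (C j \<tau>)" "\<And>j \<tau>. \<tau> \<in> F j \<Longrightarrow> C j \<tau> \<subseteq> D \<tau>"
    and small: "\<And>j. emeasure M (G [] - (\<Union>\<tau>\<in>F j. C j \<tau>)) \<le> ennreal (\<eta> * (1/2) ^ Suc j)"
    by metis
  define K where "K = (\<Inter>j. \<Union>\<tau>\<in>F j. C j \<tau>)"
  have Uc: "compact (\<Union>\<tau>\<in>F j. C j \<tau>)" for j using F C by (intro compact_UN) auto
  have "compact K"
  proof -
    have "closed K" unfolding K_def using Uc by (intro closed_INT) (auto simp: compact_imp_closed)
    moreover have "K = (\<Union>\<tau>\<in>F 0. C 0 \<tau>) \<inter> K" by (auto simp: K_def)
    ultimately show ?thesis using compact_Int_closed[OF Uc[of 0]] by metis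
  qed
  then have K_sets: "K \<in> sets M" by (simp add: sets borel_compact)
  have "emeasure M (G [] - K) \<le> ennreal \<eta>"
  proof -
    have s: "G [] - (\<Union>\<tau>\<in>F j. C j \<tau>) \<in> sets M" for j
      using G(1) Uc[of j] by (auto simp: sets borel_compact)
    have "G [] - K = (\<Union>j. G [] - (\<Union>\<tau>\<in>F j. C j \<tau>))" by (auto simp: K_def)
    then have "emeasure M (G [] - K) \<le> (\<Sum>j. emeasure M (G [] - (\<Union>\<tau>\<in>F j. C j \<tau>)))"
      using s emeasure_subadditive_countably[of "\<lambda>j. G [] - (\<Union>\<tau>\<in>F j. C j \<tau>)" M] by (simp only:) auto
    also have "\<dots> \<le> (\<Sum>n. ennreal (\<eta> * (1/2) ^ Suc n))"
      by (intro suminf_le summableI small)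
    also have "\<dots> = ennreal \<eta>"
      using sums_mult[OF power_half_series, of \<eta>] \<eta> by (intro suminf_ennreal_eq) auto
    finally show ?thesis .
  qed
  moreover have "outer_measure_of M A \<le> emeasure M (G [])"
    using outer_measure_of_mono[of A "G []" M] G(1,2)[of "[]"] by (simp add: P_def code_simps)
  moreover have "emeasure M (G []) \<le> emeasure M K + emeasure M (G [] - K)"
    using emeasure_subadditive[of K M "G [] - K"] emeasure_mono[of "G []" "K \<union> (G [] - K)" M] G(1) K_sets
    by (auto intro: order_trans)
  ultimately have meas: "outer_measure_of M A \<le> emeasure M K + ennreal \<eta>"
    by (meson add_left_mono order_trans)
  define t where "t j x = (THE \<tau>. length \<tau> = j \<and> x \<in> D \<tau>)" for j x
  have t: "t j x = \<tau>" if "length \<tau> = j" "x \<in> D \<tau>" for j x \<tau>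
    unfolding t_def using that D_disj by (intro the_equality) auto
  have t_in: "t j x \<in> F j \<and> x \<in> C j (t j x) \<and> length (t j x) = j \<and> x \<in> D (t j x)" if xK: "x \<in> K" for j x
  proof -
    obtain \<tau> where \<tau>: "\<tau> \<in> F j" "x \<in> C j \<tau>" using xK by (auto simp: K_def)
    then have "length \<tau> = j" "x \<in> D \<tau>" using C(2)[OF \<tau>(1)] F(2)[of j] by (auto simp: L_def)
    then show ?thesis using t[of \<tau> j x] \<tau> by simp
  qed
  define l' where "l' j x = hd (t (Suc j) x)" for j x
  have t_Suc: "t (Suc j) x = l' j x # t j x" if xK: "x \<in> K" for j x
  proof -
    obtain v \<tau> where v: "t (Suc j) x = v # \<tau>" using t_in[OF xK, of "Suc j"] by (cases "t (Suc j) x") auto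
    then have "x \<in> D \<tau>" "length \<tau> = j" using t_in[OF xK, of "Suc j"] by (auto simp: D_Cons)
    then show ?thesis using t v by (simp add: l'_def)
  qed
  have P_t: "P (t j x) = {p\<in>A. \<forall>i<j. l i p = l' i x}" if xK: "x \<in> K" for j x
  proof -
    have "code p j = t j x \<longleftrightarrow> (\<forall>i<j. l i p = l' i x)" for p
    proof (induction j)
      case 0 then show ?case using t_in[OF xK, of 0] by (simp add: code_simps)
    next
      case (Suc j) then show ?case by (auto simp: code_simps t_Suc[OF xK] less_Suc_eq)
    qed
    then show ?thesis using t_in[OF xK, of j] by (simp add: P_def)
  qed
  show ?thesis
  proof (rule that[OF \<open>compact K\<close> meas])
    show "x \<in> closure {p \<in> A. \<forall>i<j. l i p = l' i x}" if "x \<in> K" for j x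
      unfolding P_t[OF that, of j, symmetric]
      using t_in[OF that, of j] DG[of "t j x"] G(3)[of "t j x"] by auto
    fix j :: nat
    \<comment> \<open>Disjoint compact sets have positive distance, and each level has finitely many
      of them; this makes the new labels locally constant.\<close>
    have "\<exists>d>0. \<forall>x\<in>C (Suc j) \<tau>. \<forall>y\<in>C (Suc j) \<sigma>. d \<le> dist x y"
      if "\<tau> \<in> F (Suc j)" "\<sigma> \<in> F (Suc j)" "\<tau> \<noteq> \<sigma>" for \<tau> \<sigma>
    proof (cases "C (Suc j) \<tau> \<times> C (Suc j) \<sigma> = {}")
      case True then show ?thesis by (intro exI[of _ 1]) auto
    next
      case False
      have "compact (C (Suc j) \<tau> \<times> C (Suc j) \<sigma>)" using that C(1) by (intro compact_Times)
      then have "\<exists>z\<in>C (Suc j) \<tau> \<times> C (Suc j) \<sigma>. \<forall>w\<in>C (Suc j) \<tau> \<times> C (Suc j) \<sigma>.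
          dist (fst z) (snd z) \<le> dist (fst w) (snd w)"
        using False by (intro continuous_attains_inf continuous_intros)
      then obtain z where z: "z \<in> C (Suc j) \<tau> \<times> C (Suc j) \<sigma>"
        "\<And>w. w \<in> C (Suc j) \<tau> \<times> C (Suc j) \<sigma> \<Longrightarrow> dist (fst z) (snd z) \<le> dist (fst w) (snd w)"
        by blast
      have "fst z \<in> D \<tau>" "snd z \<in> D \<sigma>" using z(1) C(2)[OF that(1)] C(2)[OF that(2)] by auto
      moreover have "length \<tau> = length \<sigma>" using subsetD[OF F(2) that(1)] subsetD[OF F(2) that(2)] by (simp add: L_def)
      ultimately have "fst z \<noteq> snd z" using D_disj[of "fst z" \<tau> \<sigma>] that(3) by auto
      then show ?thesis using z(2) by (intro exI[of _ "dist (fst z) (snd z)"]) force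
    qed
    then obtain d where d: "\<And>\<tau> \<sigma>. \<tau> \<in> F (Suc j) \<Longrightarrow> \<sigma> \<in> F (Suc j) \<Longrightarrow> \<tau> \<noteq> \<sigma> \<Longrightarrow> d \<tau> \<sigma> > 0"
      "\<And>\<tau> \<sigma> x y. \<tau> \<in> F (Suc j) \<Longrightarrow> \<sigma> \<in> F (Suc j) \<Longrightarrow> \<tau> \<noteq> \<sigma> \<Longrightarrow> x \<in> C (Suc j) \<tau> \<Longrightarrow> y \<in> C (Suc j) \<sigma> \<Longrightarrow> d \<tau> \<sigma> \<le> dist x y"
      by metis
    define e where "e = Min (insert 1 ((\<lambda>(\<tau>, \<sigma>). d \<tau> \<sigma>) ` {(\<tau>, \<sigma>). \<tau> \<in> F (Suc j) \<and> \<sigma> \<in> F (Suc j) \<and> \<tau> \<noteq> \<sigma>}))"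
    have fs: "finite {(\<tau>, \<sigma>). \<tau> \<in> F (Suc j) \<and> \<sigma> \<in> F (Suc j) \<and> \<tau> \<noteq> \<sigma>}"
      by (rule finite_subset[of _ "F (Suc j) \<times> F (Suc j)"]) (use F(1) in auto)
    have "e > 0" unfolding e_def using fs d(1) by (subst Min_gr_iff) auto
    moreover have "l' j x = l' j y" if xy: "x \<in> K" "y \<in> K" "dist x y < e" for x y
    proof (rule ccontr)
      assume "l' j x \<noteq> l' j y"
      then have ne: "t (Suc j) x \<noteq> t (Suc j) y" by (auto simp: l'_def)
      have "e \<le> d (t (Suc j) x) (t (Suc j) y)"
        unfolding e_def using fs ne t_in[OF xy(1), of "Suc j"] t_in[OF xy(2), of "Suc j"]
        by (intro Min_le) auto
      also have "\<dots> \<le> dist x y"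
        using t_in[OF xy(1), of "Suc j"] t_in[OF xy(2), of "Suc j"] ne by (intro d(2)) auto
      finally show False using xy(3) by simp
    qed
    ultimately show "\<exists>e>0. \<forall>x\<in>K. \<forall>y\<in>K. dist x y < e \<longrightarrow> l' j x = l' j y" by blast
  qed
qed

section \<open>Horizontal gradients\<close>

text \<open>The Pansu differential of \<open>f\<close> at \<open>q\<close> is \<open>p \<mapsto> v \<bullet> hproj p\<close>.\<close>

definition has_hgrad :: "('n::finite heis \<Rightarrow> real) \<Rightarrow> 'n hvec \<Rightarrow> 'n heis \<Rightarrow> bool" where
  "has_hgrad f v q \<longleftrightarrow>
     ((\<lambda>p. (f p - f q - v \<bullet> (hproj p - hproj q)) / hdist p q) \<longlongrightarrow> 0) (at q)"

lemma has_hgrad_iff: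
  "has_hgrad f v q \<longleftrightarrow> (\<forall>e>0. \<exists>d>0. \<forall>p. hdist p q < d \<longrightarrow>
      \<bar>f p - f q - v \<bullet> (hproj p - hproj q)\<bar> \<le> e * hdist p q)"
proof -
  have *: "dist (A / hdist p q) 0 < e \<longleftrightarrow> \<bar>A\<bar> < e * hdist p q" if "p \<noteq> q" for A e p
  proof -
    have "dist (A / hdist p q) 0 = \<bar>A\<bar> / hdist p q" by (simp add: dist_real_def)
    then show ?thesis by (simp only: pos_divide_less_eq[OF hdist_pos[OF that]])
  qed
  show ?thesis
  proof
    assume "has_hgrad f v q"
    then have ev: "\<And>e. e > 0 \<Longrightarrow> \<forall>\<^sub>F p in at q. dist ((f p - f q - v \<bullet> (hproj p - hproj q)) / hdist p q) 0 < e"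
      unfolding has_hgrad_def by (rule tendstoD)
    show "\<forall>e>0. \<exists>d>0. \<forall>p. hdist p q < d \<longrightarrow>
      \<bar>f p - f q - v \<bullet> (hproj p - hproj q)\<bar> \<le> e * hdist p q"
    proof (intro allI impI)
      fix e :: real assume "e > 0"
      from ev[OF this] obtain d where d: "d > 0" "\<And>p. p \<noteq> q \<Longrightarrow> hdist p q < d \<Longrightarrow>
          dist ((f p - f q - v \<bullet> (hproj p - hproj q)) / hdist p q) 0 < e"
        unfolding eventually_at_hdist by blast
      have "\<bar>f p - f q - v \<bullet> (hproj p - hproj q)\<bar> \<le> e * hdist p q" if "hdist p q < d" for p
        using d(2)[OF _ that] * by (cases "p = q") (auto simp: less_imp_le)
      then show "\<exists>d>0. \<forall>p. hdist p q < d \<longrightarrow>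
          \<bar>f p - f q - v \<bullet> (hproj p - hproj q)\<bar> \<le> e * hdist p q"
        using d(1) by blast
    qed
  next
    assume R: "\<forall>e>0. \<exists>d>0. \<forall>p. hdist p q < d \<longrightarrow>
      \<bar>f p - f q - v \<bullet> (hproj p - hproj q)\<bar> \<le> e * hdist p q"
    show "has_hgrad f v q"
      unfolding has_hgrad_def
    proof (rule tendstoI)
      fix e :: real assume e: "e > 0"
      then obtain d where d: "d > 0" "\<And>p. hdist p q < d \<Longrightarrow>
          \<bar>f p - f q - v \<bullet> (hproj p - hproj q)\<bar> \<le> e / 2 * hdist p q"
        using R half_gt_zero by blast
      have "dist ((f p - f q - v \<bullet> (hproj p - hproj q)) / hdist p q) 0 < e"
        if "p \<noteq> q" "hdist p q < d" for p
        unfolding *[OF that(1)] using d(2)[OF that(2)] mult_pos_pos[OF e hdist_pos[OF that(1)]] by linarith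
      then show "\<forall>\<^sub>F p in at q. dist ((f p - f q - v \<bullet> (hproj p - hproj q)) / hdist p q) 0 < e"
        unfolding eventually_at_hdist using d(1) by blast
    qed
  qed
qed

lemma has_hgradD:
  assumes "has_hgrad f v q" "e > 0"
  obtains d where "d > 0" "\<And>p. hdist p q < d \<Longrightarrow> \<bar>f p - f q - v \<bullet> (hproj p - hproj q)\<bar> \<le> e * hdist p q"
  using assms unfolding has_hgrad_iff by blast

lemma has_hgrad_const: "has_hgrad (\<lambda>_. c) 0 q"
  unfolding has_hgrad_iff by (auto intro!: exI[of _ 1])

lemma has_hgrad_affine: "has_hgrad (\<lambda>p. v \<bullet> (hproj p - w)) v q"
  unfolding has_hgrad_iff by (auto intro!: exI[of _ 1] simp: inner_diff_right)

lemma has_hgrad_add: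
  assumes "has_hgrad f v q" "has_hgrad g w q"
  shows "has_hgrad (\<lambda>p. f p + g p) (v + w) q"
proof -
  have "(\<lambda>p. (f p + g p - (f q + g q) - (v + w) \<bullet> (hproj p - hproj q)) / hdist p q)
    = (\<lambda>p. (f p - f q - v \<bullet> (hproj p - hproj q)) / hdist p q + (g p - g q - w \<bullet> (hproj p - hproj q)) / hdist p q)"
    by (simp add: fun_eq_iff inner_add_left algebra_simps flip: add_divide_distrib)
  then show ?thesis
    using tendsto_add[OF assms[unfolded has_hgrad_def]] by (simp add: has_hgrad_def)
qed

lemma has_hgrad_local_lipschitz:
  assumes "has_hgrad f v q"
  obtains d where "d > 0" "\<And>p. hdist p q < d \<Longrightarrow> \<bar>f p - f q\<bar> \<le> (norm v + 1) * hdist p q"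
proof -
  obtain d where d: "d > 0" "\<And>p. hdist p q < d \<Longrightarrow> \<bar>f p - f q - v \<bullet> (hproj p - hproj q)\<bar> \<le> 1 * hdist p q"
    using has_hgradD[OF assms, of 1] by auto
  show ?thesis
  proof (rule that[OF d(1)])
    fix p assume p: "hdist p q < d"
    have "\<bar>v \<bullet> (hproj p - hproj q)\<bar> \<le> norm v * hdist p q"
      using Cauchy_Schwarz_ineq2[of v "hproj p - hproj q"]
        mult_left_mono[OF norm_hproj_diff_le[of p q] norm_ge_zero[of v]] by linarith
    then show "\<bar>f p - f q\<bar> \<le> (norm v + 1) * hdist p q"
      using d(2)[OF p] unfolding distrib_right by linarith
  qed
qed

lemma has_hgrad_isCont:
  assumes "has_hgrad f v q"
  shows "isCont f q"
  unfolding isCont_def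
proof -
  obtain d where d: "d > 0" "\<And>p. hdist p q < d \<Longrightarrow> \<bar>f p - f q\<bar> \<le> (norm v + 1) * hdist p q"
    using has_hgrad_local_lipschitz[OF assms] by blast
  have "((\<lambda>p. (norm v + 1) * hdist p q) \<longlongrightarrow> (norm v + 1) * hdist q q) (at q)"
    by (intro tendsto_intros)
  then have lim: "((\<lambda>p. (norm v + 1) * hdist p q) \<longlongrightarrow> 0) (at q)" by simp
  have "\<forall>\<^sub>F p in at q. norm (f p - f q) \<le> (norm v + 1) * hdist p q"
    unfolding eventually_at_hdist using d by auto
  from Lim_null_comparison[OF this lim]
  have "((\<lambda>p. f p - f q) \<longlongrightarrow> 0) (at q)" .
  then show "f \<midarrow>q\<rightarrow> f q" using LIM_zero_iff by blast
qed

lemma has_hgrad_compose: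
  assumes f: "has_hgrad f v q" and h: "(h has_real_derivative D) (at (f q))"
  shows "has_hgrad (\<lambda>p. h (f p)) (D *\<^sub>R v) q"
  unfolding has_hgrad_iff
proof (intro allI impI)
  fix e :: real assume e: "e > 0"
  define L where "L = norm v + 1"
  have L: "L > 0" by (simp add: L_def add_nonneg_pos)
  \<comment> \<open>Each error gets half of e: the nonlinearity of h is divided by the Lipschitz
    bound L of f, the error of f by the derivative, where \<open>\<bar>D\<bar> + 1\<close> keeps the
    denominator nonzero.\<close>
  define e1 where "e1 = e / 2 / L"
  define e2 where "e2 = e / 2 / (\<bar>D\<bar> + 1)"
  have e12: "e1 > 0" "e2 > 0" using e L by (auto simp: e1_def e2_def intro!: divide_pos_pos)
  have "(h has_derivative (\<lambda>x. D * x)) (at (f q))"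
    using h by (simp add: has_field_derivative_def)
  then obtain s where s: "s > 0" "\<And>y. \<bar>y - f q\<bar> < s \<Longrightarrow> \<bar>h y - h (f q) - D * (y - f q)\<bar> \<le> e1 * \<bar>y - f q\<bar>"
    using e12(1) unfolding has_derivative_at_alt by (metis real_norm_def)
  obtain d1 where d1: "d1 > 0" "\<And>p. hdist p q < d1 \<Longrightarrow> \<bar>f p - f q\<bar> \<le> L * hdist p q"
    using has_hgrad_local_lipschitz[OF f] unfolding L_def by blast
  obtain d2 where d2: "d2 > 0" "\<And>p. hdist p q < d2 \<Longrightarrow> \<bar>f p - f q - v \<bullet> (hproj p - hproj q)\<bar> \<le> e2 * hdist p q"
    using has_hgradD[OF f e12(2)] by blast
  define d where "d = min (min d1 d2) (s / L)"
  have "d > 0" using d1 d2 s L by (simp add: d_def)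
  moreover have "\<bar>h (f p) - h (f q) - D *\<^sub>R v \<bullet> (hproj p - hproj q)\<bar> \<le> e * hdist p q"
    if p: "hdist p q < d" for p
  proof -
    have 1: "\<bar>f p - f q\<bar> \<le> L * hdist p q" using p by (intro d1(2)) (simp add: d_def)
    also have "\<dots> < s" using p L by (simp add: d_def pos_less_divide_eq mult.commute)
    finally have "\<bar>h (f p) - h (f q) - D * (f p - f q)\<bar> \<le> e1 * \<bar>f p - f q\<bar>" by (rule s(2))
    also have "\<dots> \<le> e1 * (L * hdist p q)" using 1 e12 by (intro mult_left_mono) auto
    also have "\<dots> = e / 2 * hdist p q" using L by (simp add: e1_def)
    finally have a: "\<bar>h (f p) - h (f q) - D * (f p - f q)\<bar> \<le> e / 2 * hdist p q" .
    have "\<bar>D * (f p - f q) - D * (v \<bullet> (hproj p - hproj q))\<bar> = \<bar>D\<bar> * \<bar>f p - f q - v \<bullet> (hproj p - hproj q)\<bar>"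
      by (simp add: abs_mult[symmetric] algebra_simps)
    also have "\<dots> \<le> (\<bar>D\<bar> + 1) * (e2 * hdist p q)"
      using d2(2)[of p] p by (intro mult_mono) (auto simp: d_def)
    also have "\<dots> = e / 2 * hdist p q"
    proof -
      have c: "c * (x / c) = x" if "c \<noteq> 0" for c x :: real using that by simp
      have "(\<bar>D\<bar> + 1) * e2 = e / 2"
        unfolding e2_def by (rule c) linarith
      then show ?thesis by (simp only: mult.assoc[symmetric])
    qed
    finally have b: "\<bar>D * (f p - f q) - D * (v \<bullet> (hproj p - hproj q))\<bar> \<le> e / 2 * hdist p q" .
    show ?thesis using a b unfolding inner_scaleR_left by linarith
  qed
  ultimately show "\<exists>d>0. \<forall>p. hdist p q < d \<longrightarrow>
      \<bar>h (f p) - h (f q) - D *\<^sub>R v \<bullet> (hproj p - hproj q)\<bar> \<le> e * hdist p q" by blast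
qed

lemma has_hgrad_cmult: "has_hgrad f v q \<Longrightarrow> has_hgrad (\<lambda>p. c * f p) (c *\<^sub>R v) q"
  by (rule has_hgrad_compose) (auto intro!: derivative_eq_intros)

lemma has_hgrad_diff:
  "has_hgrad f v q \<Longrightarrow> has_hgrad g w q \<Longrightarrow> has_hgrad (\<lambda>p. f p - g p) (v - w) q"
  using has_hgrad_add[of f v q "\<lambda>p. (-1) * g p" "(-1) *\<^sub>R w"] has_hgrad_cmult[of g w q "-1"] by simp

text \<open>Polarisation reduces products to squares.\<close>

lemma has_hgrad_mult:
  assumes f: "has_hgrad f v q" and g: "has_hgrad g w q"
  shows "has_hgrad (\<lambda>p. f p * g p) (f q *\<^sub>R w + g q *\<^sub>R v) q"
proof -
  have sq: "has_hgrad (\<lambda>p. (h p)\<^sup>2) ((2 * h q) *\<^sub>R u) q" if "has_hgrad h u q" for h u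
    using that by (rule has_hgrad_compose) (auto intro!: derivative_eq_intros)
  have "has_hgrad (\<lambda>p. (1/4) * ((f p + g p)\<^sup>2 - (f p - g p)\<^sup>2))
      ((1/4) *\<^sub>R ((2 * (f q + g q)) *\<^sub>R (v + w) - (2 * (f q - g q)) *\<^sub>R (v - w))) q"
    by (intro has_hgrad_cmult has_hgrad_diff sq has_hgrad_add f g)
  moreover have "(1/4) * ((f p + g p)\<^sup>2 - (f p - g p)\<^sup>2) = f p * g p" for p
    by (simp add: power2_eq_square algebra_simps)
  moreover have "(1/4) *\<^sub>R ((2 * (f q + g q)) *\<^sub>R (v + w) - (2 * (f q - g q)) *\<^sub>R (v - w)) = f q *\<^sub>R w + g q *\<^sub>R v"
    (is "?l = ?r")
  proof -
    have "z \<bullet> ?l = z \<bullet> ?r" for z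
      by (simp add: inner_add_right inner_diff_right algebra_simps)
    then show ?thesis by (metis vector_eq_ldot)
  qed
  ultimately show ?thesis by simp
qed

lemma has_hgrad_local:
  assumes f: "has_hgrad f v q" and d: "d > 0" and eq: "\<And>p. hdist p q < d \<Longrightarrow> g p = f p"
  shows "has_hgrad g v q"
  unfolding has_hgrad_iff
proof (intro allI impI)
  fix e :: real assume "e > 0"
  then obtain d' where "d' > 0" "\<And>p. hdist p q < d' \<Longrightarrow> \<bar>f p - f q - v \<bullet> (hproj p - hproj q)\<bar> \<le> e * hdist p q"
    using has_hgradD[OF f] by blast
  then show "\<exists>d>0. \<forall>p. hdist p q < d \<longrightarrow> \<bar>g p - g q - v \<bullet> (hproj p - hproj q)\<bar> \<le> e * hdist p q"
    using d eq by (intro exI[of _ "min d d'"]) simp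
qed

text \<open>A small horizontal step from q against v would decrease f if v were nonzero. Besides
  uniqueness of the gradient, this gives vanishing gradients wherever a cutoff attains its extreme
  value 0 or 1.\<close>

lemma has_hgrad_minimum:
  assumes f: "has_hgrad f v q" and min: "\<And>p. f q \<le> f p"
  shows "v = 0"
proof (rule ccontr)
  assume "v \<noteq> 0"
  then have nv: "norm v > 0" by simp
  then have "norm v / 2 > 0" by simp
  then obtain d where d: "d > 0"
    "\<And>p. hdist p q < d \<Longrightarrow> \<bar>f p - f q - v \<bullet> (hproj p - hproj q)\<bar> \<le> norm v / 2 * hdist p q"
    using has_hgradD[OF f] by blast
  define r where "r = d / (2 * norm v)"
  have r: "r > 0" "r * norm v < d" using d nv by (auto simp: r_def)
  define p where "p = q \<odot> hlift (- r *\<^sub>R v)"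
  have hd: "hdist p q = r * norm v" using r by (simp add: p_def)
  have "hproj p - hproj q = - r *\<^sub>R v" by (simp add: p_def)
  then have "\<bar>f p - f q + r * (norm v)\<^sup>2\<bar> \<le> norm v / 2 * (r * norm v)"
    using d(2)[of p] r(2) hd by (simp add: power2_norm_eq_inner)
  then have "r * (norm v)\<^sup>2 \<le> r * (norm v)\<^sup>2 / 2"
  proof -
    define X where "X = r * (norm v)\<^sup>2"
    have "norm v / 2 * (r * norm v) = X / 2" by (simp add: X_def power2_eq_square)
    moreover have "f p - f q + X \<le> \<bar>f p - f q + X\<bar>" by simp
    ultimately show ?thesis
      using \<open>\<bar>f p - f q + r * (norm v)\<^sup>2\<bar> \<le> _\<close> min[of p] unfolding X_def[symmetric] by linarith
  qed
  moreover have "r * (norm v)\<^sup>2 > 0" using r nv by simp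
  ultimately show False by linarith
qed

lemma has_hgrad_maximum:
  assumes f: "has_hgrad f v q" and max: "\<And>p. f p \<le> f q"
  shows "v = 0"
  using has_hgrad_minimum[OF has_hgrad_cmult[OF f, of "-1"]] max by simp

lemma has_hgrad_unique: "has_hgrad f v q \<Longrightarrow> has_hgrad f w q \<Longrightarrow> v = w"
  using has_hgrad_minimum[OF has_hgrad_diff[of f v q f w]] by simp

lemma has_hgrad_hmult_left:
  assumes "has_hgrad f v (a \<odot> q)"
  shows "has_hgrad (\<lambda>p. f (a \<odot> p)) v q"
  unfolding has_hgrad_iff
proof (intro allI impI)
  fix e :: real assume "e > 0"
  then obtain d where d: "d > 0" "\<And>p. hdist p (a \<odot> q) < d \<Longrightarrow>
      \<bar>f p - f (a \<odot> q) - v \<bullet> (hproj p - hproj (a \<odot> q))\<bar> \<le> e * hdist p (a \<odot> q)"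
    using has_hgradD[OF assms] by blast
  have "\<bar>f (a \<odot> p) - f (a \<odot> q) - v \<bullet> (hproj p - hproj q)\<bar> \<le> e * hdist p q" if "hdist p q < d" for p
    using d(2)[of "a \<odot> p"] that by simp
  then show "\<exists>d>0. \<forall>p. hdist p q < d \<longrightarrow> \<bar>f (a \<odot> p) - f (a \<odot> q) - v \<bullet> (hproj p - hproj q)\<bar> \<le> e * hdist p q"
    using d(1) by blast
qed

lemma has_hgrad_dil:
  assumes f: "has_hgrad f v (dil r q)" and r: "r > 0"
  shows "has_hgrad (\<lambda>p. f (dil r p)) (r *\<^sub>R v) q"
  unfolding has_hgrad_iff
proof (intro allI impI)
  fix e :: real assume "e > 0"
  then have "e / r > 0" using r by simp
  then obtain d where d: "d > 0" "\<And>p. hdist p (dil r q) < d \<Longrightarrow>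
      \<bar>f p - f (dil r q) - v \<bullet> (hproj p - hproj (dil r q))\<bar> \<le> e / r * hdist p (dil r q)"
    using has_hgradD[OF f] by blast
  have "\<bar>f (dil r p) - f (dil r q) - r *\<^sub>R v \<bullet> (hproj p - hproj q)\<bar> \<le> e * hdist p q"
    if "hdist p q < d / r" for p
    using d(2)[of "dil r p"] that r
    by (simp add: hdist_dil pos_less_divide_eq mult.commute inner_diff_right right_diff_distrib)
  then show "\<exists>d>0. \<forall>p. hdist p q < d \<longrightarrow> \<bar>f (dil r p) - f (dil r q) - r *\<^sub>R v \<bullet> (hproj p - hproj q)\<bar> \<le> e * hdist p q"
    using d(1) r by (intro exI[of _ "d / r"]) simp
qed

lemma hcen_diff: "hcen p - hcen q = hcen (hinv q \<odot> p) + 2 * (hrot (hproj q) \<bullet> (hproj p - hproj q))"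
  by (simp add: hform_minus inner_diff_right flip: hform_inner)

text \<open>The remainder in \<open>hcen_diff\<close> is the central coordinate of the increment, of
  second order in \<open>hdist\<close>. The centre has homogeneous degree 2 and contributes to the
  gradient only through the rotated base point.\<close>

lemma has_hgrad_hcen: "has_hgrad hcen (2 *\<^sub>R hrot (hproj q)) q"
  unfolding has_hgrad_iff
proof (intro allI impI)
  fix e :: real assume e: "e > 0"
  have "\<bar>hcen p - hcen q - 2 *\<^sub>R hrot (hproj q) \<bullet> (hproj p - hproj q)\<bar> \<le> e * hdist p q"
    if "hdist p q < e" for p
  proof -
    have "\<bar>hcen (hinv q \<odot> p)\<bar> \<le> (hdist p q)\<^sup>2"
      using abs_hcen_le[of "hinv q \<odot> p"] by (simp add: hdist_def)
    also have "\<dots> \<le> e * hdist p q"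
      using that by (auto simp: power2_eq_square intro!: mult_right_mono)
    finally have "\<bar>hcen (hinv q \<odot> p)\<bar> \<le> e * hdist p q" .
    moreover have "hcen p - hcen q - 2 *\<^sub>R hrot (hproj q) \<bullet> (hproj p - hproj q) = hcen (hinv q \<odot> p)"
      using hcen_diff[of p q] unfolding inner_scaleR_left by linarith
    ultimately show ?thesis by (simp only:)
  qed
  then show "\<exists>d>0. \<forall>p. hdist p q < d \<longrightarrow>
      \<bar>hcen p - hcen q - 2 *\<^sub>R hrot (hproj q) \<bullet> (hproj p - hproj q)\<bar> \<le> e * hdist p q"
    using e by blast
qed

lemma has_hgrad_pansu: "has_hgrad f v q \<Longrightarrow> has_pansu_differential f (\<lambda>p. v \<bullet> hproj p) q"
  by (auto simp: has_hgrad_def has_pansu_differential_def hlinear_def inner_add_right inner_diff_right)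

text \<open>The Pansu differential is the inner product with the gradient, so Cauchy-Schwarz on the
  unit ball turns continuity of g into uniform convergence.\<close>

lemma C1H_onI:
  assumes "continuous_on U g" "\<And>q. q \<in> U \<Longrightarrow> has_hgrad f (g q) q"
  shows "C1H_on U f"
  unfolding C1H_on_def
proof (intro conjI ballI)
  have pd: "pansu_differential f q = (\<lambda>p. g q \<bullet> hproj p)" if "q \<in> U" for q
    using has_hgrad_pansu[OF assms(2)[OF that]] by (rule pansu_differential_eq)
  fix q assume q: "q \<in> U"
  show "\<exists>L. has_pansu_differential f L q" using has_hgrad_pansu[OF assms(2)[OF q]] by blast
  show "uniform_limit {v. hnorm v \<le> 1} (pansu_differential f) (pansu_differential f q) (at q within U)"
  proof (rule uniform_limitI)
    fix e :: real assume "e > 0"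
    then have "\<forall>\<^sub>F p in at q within U. dist (g p) (g q) < e"
      using assms(1) q by (auto simp: continuous_on_def dest: tendstoD)
    then show "\<forall>\<^sub>F p in at q within U. \<forall>v\<in>{v. hnorm v \<le> 1}.
        dist (pansu_differential f p v) (pansu_differential f q v) < e"
      unfolding eventually_at_filter
    proof eventually_elim
      case (elim p)
      show ?case
      proof (intro impI ballI)
        fix v :: "'a heis" assume p: "p \<noteq> q" "p \<in> U" and v: "v \<in> {v. hnorm v \<le> 1}"
        have "\<bar>(g p - g q) \<bullet> hproj v\<bar> \<le> norm (g p - g q) * norm (hproj v)"
          by (rule Cauchy_Schwarz_ineq2)
        also have "\<dots> \<le> norm (g p - g q) * 1"
          using v norm_hproj_le[of v] by (intro mult_left_mono) auto
        also have "\<dots> < e" using elim p by (simp add: dist_norm)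
        finally show "dist (pansu_differential f p v) (pansu_differential f q v) < e"
          by (simp add: pd[OF q] pd[OF p(2)] dist_real_def inner_diff_left)
      qed
    qed
  qed
qed

section \<open>Functions with a continuous horizontal gradient on the whole group\<close>

definition hC1 :: "('n::finite heis \<Rightarrow> real) \<Rightarrow> bool" where
  "hC1 f \<longleftrightarrow> (\<exists>g. continuous_on UNIV g \<and> (\<forall>q. has_hgrad f (g q) q))"

definition hgrad :: "('n::finite heis \<Rightarrow> real) \<Rightarrow> 'n heis \<Rightarrow> 'n hvec" where
  "hgrad f q = (THE v. has_hgrad f v q)"

lemma hgrad_eq: "has_hgrad f v q \<Longrightarrow> hgrad f q = v"
  unfolding hgrad_def using has_hgrad_unique by blast

lemma hC1I: "continuous_on UNIV g \<Longrightarrow> (\<And>q. has_hgrad f (g q) q) \<Longrightarrow> hC1 f"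
  unfolding hC1_def by blast

lemma hC1_has_hgrad: "hC1 f \<Longrightarrow> has_hgrad f (hgrad f q) q"
  unfolding hC1_def using hgrad_eq by metis

lemma hC1_continuous_hgrad: "hC1 f \<Longrightarrow> continuous_on UNIV (hgrad f)"
  unfolding hC1_def using hgrad_eq by (metis ext)

lemma hC1_continuous: "hC1 f \<Longrightarrow> continuous_on UNIV f"
  using hC1_has_hgrad has_hgrad_isCont continuous_at_imp_continuous_on by blast

lemma hC1_const: "hC1 (\<lambda>_. c)"
  by (rule hC1I[of "\<lambda>_. 0"]) (auto intro: has_hgrad_const)

lemma hC1_affine: "hC1 (\<lambda>p. v \<bullet> (hproj p - w))"
  by (rule hC1I[of "\<lambda>_. v"]) (auto intro: has_hgrad_affine)

lemma hC1_hcen: "hC1 hcen"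
  by (rule hC1I[OF _ has_hgrad_hcen]) (intro continuous_intros)

lemma hC1_add: "hC1 f \<Longrightarrow> hC1 g \<Longrightarrow> hC1 (\<lambda>p. f p + g p)"
  by (rule hC1I[OF _ has_hgrad_add[OF hC1_has_hgrad hC1_has_hgrad]])
     (intro continuous_intros hC1_continuous_hgrad)

lemma hC1_diff: "hC1 f \<Longrightarrow> hC1 g \<Longrightarrow> hC1 (\<lambda>p. f p - g p)"
  by (rule hC1I[OF _ has_hgrad_diff[OF hC1_has_hgrad hC1_has_hgrad]])
     (intro continuous_intros hC1_continuous_hgrad)

lemma hC1_mult: "hC1 f \<Longrightarrow> hC1 g \<Longrightarrow> hC1 (\<lambda>p. f p * g p)"
  by (rule hC1I[OF _ has_hgrad_mult[OF hC1_has_hgrad hC1_has_hgrad]])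
     (intro continuous_intros hC1_continuous_hgrad hC1_continuous)

lemma hC1_compose:
  assumes "hC1 f" "continuous_on UNIV h'" "\<And>x. (h has_real_derivative h' x) (at x)"
  shows "hC1 (\<lambda>p. h (f p))"
  by (rule hC1I[OF _ has_hgrad_compose[OF hC1_has_hgrad[OF assms(1)] assms(3)]])
     (intro continuous_intros hC1_continuous_hgrad hC1_continuous assms continuous_on_compose2[OF assms(2)] subset_UNIV)

lemma hC1_sum: "(\<And>i. i \<in> I \<Longrightarrow> hC1 (f i)) \<Longrightarrow> hC1 (\<lambda>p. \<Sum>i\<in>I. f i p)"
  by (induction I rule: infinite_finite_induct) (auto intro: hC1_const hC1_add)

lemma hC1_prod: "(\<And>i. i \<in> I \<Longrightarrow> hC1 (f i)) \<Longrightarrow> hC1 (\<lambda>p. \<Prod>i\<in>I. f i p)"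
  by (induction I rule: infinite_finite_induct) (auto intro: hC1_const hC1_mult)

lemma hC1_hmult_left: "hC1 f \<Longrightarrow> hC1 (\<lambda>p. f (a \<odot> p))"
  by (rule hC1I[OF _ has_hgrad_hmult_left[OF hC1_has_hgrad]])
     (intro continuous_intros continuous_on_compose2[OF hC1_continuous_hgrad] subset_UNIV)

lemma hC1_dil: "hC1 f \<Longrightarrow> r > 0 \<Longrightarrow> hC1 (\<lambda>p. f (dil r p))"
  by (rule hC1I[OF _ has_hgrad_dil[OF hC1_has_hgrad]])
     (intro continuous_intros continuous_on_compose2[OF hC1_continuous_hgrad] subset_UNIV)+

lemma hgrad_sum:
  "finite I \<Longrightarrow> (\<And>i. i \<in> I \<Longrightarrow> hC1 (f i)) \<Longrightarrow> hgrad (\<lambda>p. \<Sum>i\<in>I. f i p) q = (\<Sum>i\<in>I. hgrad (f i) q)"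
proof (induction I rule: finite_induct)
  case empty then show ?case by (simp add: hgrad_eq has_hgrad_const)
next
  case (insert i I)
  then show ?case
    using hgrad_eq[OF has_hgrad_add[OF hC1_has_hgrad[of "f i" q] hC1_has_hgrad[OF hC1_sum[of I f], of q]]] by simp
qed

lemma hgrad_mult: "hC1 f \<Longrightarrow> hC1 g \<Longrightarrow> hgrad (\<lambda>p. f p * g p) q = f q *\<^sub>R hgrad g q + g q *\<^sub>R hgrad f q"
  by (intro hgrad_eq has_hgrad_mult hC1_has_hgrad)

lemma hgrad_diff: "hC1 f \<Longrightarrow> hC1 g \<Longrightarrow> hgrad (\<lambda>p. f p - g p) q = hgrad f q - hgrad g q"
  by (intro hgrad_eq has_hgrad_diff hC1_has_hgrad)

lemma hgrad_affine: "hgrad (\<lambda>p. v \<bullet> (hproj p - w)) q = v"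
  by (intro hgrad_eq has_hgrad_affine)

lemma hgrad_hmult_left: "hC1 f \<Longrightarrow> hgrad (\<lambda>p. f (a \<odot> p)) q = hgrad f (a \<odot> q)"
  by (intro hgrad_eq has_hgrad_hmult_left hC1_has_hgrad)

lemma hgrad_dil: "hC1 f \<Longrightarrow> r > 0 \<Longrightarrow> hgrad (\<lambda>p. f (dil r p)) q = r *\<^sub>R hgrad f (dil r q)"
  by (intro hgrad_eq has_hgrad_dil hC1_has_hgrad)

lemma hgrad_minimum: "hC1 f \<Longrightarrow> (\<And>p. f q \<le> f p) \<Longrightarrow> hgrad f q = 0"
  using has_hgrad_minimum[OF hC1_has_hgrad] by blast

lemma hgrad_maximum: "hC1 f \<Longrightarrow> (\<And>p. f p \<le> f q) \<Longrightarrow> hgrad f q = 0"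
  using has_hgrad_maximum[OF hC1_has_hgrad] by blast

section \<open>A partition of unity at a fixed scale\<close>

text \<open>At the junction the difference quotient is itself glued from two quotients with the same
  limit; elsewhere the function is locally one of the two.\<close>

lemma has_real_derivative_glue:
  assumes f: "\<And>x. (f has_real_derivative f' x) (at x)" and g: "\<And>x. (g has_real_derivative g' x) (at x)"
    and eq: "f a = g a" "f' a = g' a"
  shows "((\<lambda>x. if x \<le> a then f x else g x) has_real_derivative (if x \<le> a then f' x else g' x)) (at x)"
proof -
  let ?h = "\<lambda>x. if x \<le> a then f x else g x"
  consider "x < a" | "x > a" | "x = a" by linarith
  then show ?thesis
  proof cases
    case 1
    then have ev: "\<forall>\<^sub>F y in nhds x. ?h y = f y"
      by (auto intro!: eventually_mono[OF eventually_nhds_in_open[of "{..<a}" x]])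
    show ?thesis using f[of x] 1 DERIV_cong_ev[OF refl ev refl, of "f' x"] by simp
  next
    case 2
    then have ev: "\<forall>\<^sub>F y in nhds x. ?h y = g y"
      by (auto intro!: eventually_mono[OF eventually_nhds_in_open[of "{a<..}" x]])
    show ?thesis using g[of x] 2 DERIV_cong_ev[OF refl ev refl, of "g' x"] by simp
  next
    case 3
    have "((\<lambda>y. if y \<le> a then (f y - f a) / (y - a) else (g y - g a) / (y - a)) \<longlongrightarrow> f' a) (at a)"
      using f[of a] g[of a] eq(2) unfolding has_field_derivative_iff
      by (intro filterlim_If) (auto intro: filterlim_mono[OF _ order_refl inf_le1])
    moreover have "(\<lambda>y. if y \<le> a then (f y - f a) / (y - a) else (g y - g a) / (y - a)) = (\<lambda>y. (?h y - ?h a) / (y - a))"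
      using eq(1) by auto
    ultimately show ?thesis using 3 unfolding has_field_derivative_iff by simp
  qed
qed

lemma continuous_on_glue:
  fixes f g :: "real \<Rightarrow> real"
  assumes "continuous_on UNIV f" "continuous_on UNIV g" "f a = g a"
  shows "continuous_on UNIV (\<lambda>x. if x \<le> a then f x else g x)"
  using assms by (intro continuous_on_cases_le[where h = "\<lambda>x. x"]) (auto intro: continuous_on_subset)

text \<open>A raised cosine: it is continuously differentiable at the ends of its support and, as
  cos(pi (s - 1)) = - cos(pi s), its integer translates sum to 1. No division by a sum is needed to
  normalise the partition of unity.\<close>

definition bump :: "real \<Rightarrow> real" where
  "bump t = (if t \<le> -1 then 0 else if t \<le> 1 then (1 + cos (pi * t)) / 2 else 0)"

lemma bump_C1: "\<exists>h'. continuous_on UNIV h' \<and> (\<forall>x. (bump has_real_derivative h' x) (at x))"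
proof -
  define c where "c t = (1 + cos (pi * t)) / 2" for t :: real
  define c' where "c' t = - (pi / 2) * sin (pi * t)" for t :: real
  have c: "(c has_real_derivative c' x) (at x)" for x
    unfolding c_def c'_def by (auto intro!: derivative_eq_intros)
  have z: "((\<lambda>_. 0) has_real_derivative (\<lambda>_. 0) x) (at x)" for x :: real by simp
  have e: "c 1 = 0" "c' 1 = 0" "c (- 1) = 0" "c' (- 1) = 0" by (simp_all add: c_def c'_def)
  define F where "F x = (if x \<le> 1 then c x else 0)" for x
  define F' where "F' x = (if x \<le> 1 then c' x else 0)" for x
  have F: "(F has_real_derivative F' x) (at x)" for x
    unfolding F_def F'_def by (rule has_real_derivative_glue[OF c z e(1,2)])
  have cc: "continuous_on UNIV c'" unfolding c'_def by (intro continuous_intros)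
  have cF: "continuous_on UNIV F'"
    unfolding F'_def by (intro continuous_on_glue cc) (auto simp: e)
  have "bump = (\<lambda>x. if x \<le> -1 then 0 else F x)"
    by (auto simp: bump_def F_def c_def)
  moreover have "((\<lambda>x. if x \<le> -1 then 0 else F x) has_real_derivative (if x \<le> -1 then 0 else F' x)) (at x)" for x
    by (rule has_real_derivative_glue[OF z F]) (auto simp: F_def F'_def e)
  moreover have "continuous_on UNIV (\<lambda>x. if x \<le> -1 then 0 else F' x)"
    by (intro continuous_on_glue cF) (auto simp: F'_def e)
  ultimately show ?thesis
    by (intro exI[of _ "\<lambda>x. if x \<le> -1 then 0 else F' x"] conjI allI) (simp_all only:)
qed

lemma bump_nonneg [simp]: "0 \<le> bump t"
proof -
  have "0 \<le> 1 + cos (pi * t)" using cos_ge_minus_one[of "pi * t"] by linarith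
  then show ?thesis by (simp add: bump_def)
qed

lemma bump_eq_0: "1 \<le> \<bar>t\<bar> \<Longrightarrow> bump t = 0"
  by (auto simp: bump_def abs_if split: if_splits)

lemma bump_int_support:
  assumes "bump (t - of_int z) \<noteq> 0" shows "z \<in> {\<lfloor>t\<rfloor>, \<lfloor>t\<rfloor> + 1}"
proof -
  have "\<bar>t - of_int z\<bar> < 1" using assms bump_eq_0 not_le by blast
  then have "z = \<lfloor>t\<rfloor> \<or> z = \<lfloor>t\<rfloor> + 1" by linarith
  then show ?thesis by simp
qed

lemma bump_sum: "(\<Sum>z\<in>{\<lfloor>t\<rfloor>, \<lfloor>t\<rfloor> + 1}. bump (t - of_int z)) = 1"
proof -
  define s where "s = t - of_int \<lfloor>t\<rfloor>"
  have s: "0 \<le> s" "s < 1" unfolding s_def by linarith+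
  have "cos (pi * (s - 1)) = - cos (pi * s)"
    by (simp add: right_diff_distrib cos_diff)
  then have "bump s + bump (s - 1) = 1"
    using s by (auto simp: bump_def add_divide_distrib diff_divide_distrib)
  then show ?thesis by (simp add: s_def algebra_simps)
qed

text \<open>The support is twice as long in the central direction, to match the even central
  coordinates of \<open>hlattice\<close>, which absorb the factor 2 of the group law.\<close>

definition hbump :: "'n::finite heis \<Rightarrow> real" where
  "hbump p = (\<Prod>i\<in>UNIV. bump (fst (hproj p) $ i)) * (\<Prod>i\<in>UNIV. bump (snd (hproj p) $ i)) * bump (hcen p / 2)"

lemma hC1_bump: "hC1 f \<Longrightarrow> hC1 (\<lambda>p. bump (f p))"
  using bump_C1 hC1_compose by metis

lemma hC1_hbump: "hC1 (hbump :: 'n::finite heis \<Rightarrow> real)"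
proof -
  have 1: "hC1 (\<lambda>p :: 'n heis. fst (hproj p) $ i)" for i
    using hC1_affine[of "(axis i 1, 0)" 0] by (simp add: inner_prod_def inner_axis')
  have 2: "hC1 (\<lambda>p :: 'n heis. snd (hproj p) $ i)" for i
    using hC1_affine[of "(0, axis i 1)" 0] by (simp add: inner_prod_def inner_axis')
  have 3: "hC1 (\<lambda>p :: 'n heis. hcen p / 2)"
    using hC1_mult[OF hC1_const[of "1/2"] hC1_hcen] by simp
  show ?thesis
    unfolding hbump_def by (intro hC1_mult hC1_prod hC1_bump 1 2 3)
qed

lemma hbump_nonneg [simp]: "0 \<le> hbump p"
  by (auto simp: hbump_def intro!: mult_nonneg_nonneg prod_nonneg)

lemma hbump_support:
  fixes p :: "'n::finite heis"
  assumes "hbump p \<noteq> 0"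
  shows "hnorm p \<le> 2 * real CARD('n) + 2"
proof -
  have b: "\<bar>t\<bar> \<le> 1" if "bump t \<noteq> 0" for t using bump_eq_0[of t] that by force
  have nz: "bump (fst (hproj p) $ i) \<noteq> 0" "bump (snd (hproj p) $ i) \<noteq> 0" "bump (hcen p / 2) \<noteq> 0" for i
    using assms by (auto simp: hbump_def)
  have 1: "\<bar>fst (hproj p) $ i\<bar> \<le> 1" "\<bar>snd (hproj p) $ i\<bar> \<le> 1" "\<bar>hcen p / 2\<bar> \<le> 1" for i
    by (rule b[OF nz(1)], rule b[OF nz(2)], rule b[OF nz(3)])
  have "norm (fst (hproj p)) \<le> (\<Sum>i\<in>UNIV. \<bar>fst (hproj p) $ i\<bar>)" by (rule norm_le_l1_cart)
  also have "\<dots> \<le> (\<Sum>i\<in>(UNIV::'n set). 1)" by (intro sum_mono 1)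
  finally have 2: "norm (fst (hproj p)) \<le> CARD('n)" by simp
  have "norm (snd (hproj p)) \<le> (\<Sum>i\<in>UNIV. \<bar>snd (hproj p) $ i\<bar>)" by (rule norm_le_l1_cart)
  also have "\<dots> \<le> (\<Sum>i\<in>(UNIV::'n set). 1)" by (intro sum_mono 1)
  finally have 3: "norm (snd (hproj p)) \<le> CARD('n)" by simp
  have "norm (hproj p) \<le> norm (fst (hproj p)) + norm (snd (hproj p))"
    using norm_Pair_le[of "fst (hproj p)" "snd (hproj p)"] by simp
  then have 4: "norm (hproj p) \<le> 2 * real CARD('n) + 2" using 2 3 by linarith
  have "2\<^sup>2 \<le> (2 * real CARD('n) + 2)\<^sup>2" by (intro power_mono) auto
  then have "\<bar>hcen p\<bar> \<le> (2 * real CARD('n) + 2)\<^sup>2" using 1(3) by simp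
  then show ?thesis using 4 by (simp add: hnorm_le_iff)
qed

lemma compact_hnorm_ball: "compact {p :: 'n::finite heis. hnorm p \<le> R}"
proof -
  have "closed {p :: 'n heis. hnorm p \<le> R}"
    by (intro closed_Collect_le continuous_intros)
  moreover have "bounded {p :: 'n heis. hnorm p \<le> R}"
    unfolding bounded_iff
  proof (intro exI[of _ "R + R\<^sup>2"] ballI)
    fix p :: "'n heis" assume "p \<in> {p. hnorm p \<le> R}"
    then have "hnorm p \<le> R" "(hnorm p)\<^sup>2 \<le> R\<^sup>2" by (auto intro: power_mono)
    then show "norm p \<le> R + R\<^sup>2" using norm_le_hnorm[of p] by linarith
  qed
  ultimately show ?thesis by (simp add: compact_eq_bounded_closed)
qed

text \<open>On a compact ball containing the support the continuous gradient is bounded; elsewhere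
  the function is at its minimum 0 and its gradient vanishes.\<close>

lemma hgrad_hbump_bounded: "\<exists>C>0. \<forall>p :: 'n::finite heis. norm (hgrad hbump p) \<le> C"
proof -
  define R where "R = 2 * real CARD('n) + 2"
  have "compact (hgrad hbump ` {p :: 'n heis. hnorm p \<le> R})"
    by (intro compact_continuous_image compact_hnorm_ball continuous_on_subset[OF hC1_continuous_hgrad[OF hC1_hbump]]) auto
  then have "bounded (hgrad hbump ` {p :: 'n heis. hnorm p \<le> R})" by (rule compact_imp_bounded)
  then obtain C where "\<forall>v\<in>hgrad hbump ` {p :: 'n heis. hnorm p \<le> R}. norm v \<le> C"
    unfolding bounded_iff ..
  then have C: "norm (hgrad hbump p) \<le> C" if "hnorm p \<le> R" for p :: "'n heis" using that by blast
  have "norm (hgrad hbump p) \<le> max C 1" for p :: "'n heis"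
  proof (cases "hbump p = 0")
    case True
    then have "hgrad hbump p = 0" by (intro hgrad_minimum hC1_hbump) simp
    then show ?thesis by simp
  next
    case False
    then show ?thesis using C[of p] hbump_support[of p] by (simp add: R_def)
  qed
  then show ?thesis by (intro exI[of _ "max C 1"]) auto
qed

section \<open>Translates of the bump along the integer lattice, and their dilations\<close>

type_synonym 'n hidx = "('n \<Rightarrow> int) \<times> ('n \<Rightarrow> int) \<times> int"

definition hlattice :: "'n::finite hidx \<Rightarrow> 'n heis" where
  "hlattice \<gamma> = ((\<chi> i. of_int (fst \<gamma> i)), (\<chi> i. of_int (fst (snd \<gamma>) i)), 2 * of_int (snd (snd \<gamma>)))"

lemma finite_hlattice_ball: "finite {\<gamma> :: 'n::finite hidx. hnorm (hlattice \<gamma>) \<le> R}"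
proof -
  define m where "m = \<lceil>R\<rceil>"
  define M where "M = \<lceil>R\<^sup>2\<rceil>"
  let ?F = "PiE (UNIV :: 'n set) (\<lambda>_. {-m..m})"
  have "{\<gamma> :: 'n hidx. hnorm (hlattice \<gamma>) \<le> R} \<subseteq> ?F \<times> ?F \<times> {-M..M}"
  proof
    fix \<gamma> :: "'n hidx" assume "\<gamma> \<in> {\<gamma>. hnorm (hlattice \<gamma>) \<le> R}"
    then have h: "hnorm (hlattice \<gamma>) \<le> R" by simp
    obtain a b c where \<gamma>: "\<gamma> = (a, b, c)" by (cases \<gamma>)
    have n: "norm (hproj (hlattice \<gamma>)) \<le> R" using norm_hproj_le[of "hlattice \<gamma>"] h by linarith
    have "\<bar>of_int (a i)\<bar> \<le> R" for i
    proof -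
      have "\<bar>fst (hproj (hlattice \<gamma>)) $ i\<bar> \<le> norm (fst (hproj (hlattice \<gamma>)))" by (rule component_le_norm_cart)
      also have "\<dots> \<le> R" using norm_fst_le[of "fst (hproj (hlattice \<gamma>))" "snd (hproj (hlattice \<gamma>))"] n by simp
      finally show ?thesis by (simp add: hlattice_def \<gamma>)
    qed
    then have "of_int \<bar>a i\<bar> \<le> R" for i by simp
    then have "\<bar>a i\<bar> \<le> m" for i unfolding m_def using le_of_int_ceiling[of R] by (metis of_int_le_iff order_trans)
    then have a: "a i \<in> {-m..m}" for i by (simp add: abs_le_iff minus_le_iff)
    have "\<bar>of_int (b i)\<bar> \<le> R" for i
    proof -
      have "\<bar>snd (hproj (hlattice \<gamma>)) $ i\<bar> \<le> norm (snd (hproj (hlattice \<gamma>)))" by (rule component_le_norm_cart)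
      also have "\<dots> \<le> R" using norm_snd_le[of "snd (hproj (hlattice \<gamma>))" "fst (hproj (hlattice \<gamma>))"] n by simp
      finally show ?thesis by (simp add: hlattice_def \<gamma>)
    qed
    then have "of_int \<bar>b i\<bar> \<le> R" for i by simp
    then have "\<bar>b i\<bar> \<le> m" for i unfolding m_def using le_of_int_ceiling[of R] by (metis of_int_le_iff order_trans)
    then have b: "b i \<in> {-m..m}" for i by (simp add: abs_le_iff minus_le_iff)
    have "\<bar>2 * of_int c\<bar> \<le> R\<^sup>2"
      using abs_hcen_le[of "hlattice \<gamma>"] power_mono[OF h hnorm_nonneg, of 2] by (simp add: hlattice_def \<gamma>)
    then have "of_int \<bar>c\<bar> \<le> R\<^sup>2" by simp
    then have "\<bar>c\<bar> \<le> M" unfolding M_def using le_of_int_ceiling[of "R\<^sup>2"] by (metis of_int_le_iff order_trans)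
    then have "c \<in> {-M..M}" by (simp add: abs_le_iff minus_le_iff)
    then show "\<gamma> \<in> ?F \<times> ?F \<times> {-M..M}" using a b by (simp add: \<gamma> PiE_def extensional_def Pi_def del: atLeastAtMost_iff)
  qed
  then show ?thesis by (rule finite_subset) (auto intro!: finite_cartesian_product finite_PiE)
qed

definition hbump_at :: "'n::finite hidx \<Rightarrow> 'n heis \<Rightarrow> real" where
  "hbump_at \<gamma> p = hbump (hinv (hlattice \<gamma>) \<odot> p)"

lemma hbump_at_eq:
  "hbump_at (a, b, c) p = (\<Prod>i\<in>UNIV. bump (fst (hproj p) $ i - of_int (a i))) *
     (\<Prod>i\<in>UNIV. bump (snd (hproj p) $ i - of_int (b i))) *
     bump (hcen p / 2 - hform (\<chi> i. of_int (a i), \<chi> i. of_int (b i)) (hproj p) - of_int c)"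
proof -
  have "hproj (hlattice (a, b, c)) = (\<chi> i. of_int (a i), \<chi> i. of_int (b i))" "hcen (hlattice (a, b, c)) = 2 * of_int c"
    by (simp_all add: hlattice_def)
  note l = this
  have "fst (hproj (hinv (hlattice (a, b, c)) \<odot> p)) $ i = fst (hproj p) $ i - of_int (a i)"
    "snd (hproj (hinv (hlattice (a, b, c)) \<odot> p)) $ i = snd (hproj p) $ i - of_int (b i)" for i
    by (simp_all add: l)
  moreover have "hcen (hinv (hlattice (a, b, c)) \<odot> p) / 2
      = hcen p / 2 - hform (\<chi> i. of_int (a i), \<chi> i. of_int (b i)) (hproj p) - of_int c"
    unfolding hcen_hmult hcen_hinv hproj_hinv hform_minus l by simp
  ultimately show ?thesis
    unfolding hbump_at_def hbump_def by (simp only:)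
qed

text \<open>For fixed horizontal indices the translation shifts the central coordinate by an amount
  that does not involve c. Summing over c first therefore gives 1 whatever the shift, and the
  remaining sums factor over the coordinates. Two integers per coordinate give the cardinality
  bound.\<close>

lemma hbump_at_partition:
  fixes p :: "'n::finite heis"
  obtains I :: "'n hidx set" where "finite I" "card I \<le> 2 ^ (2 * CARD('n) + 1)"
    "(\<Sum>\<gamma>\<in>I. hbump_at \<gamma> p) = 1" "\<And>\<gamma>. \<gamma> \<notin> I \<Longrightarrow> hbump_at \<gamma> p = 0"
proof -
  define x where "x = fst (hproj p)"
  define y where "y = snd (hproj p)"
  define \<tau> where "\<tau> a b = hcen p / 2 - hform (\<chi> i. of_int (a i), \<chi> i. of_int (b i)) (hproj p)" for a b :: "'n \<Rightarrow> int"
  have eq: "hbump_at (a, b, c) p = (\<Prod>i\<in>UNIV. bump (x $ i - of_int (a i))) *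
     (\<Prod>i\<in>UNIV. bump (y $ i - of_int (b i))) * bump (\<tau> a b - of_int c)" for a b c
    by (simp add: hbump_at_eq x_def y_def \<tau>_def)
  define A where "A = PiE UNIV (\<lambda>i. {\<lfloor>x $ i\<rfloor>, \<lfloor>x $ i\<rfloor> + 1})"
  define B where "B = PiE UNIV (\<lambda>i. {\<lfloor>y $ i\<rfloor>, \<lfloor>y $ i\<rfloor> + 1})"
  define T where "T a b = {\<lfloor>\<tau> a b\<rfloor>, \<lfloor>\<tau> a b\<rfloor> + 1}" for a b
  have fin: "finite A" "finite B" "finite (T a b)" for a b
    by (auto simp: A_def B_def T_def intro!: finite_PiE)
  have card: "card A = 2 ^ CARD('n)" "card B = 2 ^ CARD('n)" "card (T a b) = 2" for a b
    by (auto simp: A_def B_def T_def card_PiE numeral_2_eq_2)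
  define I where "I = (SIGMA a:A. SIGMA b:B. T a b)"
  have "card I = 2 ^ (2 * CARD('n) + 1)"
    unfolding I_def using fin card by (simp add: card_SigmaI power_add mult_2)
  moreover have "finite I" unfolding I_def using fin by auto
  moreover have "(\<Sum>\<gamma>\<in>I. hbump_at \<gamma> p) = 1"
  proof -
    have "(\<Sum>\<gamma>\<in>I. hbump_at \<gamma> p) = (\<Sum>a\<in>A. \<Sum>b\<in>B. \<Sum>c\<in>T a b. hbump_at (a, b, c) p)"
      unfolding I_def using fin by (simp add: sum.Sigma split_beta)
    also have "\<dots> = (\<Sum>a\<in>A. \<Sum>b\<in>B. (\<Prod>i\<in>UNIV. bump (x $ i - of_int (a i))) * (\<Prod>i\<in>UNIV. bump (y $ i - of_int (b i))))"
    proof (intro sum.cong refl)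
      show "(\<Sum>c\<in>T a b. hbump_at (a, b, c) p) = (\<Prod>i\<in>UNIV. bump (x $ i - of_int (a i))) * (\<Prod>i\<in>UNIV. bump (y $ i - of_int (b i)))" for a b
        unfolding eq sum_distrib_left[symmetric] T_def bump_sum by simp
    qed
    also have "\<dots> = (\<Sum>a\<in>A. (\<Prod>i\<in>UNIV. bump (x $ i - of_int (a i)))) * (\<Sum>b\<in>B. (\<Prod>i\<in>UNIV. bump (y $ i - of_int (b i))))"
      unfolding sum_product ..
    also have "(\<Sum>a\<in>A. \<Prod>i\<in>UNIV. bump (x $ i - of_int (a i))) = 1"
      unfolding A_def
      by (subst prod_sum_PiE[symmetric]) (auto simp only: bump_sum finite prod.neutral_const finite_insert finite.emptyI)
    also have "(\<Sum>b\<in>B. \<Prod>i\<in>UNIV. bump (y $ i - of_int (b i))) = 1"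
      unfolding B_def
      by (subst prod_sum_PiE[symmetric]) (auto simp only: bump_sum finite prod.neutral_const finite_insert finite.emptyI)
    finally show ?thesis by simp
  qed
  moreover have "\<gamma> \<in> I" if nz: "hbump_at \<gamma> p \<noteq> 0" for \<gamma>
  proof -
    obtain a b c where \<gamma>: "\<gamma> = (a, b, c)" by (cases \<gamma>)
    have b: "bump (x $ i - of_int (a i)) \<noteq> 0" "bump (y $ i - of_int (b i)) \<noteq> 0" "bump (\<tau> a b - of_int c) \<noteq> 0" for i
      using nz unfolding \<gamma> eq by auto
    have "a \<in> A" "b \<in> B" "c \<in> T a b"
      unfolding A_def B_def T_def
      using bump_int_support[OF b(1)] bump_int_support[OF b(2)] bump_int_support[OF b(3)] by auto
    then show ?thesis by (simp add: \<gamma> I_def)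
  qed
  ultimately show ?thesis using that[of I] by auto
qed

text \<open>Dilation by \<open>1 / r\<close> transports the unit-scale partition to scale r: the
  overlap bound N is unchanged, while diameters scale with r and gradients with
  \<open>1 / r\<close>. The last clause lets only finitely many bumps meet a bounded set.\<close>

lemma hpartition:
  obtains N :: nat and D C :: real and \<psi> :: "real \<Rightarrow> 'n::finite hidx \<Rightarrow> 'n heis \<Rightarrow> real"
  where "D > 0" "C > 0"
    "\<And>r \<gamma>. r > 0 \<Longrightarrow> hC1 (\<psi> r \<gamma>)" "\<And>r \<gamma> p. 0 \<le> \<psi> r \<gamma> p"
    "\<And>r p. r > 0 \<Longrightarrow> \<exists>I. finite I \<and> card I \<le> N \<and> (\<Sum>\<gamma>\<in>I. \<psi> r \<gamma> p) = 1 \<and> (\<forall>\<gamma>. \<gamma> \<notin> I \<longrightarrow> \<psi> r \<gamma> p = 0)"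
    "\<And>r \<gamma> p q. r > 0 \<Longrightarrow> \<psi> r \<gamma> p \<noteq> 0 \<Longrightarrow> \<psi> r \<gamma> q \<noteq> 0 \<Longrightarrow> hdist p q \<le> D * r"
    "\<And>r \<gamma> p. r > 0 \<Longrightarrow> norm (hgrad (\<psi> r \<gamma>) p) \<le> C / r"
    "\<And>r R. r > 0 \<Longrightarrow> finite {\<gamma>. \<exists>p. hnorm p \<le> R \<and> \<psi> r \<gamma> p \<noteq> 0}"
proof -
  define D where "D = 2 * real CARD('n) + 2"
  obtain C where C: "C > 0" "\<And>p :: 'n heis. norm (hgrad hbump p) \<le> C"
    using hgrad_hbump_bounded by blast
  define \<psi> :: "real \<Rightarrow> 'n hidx \<Rightarrow> 'n heis \<Rightarrow> real" where "\<psi> r \<gamma> p = hbump_at \<gamma> (dil (1 / r) p)" for r \<gamma> p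
  have C1: "hC1 (hbump_at \<gamma>)" for \<gamma> :: "'n hidx"
    unfolding hbump_at_def by (intro hC1_hmult_left hC1_hbump)
  have near: "hdist (dil (1 / r) p) (hlattice \<gamma>) \<le> D" if "\<psi> r \<gamma> p \<noteq> 0" for r \<gamma> and p :: "'n heis"
    using hbump_support[of "hinv (hlattice \<gamma>) \<odot> dil (1 / r) p"] that
    by (simp add: D_def \<psi>_def hbump_at_def hdist_def)
  show ?thesis
  proof (rule that[of "2 * D" C \<psi> "2 ^ (2 * CARD('n) + 1)"])
    show "2 * D > 0" by (simp add: D_def)
    show "C > 0" by (rule C)
    show "hC1 (\<psi> r \<gamma>)" if "r > 0" for r \<gamma>
      unfolding \<psi>_def using that by (intro hC1_dil C1) simp
    show "0 \<le> \<psi> r \<gamma> p" for r \<gamma> p by (simp add: \<psi>_def hbump_at_def)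
    show "\<exists>I. finite I \<and> card I \<le> 2 ^ (2 * CARD('n) + 1) \<and> (\<Sum>\<gamma>\<in>I. \<psi> r \<gamma> p) = 1 \<and> (\<forall>\<gamma>. \<gamma> \<notin> I \<longrightarrow> \<psi> r \<gamma> p = 0)" for r p
      unfolding \<psi>_def using hbump_at_partition[of "dil (1 / r) p"] by metis
    show "hdist p q \<le> 2 * D * r" if "r > 0" "\<psi> r \<gamma> p \<noteq> 0" "\<psi> r \<gamma> q \<noteq> 0" for r \<gamma> p q
    proof -
      have "hdist (dil (1 / r) p) (dil (1 / r) q) \<le> 2 * D"
        using near[OF that(2)] near[OF that(3)]
          hdist_triangle[of "dil (1 / r) p" "dil (1 / r) q" "hlattice \<gamma>"] hdist_commute[of "hlattice \<gamma>"] by simp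
      then show ?thesis using that(1) by (simp add: hdist_dil pos_divide_le_eq)
    qed
    show "norm (hgrad (\<psi> r \<gamma>) p) \<le> C / r" if "r > 0" for r \<gamma> p
    proof -
      have "hgrad (\<psi> r \<gamma>) p = (1 / r) *\<^sub>R hgrad (hbump_at \<gamma>) (dil (1 / r) p)"
        unfolding \<psi>_def using that by (intro hgrad_dil C1) simp
      also have "hgrad (hbump_at \<gamma>) (dil (1 / r) p) = hgrad hbump (hinv (hlattice \<gamma>) \<odot> dil (1 / r) p)"
        unfolding hbump_at_def by (rule hgrad_hmult_left[OF hC1_hbump])
      finally show ?thesis using C(2) that by (simp add: divide_right_mono)
    qed
    show "finite {\<gamma>. \<exists>p. hnorm p \<le> R \<and> \<psi> r \<gamma> p \<noteq> 0}" if "r > 0" for r R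
    proof (rule finite_subset[OF _ finite_hlattice_ball])
      show "{\<gamma>. \<exists>p. hnorm p \<le> R \<and> \<psi> r \<gamma> p \<noteq> 0} \<subseteq> {\<gamma>. hnorm (hlattice \<gamma>) \<le> 1 / r * R + D}"
      proof clarify
        fix a b c p assume p: "hnorm p \<le> R" "\<psi> r (a, b, c) p \<noteq> 0"
        have "hdist (hlattice (a, b, c)) 0 \<le> hdist (hlattice (a, b, c)) (dil (1 / r) p) + hdist (dil (1 / r) p) 0"
          by (rule hdist_triangle)
        moreover have "hdist (dil (1 / r) p) 0 \<le> 1 / r * R"
        proof -
          have "hinv 0 = (0 :: 'n heis)" by (rule heis_eqI) simp_all
          then have "hdist (dil (1 / r) p) 0 = 1 / r * hnorm p"
            using that by (simp add: hdist_def hmult_zero hnorm_dil)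
          then show ?thesis using p(1) that by (simp add: divide_right_mono)
        qed
        moreover have "hdist (hlattice (a, b, c)) 0 = hnorm (hlattice (a, b, c))"
          using hdist_hmult_self(1)[of 0 "hlattice (a, b, c)"] by (simp add: hmult_zero)
        ultimately show "hnorm (hlattice (a, b, c)) \<le> 1 / r * R + D"
          using near[OF p(2)] by (simp add: hdist_commute)
      qed
    qed
  qed
qed

section \<open>Whitney's extension theorem\<close>

lemma hdist_zero_right: "hdist p 0 = hnorm p"
  using hdist_hmult_self(1)[of 0 p] by (simp add: hmult_zero)

lemma hsetdist_le: "q \<in> K \<Longrightarrow> hsetdist p K \<le> hdist p q"
  unfolding hsetdist_def by (intro cINF_lower) (auto intro!: bdd_belowI[of _ 0])

lemma hsetdist_greatest: "K \<noteq> {} \<Longrightarrow> (\<And>q. q \<in> K \<Longrightarrow> c \<le> hdist p q) \<Longrightarrow> c \<le> hsetdist p K"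
  unfolding hsetdist_def by (intro cINF_greatest)

lemma hsetdist_triangle:
  assumes "K \<noteq> {}" shows "hsetdist p K \<le> hdist p p' + hsetdist p' K"
proof -
  have "hsetdist p K - hdist p p' \<le> hsetdist p' K"
  proof (rule hsetdist_greatest[OF assms])
    fix q assume "q \<in> K"
    then show "hsetdist p K - hdist p p' \<le> hdist p' q"
      using hsetdist_le[of q K p] hdist_triangle[of p q p'] by linarith
  qed
  then show ?thesis by linarith
qed

lemma hsetdist_attained:
  assumes "compact K" "K \<noteq> {}"
  obtains q where "q \<in> K" "hsetdist p K = hdist p q"
proof -
  have "\<exists>q\<in>K. \<forall>y\<in>K. hdist p q \<le> hdist p y"
    using assms by (intro continuous_attains_inf continuous_intros)
  then obtain q where q: "q \<in> K" "\<And>y. y \<in> K \<Longrightarrow> hdist p q \<le> hdist p y" by blast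
  then have "hsetdist p K = hdist p q"
    using hsetdist_le[of q K p] hsetdist_greatest[OF assms(2), of "hdist p q" p] by force
  then show ?thesis using that q by blast
qed

text \<open>With \<open>u\<^sub>j\<close> the sum of the bumps of scale \<open>r\<^sub>j\<close> that meet the \<open>r\<^sub>j\<close>-neighbourhood of \<open>K\<close>, the functions
  \<open>(u\<^sub>j\<^sub>+\<^sub>1 - u\<^sub>j\<^sub>+\<^sub>2) \<phi>\<^sub>j\<^sub>\<gamma>\<close> telescope to \<open>1\<close> near \<open>K\<close> and live where the distance to \<open>K\<close> is comparable
  to \<open>r\<^sub>j\<close>.\<close>

lemma whitney_partition:
  fixes K :: "'n::finite heis set"
  assumes K: "compact K" "K \<noteq> {}"
  obtains N :: nat and C \<rho> :: real and \<theta> :: "nat \<times> 'n hidx \<Rightarrow> 'n heis \<Rightarrow> real" and z :: "nat \<times> 'n hidx \<Rightarrow> 'n heis"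
  where "C > 0" "\<rho> > 0"
    "\<And>\<tau>. hC1 (\<theta> \<tau>)" "\<And>\<tau> p. \<bar>\<theta> \<tau> p\<bar> \<le> 1" "\<And>\<tau> p. p \<in> K \<Longrightarrow> \<theta> \<tau> p = 0"
    "\<And>p. p \<notin> K \<Longrightarrow> \<exists>e>0. finite {\<tau>. \<exists>p'. hdist p' p < e \<and> \<theta> \<tau> p' \<noteq> 0}"
    "\<And>p. p \<notin> K \<Longrightarrow> finite {\<tau>. \<theta> \<tau> p \<noteq> 0 \<or> hgrad (\<theta> \<tau>) p \<noteq> 0} \<and> card {\<tau>. \<theta> \<tau> p \<noteq> 0 \<or> hgrad (\<theta> \<tau>) p \<noteq> 0} \<le> N"
    "\<And>p T. p \<notin> K \<Longrightarrow> hsetdist p K < \<rho> \<Longrightarrow> finite T \<Longrightarrow> (\<forall>\<tau>. \<tau> \<notin> T \<longrightarrow> \<theta> \<tau> p = 0) \<Longrightarrow> (\<Sum>\<tau>\<in>T. \<theta> \<tau> p) = 1"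
    "\<And>\<tau> p. p \<notin> K \<Longrightarrow> \<theta> \<tau> p \<noteq> 0 \<or> hgrad (\<theta> \<tau>) p \<noteq> 0 \<Longrightarrow> z \<tau> \<in> K \<and> hdist p (z \<tau>) \<le> C * hsetdist p K"
    "\<And>\<tau> p. p \<notin> K \<Longrightarrow> norm (hgrad (\<theta> \<tau>) p) * hsetdist p K \<le> C"
proof -
  note [simp del] = split_paired_Ex split_paired_All
  obtain N :: nat and D C :: real and \<psi> :: "real \<Rightarrow> 'n::finite hidx \<Rightarrow> 'n heis \<Rightarrow> real"
    where DC: "D > 0" "C > 0"
    and \<psi>_C1: "\<And>r \<gamma>. r > 0 \<Longrightarrow> hC1 (\<psi> r \<gamma>)" and \<psi>_nn: "\<And>r \<gamma> p. 0 \<le> \<psi> r \<gamma> p"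
    and \<psi>_part: "\<And>r p. r > 0 \<Longrightarrow> \<exists>I. finite I \<and> card I \<le> N \<and> (\<Sum>\<gamma>\<in>I. \<psi> r \<gamma> p) = 1 \<and> (\<forall>\<gamma>. \<gamma> \<notin> I \<longrightarrow> \<psi> r \<gamma> p = 0)"
    and \<psi>_near: "\<And>r \<gamma> p q. r > 0 \<Longrightarrow> \<psi> r \<gamma> p \<noteq> 0 \<Longrightarrow> \<psi> r \<gamma> q \<noteq> 0 \<Longrightarrow> hdist p q \<le> D * r"
    and \<psi>_grad: "\<And>r \<gamma> p. r > 0 \<Longrightarrow> norm (hgrad (\<psi> r \<gamma>) p) \<le> C / r"
    and \<psi>_fin: "\<And>r R. r > 0 \<Longrightarrow> finite {\<gamma>. \<exists>p. hnorm p \<le> R \<and> \<psi> r \<gamma> p \<noteq> 0}"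
    by (rule hpartition, rule that) assumption+
  define dK where "dK p = hsetdist p K" for p
  have dK_pos: "dK p > 0" if p: "p \<notin> K" for p
  proof -
    obtain q where "q \<in> K" "dK p = hdist p q" unfolding dK_def using hsetdist_attained[OF K] by blast
    then show ?thesis using p hdist_pos[of p q] by auto
  qed
  have dK_lip: "dK p \<le> hdist p p' + dK p'" for p p' unfolding dK_def by (rule hsetdist_triangle[OF K(2)])
  \<comment> \<open>A bump of scale \<open>r j\<close> that meets the
    \<open>r j\<close>-neighbourhood of K stays within \<open>(1 + D) * r j\<close> of K. With
    consecutive scales in this ratio, \<open>u (Suc j)\<close> is 1 where the distance is below
    \<open>r (Suc j)\<close> and 0 where it is at least \<open>r j\<close>.\<close>
  define \<Lambda> where "\<Lambda> = 1 + D"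
  have \<Lambda>: "\<Lambda> > 1" using DC by (simp add: \<Lambda>_def)
  define r where "r j = (1 / \<Lambda>) ^ j" for j :: nat
  have r_pos: "r j > 0" for j using \<Lambda> by (simp add: r_def)
  have r_Suc: "r j = \<Lambda> * r (Suc j)" for j using \<Lambda> by (simp add: r_def)
  have r_mono: "r j \<le> r i" if "i \<le> j" for i j
    unfolding r_def using \<Lambda> that by (intro power_decreasing) auto
  have r_small: "\<exists>J. r J < e" if "e > 0" for e
    unfolding r_def using \<Lambda> that by (intro real_arch_pow_inv) auto
  define \<phi> where "\<phi> j = \<psi> (r j)" for j
  obtain I where I: "\<And>j p. finite (I j p)" "\<And>j p. card (I j p) \<le> N" "\<And>j p. (\<Sum>\<gamma>\<in>I j p. \<phi> j \<gamma> p) = 1"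
    "\<And>j p \<gamma>. \<gamma> \<notin> I j p \<Longrightarrow> \<phi> j \<gamma> p = 0"
    using \<psi>_part[OF r_pos] unfolding \<phi>_def by metis
  have \<phi>_C1: "hC1 (\<phi> j \<gamma>)" for j \<gamma> unfolding \<phi>_def by (rule \<psi>_C1[OF r_pos])
  have \<phi>_nn: "0 \<le> \<phi> j \<gamma> p" for j \<gamma> p unfolding \<phi>_def by (rule \<psi>_nn)
  have \<phi>_le1: "\<phi> j \<gamma> p \<le> 1" for j \<gamma> p
  proof (cases "\<gamma> \<in> I j p")
    case True
    then have "\<phi> j \<gamma> p \<le> (\<Sum>\<gamma>\<in>I j p. \<phi> j \<gamma> p)" using I(1) \<phi>_nn by (intro member_le_sum) auto
    then show ?thesis by (simp add: I(3))
  qed (simp add: I(4))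
  have \<phi>_grad0: "hgrad (\<phi> j \<gamma>) p = 0" if "\<phi> j \<gamma> p = 0" for j \<gamma> p
    using that \<phi>_nn by (intro hgrad_minimum \<phi>_C1) simp
  have \<phi>_near: "hdist p q \<le> D * r j" if "\<phi> j \<gamma> p \<noteq> 0" "\<phi> j \<gamma> q \<noteq> 0" for j \<gamma> p q
    using that \<psi>_near[OF r_pos] unfolding \<phi>_def by blast
  have \<phi>_grad: "norm (hgrad (\<phi> j \<gamma>) p) \<le> C / r j" for j \<gamma> p unfolding \<phi>_def by (rule \<psi>_grad[OF r_pos])
  define \<Gamma> where "\<Gamma> j = {\<gamma>. \<exists>p q. q \<in> K \<and> hdist p q < r j \<and> \<phi> j \<gamma> p \<noteq> 0}" for j
  have \<Gamma>_fin: "finite (\<Gamma> j)" for j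
  proof -
    have "\<exists>q\<in>K. \<forall>y\<in>K. hnorm y \<le> hnorm q"
      using K by (intro continuous_attains_sup continuous_intros)
    then obtain B where B: "\<And>y. y \<in> K \<Longrightarrow> hnorm y \<le> B" by blast
    have "\<Gamma> j \<subseteq> {\<gamma>. \<exists>p. hnorm p \<le> r j + B \<and> \<psi> (r j) \<gamma> p \<noteq> 0}"
    proof
      fix \<gamma> assume "\<gamma> \<in> \<Gamma> j"
      then obtain p q where pq: "q \<in> K" "hdist p q < r j" "\<psi> (r j) \<gamma> p \<noteq> 0"
        by (auto simp: \<Gamma>_def \<phi>_def)
      then have "hnorm p \<le> r j + B"
        using hdist_triangle[of p 0 q] B[OF pq(1)] by (simp add: hdist_zero_right)
      then show "\<gamma> \<in> {\<gamma>. \<exists>p. hnorm p \<le> r j + B \<and> \<psi> (r j) \<gamma> p \<noteq> 0}" using pq by blast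
    qed
    then show ?thesis using \<psi>_fin[OF r_pos] finite_subset by blast
  qed
  define u where "u j p = (\<Sum>\<gamma>\<in>\<Gamma> j. \<phi> j \<gamma> p)" for j p
  have u_C1: "hC1 (u j)" for j unfolding u_def by (intro hC1_sum \<phi>_C1)
  have u_nn: "0 \<le> u j p" for j p unfolding u_def by (intro sum_nonneg \<phi>_nn)
  have u_le1: "u j p \<le> 1" for j p
  proof -
    have "u j p = (\<Sum>\<gamma>\<in>\<Gamma> j \<inter> I j p. \<phi> j \<gamma> p)"
      unfolding u_def using \<Gamma>_fin I(4) by (intro sum.mono_neutral_right) auto
    also have "\<dots> \<le> (\<Sum>\<gamma>\<in>I j p. \<phi> j \<gamma> p)" using I(1) \<phi>_nn by (intro sum_mono2) auto
    finally show ?thesis by (simp add: I(3))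
  qed
  have u_eq1: "u j p = 1" if p: "dK p < r j" for j p
  proof -
    obtain q where q: "q \<in> K" "dK p = hdist p q" unfolding dK_def using hsetdist_attained[OF K] by blast
    have "\<gamma> \<in> \<Gamma> j" if "\<phi> j \<gamma> p \<noteq> 0" for \<gamma> using that q p by (auto simp: \<Gamma>_def)
    then have "(\<Sum>\<gamma>\<in>\<Gamma> j \<union> I j p. \<phi> j \<gamma> p) = u j p"
      unfolding u_def using \<Gamma>_fin I(1) by (intro sum.mono_neutral_right) auto
    moreover have "(\<Sum>\<gamma>\<in>\<Gamma> j \<union> I j p. \<phi> j \<gamma> p) = (\<Sum>\<gamma>\<in>I j p. \<phi> j \<gamma> p)"
      using \<Gamma>_fin I(1,4) by (intro sum.mono_neutral_right) auto
    ultimately show ?thesis using I(3) by simp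
  qed
  have \<phi>_dist: "hdist p q < \<Lambda> * r j" if "\<phi> j \<gamma> p \<noteq> 0" "\<phi> j \<gamma> p' \<noteq> 0" "hdist p' q < r j" for j \<gamma> p p' q
    using \<phi>_near[OF that(1,2)] hdist_triangle[of p q p'] that(3) by (simp add: \<Lambda>_def distrib_right)
  have u_eq0: "u j p = 0" if p: "\<Lambda> * r j \<le> dK p" for j p
  proof -
    have "\<phi> j \<gamma> p = 0" if \<gamma>: "\<gamma> \<in> \<Gamma> j" for \<gamma>
    proof (rule ccontr)
      assume nz: "\<phi> j \<gamma> p \<noteq> 0"
      obtain p' q where "q \<in> K" "hdist p' q < r j" "\<phi> j \<gamma> p' \<noteq> 0" using \<gamma> by (auto simp: \<Gamma>_def)
      then have "hdist p q < \<Lambda> * r j" "dK p \<le> hdist p q"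
        using \<phi>_dist nz by (auto simp: dK_def hsetdist_le)
      then show False using p by simp
    qed
    then show ?thesis unfolding u_def by simp
  qed
  have u_grad0: "hgrad (u j) p = 0" if "u j p = 0 \<or> u j p = 1" for j p
    using that
  proof
    assume "u j p = 0" then show ?thesis using u_nn by (intro hgrad_minimum u_C1) simp
  next
    assume "u j p = 1" then show ?thesis using u_le1 by (intro hgrad_maximum u_C1) simp
  qed
  have u_grad: "norm (hgrad (u j) p) \<le> N * C / r j" for j p
  proof -
    have "hgrad (u j) p = (\<Sum>\<gamma>\<in>\<Gamma> j. hgrad (\<phi> j \<gamma>) p)"
      unfolding u_def by (intro hgrad_sum \<Gamma>_fin \<phi>_C1)
    also have "\<dots> = (\<Sum>\<gamma>\<in>\<Gamma> j \<inter> I j p. hgrad (\<phi> j \<gamma>) p)"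
      using \<Gamma>_fin \<phi>_grad0 I(4) by (intro sum.mono_neutral_right) auto
    also have "norm \<dots> \<le> (\<Sum>\<gamma>\<in>\<Gamma> j \<inter> I j p. C / r j)"
      by (intro sum_norm_le \<phi>_grad)
    also have "\<dots> = real (card (\<Gamma> j \<inter> I j p)) * (C / r j)" by simp
    also have "\<dots> \<le> N * (C / r j)"
    proof (intro mult_right_mono)
      have "card (\<Gamma> j \<inter> I j p) \<le> card (I j p)" by (intro card_mono I(1)) auto
      then show "real (card (\<Gamma> j \<inter> I j p)) \<le> real N" using I(2)[of j p] by linarith
      show "0 \<le> C / r j" using DC r_pos[of j] by simp
    qed
    finally show ?thesis by simp
  qed
  \<comment> \<open>The difference of \<open>u\<close> at levels j + 1 and j + 2 is nonzero only
    where the distance is below \<open>r j\<close>. There \<open>u j\<close> is 1, so multiplying by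
    the level-j bumps and summing over \<open>\<Gamma> j\<close> loses nothing, and the sum over j
    telescopes.\<close>
  define \<theta> where "\<theta> \<tau> p = (if snd \<tau> \<in> \<Gamma> (fst \<tau>) then
      (u (Suc (fst \<tau>)) p - u (Suc (Suc (fst \<tau>))) p) * \<phi> (fst \<tau>) (snd \<tau>) p else 0)" for \<tau> p
  have \<theta>_eq: "\<theta> (j, \<gamma>) = (if \<gamma> \<in> \<Gamma> j then (\<lambda>p. (u (Suc j) p - u (Suc (Suc j)) p) * \<phi> j \<gamma> p) else (\<lambda>_. 0))" for j \<gamma>
    by (auto simp: \<theta>_def)
  have \<theta>_val: "\<theta> (j, \<gamma>) p = (if \<gamma> \<in> \<Gamma> j then (u (Suc j) p - u (Suc (Suc j)) p) * \<phi> j \<gamma> p else 0)" for j \<gamma> p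
    by (simp add: \<theta>_def)
  have \<theta>_C1: "hC1 (\<theta> \<tau>)" for \<tau>
    by (cases \<tau>) (auto simp: \<theta>_eq intro!: hC1_const hC1_mult hC1_diff u_C1 \<phi>_C1)
  have \<theta>_grad: "hgrad (\<theta> (j, \<gamma>)) p = (if \<gamma> \<in> \<Gamma> j then
      (u (Suc j) p - u (Suc (Suc j)) p) *\<^sub>R hgrad (\<phi> j \<gamma>) p + \<phi> j \<gamma> p *\<^sub>R (hgrad (u (Suc j)) p - hgrad (u (Suc (Suc j))) p)
      else 0)" for j \<gamma> p
    by (auto simp: \<theta>_eq hgrad_mult hC1_diff u_C1 \<phi>_C1 hgrad_diff hgrad_eq[OF has_hgrad_const])
  have u_diff: "\<bar>u i p - u j p\<bar> \<le> 1" for i j p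
    using u_nn[of i p] u_nn[of j p] u_le1[of i p] u_le1[of j p] by linarith
  have active: "\<gamma> \<in> \<Gamma> j \<and> \<phi> j \<gamma> p \<noteq> 0 \<and> r (Suc (Suc j)) \<le> dK p \<and> dK p < r j"
    if a: "\<theta> (j, \<gamma>) p \<noteq> 0 \<or> hgrad (\<theta> (j, \<gamma>)) p \<noteq> 0" for j \<gamma> p
  proof -
    have 1: "\<gamma> \<in> \<Gamma> j" using a by (auto simp: \<theta>_val \<theta>_grad split: if_splits)
    have 2: "\<phi> j \<gamma> p \<noteq> 0" using a 1 \<phi>_grad0[of j \<gamma> p] by (auto simp: \<theta>_val \<theta>_grad)
    \<comment> \<open>0 and 1 are the extreme values of each \<open>u i\<close>, so its gradient
      vanishes where they are attained; if both terms share such a value, their difference vanishes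
      together with its gradient.\<close>
    have zero: False if "u (Suc j) p = c" "u (Suc (Suc j)) p = c" "c = 0 \<or> c = 1" for c
      using a 1 that u_grad0[of "Suc j" p] u_grad0[of "Suc (Suc j)" p] by (auto simp: \<theta>_val \<theta>_grad)
    have 3: "r (Suc (Suc j)) \<le> dK p"
    proof (rule ccontr)
      assume "\<not> ?thesis"
      moreover have "r (Suc (Suc j)) \<le> r (Suc j)" by (rule r_mono) simp
      ultimately show False using zero[of 1] u_eq1[of p "Suc j"] u_eq1[of p "Suc (Suc j)"] by auto
    qed
    have 4: "dK p < r j"
    proof (rule ccontr)
      assume n: "\<not> ?thesis"
      moreover have "\<Lambda> * r (Suc (Suc j)) \<le> \<Lambda> * r (Suc j)" using \<Lambda> by (intro mult_left_mono r_mono) auto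
      ultimately show False using zero[of 0] u_eq0[of "Suc j" p] u_eq0[of "Suc (Suc j)" p] r_Suc[of j] by auto
    qed
    show ?thesis using 1 2 3 4 by blast
  qed
  define z where "z \<tau> = (SOME q. q \<in> K \<and> (\<exists>p. hdist p q < r (fst \<tau>) \<and> \<phi> (fst \<tau>) (snd \<tau>) p \<noteq> 0))" for \<tau>
  have z: "z (j, \<gamma>) \<in> K \<and> (\<exists>p. hdist p (z (j, \<gamma>)) < r j \<and> \<phi> j \<gamma> p \<noteq> 0)" if "\<gamma> \<in> \<Gamma> j" for j \<gamma>
  proof -
    have "\<exists>q. q \<in> K \<and> (\<exists>p. hdist p q < r j \<and> \<phi> j \<gamma> p \<noteq> 0)" using that by (auto simp: \<Gamma>_def)
    from someI_ex[OF this] show ?thesis by (simp add: z_def)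
  qed
  have r_two: "r j = \<Lambda>\<^sup>2 * r (Suc (Suc j))" for j
    using r_Suc[of j] r_Suc[of "Suc j"] by (simp add: power2_eq_square)
  \<comment> \<open>Where a weight is active, \<open>r (Suc (Suc j)) \<le> dK p < r j\<close>, and
    \<open>r j\<close> is \<open>\<Lambda>\<^sup>2 * r (Suc (Suc j))\<close>. So the centre is
    within \<open>\<Lambda> * r j\<close>, at most \<open>\<Lambda> ^ 3 * dK p\<close>, and the
    gradient bound \<open>(1 + 2 * N) * C / r (Suc (Suc j))\<close> times \<open>dK p\<close> is at
    most the second entry.\<close>
  define C' where "C' = max (\<Lambda> ^ 3) (\<Lambda>\<^sup>2 * ((1 + 2 * real N) * C))"
  show ?thesis
  proof (rule that[of C' "r 1" \<theta> "2 * N" z])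
    show "C' > 0" using \<Lambda> by (simp add: C'_def less_max_iff_disj)
    show "r 1 > 0" by (rule r_pos)
    show "hC1 (\<theta> \<tau>)" for \<tau> by (rule \<theta>_C1)
    show "\<bar>\<theta> \<tau> p\<bar> \<le> 1" for \<tau> p
    proof -
      obtain j \<gamma> where \<tau>: "\<tau> = (j, \<gamma>)" by (cases \<tau>)
      have "\<bar>(u (Suc j) p - u (Suc (Suc j)) p) * \<phi> j \<gamma> p\<bar> \<le> 1 * 1"
        unfolding abs_mult using u_diff[of "Suc j" p "Suc (Suc j)"] \<phi>_nn[of j \<gamma> p] \<phi>_le1[of j \<gamma> p]
        by (intro mult_mono) auto
      then show ?thesis by (simp add: \<tau> \<theta>_val)
    qed
    show "\<theta> \<tau> p = 0" if "p \<in> K" for \<tau> p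
    proof -
      have "dK p \<le> 0" using hsetdist_le[OF that, of p] by (simp add: dK_def)
      then have "u j p = 1" for j using r_pos[of j] by (intro u_eq1) simp
      then show ?thesis by (simp add: \<theta>_def)
    qed
    fix p assume p: "p \<notin> K"
    show "\<exists>e>0. finite {\<tau>. \<exists>p'. hdist p' p < e \<and> \<theta> \<tau> p' \<noteq> 0}"
    proof (intro exI conjI)
      show "dK p / 2 > 0" using dK_pos[OF p] by simp
      obtain J where J: "r J < dK p / 2" using r_small dK_pos[OF p] half_gt_zero by blast
      have "{\<tau>. \<exists>p'. hdist p' p < dK p / 2 \<and> \<theta> \<tau> p' \<noteq> 0} \<subseteq> (SIGMA j:{..<J}. \<Gamma> j)"
      proof clarify
        fix j a b c p' assume p': "hdist p' p < dK p / 2" "\<theta> (j, a, b, c) p' \<noteq> 0"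
        have "dK p / 2 < dK p'" using dK_lip[of p p'] p'(1) by (simp add: hdist_commute)
        moreover have "dK p' < r j" "(a, b, c) \<in> \<Gamma> j" using active[of j "(a, b, c)" p'] p'(2) by auto
        ultimately have "r J < r j" using J by linarith
        then have "j < J" using r_mono[of J j] by (cases "j < J") auto
        then show "j \<in> {..<J} \<and> (a, b, c) \<in> \<Gamma> j" using \<open>(a, b, c) \<in> \<Gamma> j\<close> by simp
      qed
      moreover have "finite (SIGMA j:{..<J}. \<Gamma> j)" using \<Gamma>_fin by auto
      ultimately show "finite {\<tau>. \<exists>p'. hdist p' p < dK p / 2 \<and> \<theta> \<tau> p' \<noteq> 0}" by (rule finite_subset)
    qed
    define S where "S = {\<tau>. \<theta> \<tau> p \<noteq> 0 \<or> hgrad (\<theta> \<tau>) p \<noteq> 0}"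
    \<comment> \<open>Active levels satisfy \<open>r (Suc (Suc j)) \<le> dK p < r j\<close>; as r
      decreases, only \<open>j0\<close> and its successor can qualify, whence
      \<open>2 * N\<close>.\<close>
    define j0 where "j0 = (LEAST j. r (Suc (Suc j)) \<le> dK p)"
    have S_sub: "S \<subseteq> (SIGMA j:{j0, Suc j0}. I j p)"
    proof clarify
      fix j a b c assume "(j, a, b, c) \<in> S"
      then have act: "\<phi> j (a, b, c) p \<noteq> 0" "r (Suc (Suc j)) \<le> dK p" "dK p < r j"
        using active[of j "(a, b, c)" p] by (auto simp: S_def)
      have "j0 \<le> j" unfolding j0_def using act(2) by (rule Least_le)
      moreover have "r (Suc (Suc j0)) \<le> dK p" unfolding j0_def using act(2) by (rule LeastI)
      then have "j < Suc (Suc j0)" using act(3) r_mono[of "Suc (Suc j0)" j] by (cases "j < Suc (Suc j0)") auto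
      ultimately have "j \<in> {j0, Suc j0}" by auto
      then show "j \<in> {j0, Suc j0} \<and> (a, b, c) \<in> I j p" using act(1) I(4) by blast
    qed
    have fin: "finite (SIGMA j:{j0, Suc j0}. I j p)" using I(1) by auto
    have "card S \<le> card (SIGMA j:{j0, Suc j0}. I j p)" by (rule card_mono[OF fin S_sub])
    also have "\<dots> = card (I j0 p) + card (I (Suc j0) p)" using I(1) by (simp add: card_SigmaI)
    also have "\<dots> \<le> 2 * N" using I(2)[of j0 p] I(2)[of "Suc j0" p] by linarith
    finally show "finite {\<tau>. \<theta> \<tau> p \<noteq> 0 \<or> hgrad (\<theta> \<tau>) p \<noteq> 0} \<and> card {\<tau>. \<theta> \<tau> p \<noteq> 0 \<or> hgrad (\<theta> \<tau>) p \<noteq> 0} \<le> 2 * N"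
      using finite_subset[OF S_sub fin] unfolding S_def by blast
    show "(\<Sum>\<tau>\<in>T. \<theta> \<tau> p) = 1" if near: "hsetdist p K < r 1" and T: "finite T" "\<forall>\<tau>. \<tau> \<notin> T \<longrightarrow> \<theta> \<tau> p = 0" for T
    proof -
      obtain J where J: "r J < dK p" using r_small dK_pos[OF p] by blast
      define T0 where "T0 = (SIGMA j:{..<J}. \<Gamma> j)"
      have T0_fin: "finite T0" unfolding T0_def using \<Gamma>_fin by auto
      have T0: "\<theta> \<tau> p = 0" if "\<tau> \<notin> T0" for \<tau>
      proof (rule ccontr)
        assume nz: "\<theta> \<tau> p \<noteq> 0"
        obtain j \<gamma> where \<tau>: "\<tau> = (j, \<gamma>)" by (cases \<tau>)
        have "dK p < r j" "\<gamma> \<in> \<Gamma> j" using active[of j \<gamma> p] nz \<tau> by auto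
        then have "j < J" using r_mono[of J j] J by (cases "j < J") auto
        then show False using that \<tau> \<open>\<gamma> \<in> \<Gamma> j\<close> by (simp add: T0_def)
      qed
      have "(\<Sum>\<tau>\<in>T. \<theta> \<tau> p) = (\<Sum>\<tau>\<in>T \<union> T0. \<theta> \<tau> p)"
        using T T0_fin by (intro sum.mono_neutral_left) auto
      also have "\<dots> = (\<Sum>\<tau>\<in>T0. \<theta> \<tau> p)"
        using T(1) T0_fin T0 by (intro sum.mono_neutral_right) auto
      also have "\<dots> = (\<Sum>j<J. \<Sum>\<gamma>\<in>\<Gamma> j. \<theta> (j, \<gamma>) p)"
        unfolding T0_def using \<Gamma>_fin by (simp add: sum.Sigma)
      also have "\<dots> = (\<Sum>j<J. u (Suc j) p - u (Suc (Suc j)) p)"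
      proof (intro sum.cong refl)
        fix j
        have "(\<Sum>\<gamma>\<in>\<Gamma> j. \<theta> (j, \<gamma>) p) = (u (Suc j) p - u (Suc (Suc j)) p) * u j p"
          unfolding u_def[of j] sum_distrib_left by (intro sum.cong refl) (simp add: \<theta>_eq)
        also have "\<dots> = u (Suc j) p - u (Suc (Suc j)) p"
        proof (cases "dK p < r j")
          case True then show ?thesis by (simp add: u_eq1)
        next
          case False
          have "\<Lambda> * r (Suc (Suc j)) \<le> \<Lambda> * r (Suc j)" using \<Lambda> by (intro mult_left_mono r_mono) auto
          then show ?thesis using False u_eq0[of "Suc j" p] u_eq0[of "Suc (Suc j)" p] r_Suc[of j] by simp
        qed
        finally show "(\<Sum>\<gamma>\<in>\<Gamma> j. \<theta> (j, \<gamma>) p) = u (Suc j) p - u (Suc (Suc j)) p" .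
      qed
      also have "\<dots> = u 1 p - u (Suc J) p"
        by (induction J) auto
      also have "\<dots> = 1"
        using u_eq1[of p 1] near u_eq0[of "Suc J" p] J r_Suc[of J] by (simp add: dK_def)
      finally show ?thesis .
    qed
    fix \<tau> :: "nat \<times> 'n hidx"
    obtain j \<gamma> where \<tau>: "\<tau> = (j, \<gamma>)" by (cases \<tau>)
    show "z \<tau> \<in> K \<and> hdist p (z \<tau>) \<le> C' * hsetdist p K" if "\<theta> \<tau> p \<noteq> 0 \<or> hgrad (\<theta> \<tau>) p \<noteq> 0"
    proof -
      have act: "\<gamma> \<in> \<Gamma> j" "\<phi> j \<gamma> p \<noteq> 0" "r (Suc (Suc j)) \<le> dK p" using active that \<tau> by auto
      obtain p' where p': "z \<tau> \<in> K" "hdist p' (z \<tau>) < r j" "\<phi> j \<gamma> p' \<noteq> 0" using z[OF act(1)] \<tau> by auto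
      have "hdist p (z \<tau>) \<le> \<Lambda> * r j" using \<phi>_dist[OF act(2) p'(3,2)] by simp
      also have "\<dots> = \<Lambda> ^ 3 * r (Suc (Suc j))" by (simp add: r_two[of j] power3_eq_cube power2_eq_square)
      also have "\<dots> \<le> C' * dK p"
      proof (intro mult_mono)
        show "\<Lambda> ^ 3 \<le> C'" "0 \<le> C'" using \<Lambda> by (simp_all add: C'_def le_max_iff_disj)
      qed (use act(3) r_pos[of "Suc (Suc j)"] in auto)
      finally show ?thesis using p'(1) by (simp add: dK_def)
    qed
    show "norm (hgrad (\<theta> \<tau>) p) * hsetdist p K \<le> C'"
    proof (cases "hgrad (\<theta> \<tau>) p = 0")
      case True then show ?thesis using \<Lambda> by (simp add: C'_def le_max_iff_disj)
    next
      case False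
      then have act: "\<gamma> \<in> \<Gamma> j" "dK p < r j" using active[of j \<gamma> p] \<tau> by auto
      define \<epsilon> where "\<epsilon> = r (Suc (Suc j))"
      have \<epsilon>: "\<epsilon> > 0" by (simp add: \<epsilon>_def r_pos)
      have inv: "c / r i \<le> c / \<epsilon>" if "i \<le> Suc (Suc j)" "c \<ge> 0" for i c
        unfolding \<epsilon>_def using that r_mono[OF that(1)] r_pos by (intro divide_left_mono mult_pos_pos) auto
      have CN: "C \<ge> 0" "N * C \<ge> 0" using DC by auto
      have "norm (hgrad (\<theta> \<tau>) p) \<le> norm ((u (Suc j) p - u (Suc (Suc j)) p) *\<^sub>R hgrad (\<phi> j \<gamma>) p)
          + norm (\<phi> j \<gamma> p *\<^sub>R (hgrad (u (Suc j)) p - hgrad (u (Suc (Suc j))) p))"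
        unfolding \<tau> \<theta>_grad using act(1) by (simp only: if_True) (rule norm_triangle_ineq)
      also have "\<dots> \<le> 1 * (C / \<epsilon>) + 1 * (N * C / \<epsilon> + N * C / \<epsilon>)"
        unfolding norm_scaleR real_norm_def
      proof (intro add_mono mult_mono)
        show "norm (hgrad (\<phi> j \<gamma>) p) \<le> C / \<epsilon>" using \<phi>_grad[of j \<gamma> p] inv[of j C] CN by simp
        have "norm (hgrad (u (Suc j)) p - hgrad (u (Suc (Suc j))) p) \<le> norm (hgrad (u (Suc j)) p) + norm (hgrad (u (Suc (Suc j))) p)"
          by (rule norm_triangle_ineq4)
        also have "\<dots> \<le> N * C / \<epsilon> + N * C / \<epsilon>"
          using u_grad[of "Suc j" p] u_grad[of "Suc (Suc j)" p] inv[of "Suc j" "N * C"] inv[of "Suc (Suc j)" "N * C"] CN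
          by (intro add_mono) auto
        finally show "norm (hgrad (u (Suc j)) p - hgrad (u (Suc (Suc j))) p) \<le> N * C / \<epsilon> + N * C / \<epsilon>" .
      qed (use u_diff \<phi>_nn \<phi>_le1 in auto)
      also have "\<dots> = (1 + 2 * real N) * C / \<epsilon>" by (simp add: add_divide_distrib[symmetric] algebra_simps)
      finally have "norm (hgrad (\<theta> \<tau>) p) \<le> (1 + 2 * real N) * C / \<epsilon>" .
      moreover have "dK p \<le> \<Lambda>\<^sup>2 * \<epsilon>" using act(2) r_two[of j] by (simp add: \<epsilon>_def)
      ultimately have "norm (hgrad (\<theta> \<tau>) p) * dK p \<le> (1 + 2 * real N) * C / \<epsilon> * (\<Lambda>\<^sup>2 * \<epsilon>)"
        using dK_pos[OF p] DC \<epsilon> by (intro mult_mono) auto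
      also have "\<dots> = \<Lambda>\<^sup>2 * ((1 + 2 * real N) * C)" using \<epsilon> by simp
      also have "\<dots> \<le> C'" by (simp add: C'_def)
      finally show ?thesis by (simp add: dK_def)
    qed
  qed
qed

text \<open>Off K the function is a weighted sum of affine functions with gradient
  \<open>k (z \<tau>)\<close> vanishing at the nearby point \<open>z \<tau>\<close> of K. The second
  condition makes the affine functions of neighbouring points of K agree up to \<epsilon> times the
  distance, so boundedly many of them with total weight 1 reproduce each one to first order.\<close>

lemma whitney_extension:
  fixes K :: "'n::finite heis set"
  assumes K: "compact K"
    and whitney: "\<And>\<epsilon>. \<epsilon> > 0 \<Longrightarrow> \<exists>\<delta>>0. \<forall>x\<in>K. \<forall>y\<in>K. hdist x y < \<delta> \<longrightarrow>
      norm (k x - k y) \<le> \<epsilon> \<and> \<bar>k x \<bullet> (hproj x - hproj y)\<bar> \<le> \<epsilon> * hdist x y"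
  obtains f g where "continuous_on UNIV g" "\<And>q. has_hgrad f (g q) q"
    "\<And>q. q \<in> K \<Longrightarrow> f q = 0" "\<And>q. q \<in> K \<Longrightarrow> g q = k q"
proof (cases "K = {}")
  case True
  show ?thesis by (rule that[of "\<lambda>_. 0" "\<lambda>_. 0"]) (auto simp: True has_hgrad_const)
next
  case False
  note [simp del] = split_paired_Ex split_paired_All
  obtain N :: nat and C \<rho> :: real and \<theta> :: "nat \<times> 'n hidx \<Rightarrow> 'n heis \<Rightarrow> real" and z :: "nat \<times> 'n hidx \<Rightarrow> 'n heis"
    where C: "C > 0" and \<rho>: "\<rho> > 0"
    and \<theta>_C1: "\<And>\<tau>. hC1 (\<theta> \<tau>)" and \<theta>_le: "\<And>\<tau> p. \<bar>\<theta> \<tau> p\<bar> \<le> 1" and \<theta>_K: "\<And>\<tau> p. p \<in> K \<Longrightarrow> \<theta> \<tau> p = 0"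
    and loc_fin: "\<And>p. p \<notin> K \<Longrightarrow> \<exists>e>0. finite {\<tau>. \<exists>p'. hdist p' p < e \<and> \<theta> \<tau> p' \<noteq> 0}"
    and card: "\<And>p. p \<notin> K \<Longrightarrow> finite {\<tau>. \<theta> \<tau> p \<noteq> 0 \<or> hgrad (\<theta> \<tau>) p \<noteq> 0} \<and> card {\<tau>. \<theta> \<tau> p \<noteq> 0 \<or> hgrad (\<theta> \<tau>) p \<noteq> 0} \<le> N"
    and sum1: "\<And>p T. p \<notin> K \<Longrightarrow> hsetdist p K < \<rho> \<Longrightarrow> finite T \<Longrightarrow> (\<forall>\<tau>. \<tau> \<notin> T \<longrightarrow> \<theta> \<tau> p = 0) \<Longrightarrow> (\<Sum>\<tau>\<in>T. \<theta> \<tau> p) = 1"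
    and near: "\<And>\<tau> p. p \<notin> K \<Longrightarrow> \<theta> \<tau> p \<noteq> 0 \<or> hgrad (\<theta> \<tau>) p \<noteq> 0 \<Longrightarrow> z \<tau> \<in> K \<and> hdist p (z \<tau>) \<le> C * hsetdist p K"
    and grad_le: "\<And>\<tau> p. p \<notin> K \<Longrightarrow> norm (hgrad (\<theta> \<tau>) p) * hsetdist p K \<le> C"
    by (rule whitney_partition[OF K False], rule that) assumption+
  \<comment> \<open>The horizontal gradient of \<open>L \<tau>\<close> is constant, so no correction in the central direction is needed.\<close>
  define L where "L \<tau> p = k (z \<tau>) \<bullet> (hproj p - hproj (z \<tau>))" for \<tau> p
  have L_C1: "hC1 (L \<tau>)" for \<tau> unfolding L_def by (rule hC1_affine)
  have L_grad: "hgrad (L \<tau>) p = k (z \<tau>)" for \<tau> p unfolding L_def by (rule hgrad_affine)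
  define F where "F T p = (\<Sum>\<tau>\<in>T. \<theta> \<tau> p * L \<tau> p)" for T p
  have F_C1: "hC1 (F T)" for T unfolding F_def by (intro hC1_sum hC1_mult \<theta>_C1 L_C1)
  define f where "f p = F {\<tau>. \<theta> \<tau> p \<noteq> 0} p" for p
  define g where "g p = (if p \<in> K then k p else hgrad f p)" for p
  have f_eq: "f p = F T p" if "finite T" "{\<tau>. \<theta> \<tau> p \<noteq> 0} \<subseteq> T" for p T
    unfolding f_def F_def using that by (intro sum.mono_neutral_left) auto
  have f_K: "f p = 0" if "p \<in> K" for p by (simp add: f_def F_def \<theta>_K that)
  have dK_pos: "hsetdist p K > 0" if p: "p \<notin> K" for p
  proof -
    obtain q where "q \<in> K" "hsetdist p K = hdist p q" using hsetdist_attained[OF K False] by blast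
    then show ?thesis using p hdist_pos[of p q] by auto
  qed
  have local_F: "\<exists>e T. e > 0 \<and> finite T \<and> (\<forall>p'. hdist p' p < e \<longrightarrow> p' \<notin> K \<and> (\<forall>\<tau>. \<tau> \<notin> T \<longrightarrow> \<theta> \<tau> p' = 0)) \<and>
      (\<forall>p'. hdist p' p < e \<longrightarrow> has_hgrad f (hgrad (F T) p') p')" if p: "p \<notin> K" for p
  proof -
    obtain e0 where e0: "e0 > 0" "finite {\<tau>. \<exists>p'. hdist p' p < e0 \<and> \<theta> \<tau> p' \<noteq> 0}" using loc_fin[OF p] by blast
    define e where "e = min e0 (hsetdist p K)"
    define T where "T = {\<tau>. \<exists>p'. hdist p' p < e0 \<and> \<theta> \<tau> p' \<noteq> 0}"
    have e: "e > 0" using e0 dK_pos[OF p] by (simp add: e_def)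
    have T0: "\<theta> \<tau> p' = 0" if "\<tau> \<notin> T" "hdist p' p < e" for \<tau> p' using that by (auto simp: T_def e_def)
    have "p' \<notin> K" if "hdist p' p < e" for p'
      using hsetdist_le[of p' K p] that by (auto simp: e_def hdist_commute)
    moreover have "has_hgrad f (hgrad (F T) p') p'" if p': "hdist p' p < e" for p'
    proof (rule has_hgrad_local[OF hC1_has_hgrad[OF F_C1]])
      show "e - hdist p' p > 0" using p' by simp
      fix p'' assume "hdist p'' p' < e - hdist p' p"
      then have "hdist p'' p < e" using hdist_triangle[of p'' p p'] by linarith
      then have "{\<tau>. \<theta> \<tau> p'' \<noteq> 0} \<subseteq> T" using T0 by blast
      then show "f p'' = F T p''" using e0(2) by (intro f_eq) (simp_all only: T_def)
    qed
    ultimately show ?thesis using e e0(2) T0 unfolding T_def[symmetric] by blast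
  qed
  have f_grad: "has_hgrad f (g p) p" if p: "p \<notin> K" for p
  proof -
    obtain e T where "e > 0" "\<And>p'. hdist p' p < e \<Longrightarrow> has_hgrad f (hgrad (F T) p') p'"
      using local_F[OF p] by metis
    then have "has_hgrad f (hgrad (F T) p) p" by simp
    then show ?thesis using p hgrad_eq[of f _ p] by (simp add: g_def)
  qed
  have g_cont: "isCont g p" if p: "p \<notin> K" for p
  proof -
    obtain e T where e: "e > 0" "\<And>p'. hdist p' p < e \<Longrightarrow> p' \<notin> K"
      "\<And>p'. hdist p' p < e \<Longrightarrow> has_hgrad f (hgrad (F T) p') p'"
      using local_F[OF p] by metis
    have eq: "g p' = hgrad (F T) p'" if "hdist p' p < e" for p'
      using e(2)[OF that] hgrad_eq[OF e(3)[OF that]] by (simp add: g_def)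
    have "isCont (hgrad (F T)) p"
      using hC1_continuous_hgrad[OF F_C1] by (simp add: continuous_on_eq_continuous_at)
    then have "(hgrad (F T) \<longlongrightarrow> g p) (at p)" using eq[of p] e(1) by (simp add: isCont_def)
    moreover have "\<forall>\<^sub>F p' in at p. hgrad (F T) p' = g p'"
      unfolding eventually_at_hdist using e(1) eq by metis
    ultimately show ?thesis unfolding isCont_def by (rule Lim_transform_eventually)
  qed
  have est: "\<exists>\<delta>>0. \<forall>p q. p \<notin> K \<longrightarrow> q \<in> K \<longrightarrow> hdist p q < \<delta> \<longrightarrow>
      norm (g p - k q) \<le> \<epsilon> \<and> \<bar>f p - k q \<bullet> (hproj p - hproj q)\<bar> \<le> \<epsilon> * hdist p q" if \<epsilon>: "\<epsilon> > 0" for \<epsilon>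
  proof -
    \<comment> \<open>Each of the at most N active terms costs a multiple of \<eta> depending on C;
      M bounds the total for values and for gradients, and its leading 1 pays for passing from a
      nearest point \<open>q'\<close> to q.\<close>
    define M where "M = 1 + (real N + 1) * (1 + 2 * (1 + C) * (1 + C))"
    have M1: "1 \<le> M" unfolding M_def using C by (intro add_increasing2 mult_nonneg_nonneg) auto
    define \<eta> where "\<eta> = \<epsilon> / M"
    have \<eta>: "\<eta> > 0" using \<epsilon> M1 by (simp add: \<eta>_def)
    have \<eta>M: "\<eta> * M = \<epsilon>" using M1 by (simp add: \<eta>_def)
    obtain \<delta> where \<delta>: "\<delta> > 0" "\<And>x y. x \<in> K \<Longrightarrow> y \<in> K \<Longrightarrow> hdist x y < \<delta> \<Longrightarrow>
        norm (k x - k y) \<le> \<eta> \<and> \<bar>k x \<bullet> (hproj x - hproj y)\<bar> \<le> \<eta> * hdist x y"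
      using whitney[OF \<eta>] by metis
    \<comment> \<open>\<open>\<rho>\<close> lets the weights sum to 1, \<open>\<delta> / 2\<close>
      brings two points of K near p within \<delta> of each other, and
      \<open>\<delta> / (1 + C)\<close> does so for q and the centres
      \<open>z \<tau>\<close>.\<close>
    define d where "d = min (min \<rho> (\<delta> / 2)) (\<delta> / (1 + C))"
    have d: "d > 0" using \<rho> \<delta> C by (simp add: d_def)
    have L_diff: "norm (k (z \<tau>) - k q) \<le> \<eta> \<and> \<bar>L \<tau> p - k q \<bullet> (hproj p - hproj q)\<bar> \<le> 2 * (1 + C) * \<eta> * hdist p q"
      if p: "p \<notin> K" and q: "q \<in> K" and pq: "hdist p q < d" and \<tau>: "\<theta> \<tau> p \<noteq> 0 \<or> hgrad (\<theta> \<tau>) p \<noteq> 0" for p q \<tau>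
    proof -
      have zK: "z \<tau> \<in> K" and zp: "hdist p (z \<tau>) \<le> C * hdist p q"
        using near[OF p \<tau>] mult_left_mono[OF hsetdist_le[OF q, of p] less_imp_le[OF C]] by linarith+
      have zq: "hdist q (z \<tau>) \<le> (1 + C) * hdist p q"
        using hdist_triangle[of q "z \<tau>" p] zp by (simp add: distrib_right hdist_commute)
      also have "\<dots> < (1 + C) * (\<delta> / (1 + C))" using pq C by (intro mult_strict_left_mono) (auto simp: d_def)
      also have "\<dots> = \<delta>" using C by simp
      finally have k1: "norm (k q - k (z \<tau>)) \<le> \<eta>" and k2: "\<bar>k q \<bullet> (hproj q - hproj (z \<tau>))\<bar> \<le> \<eta> * hdist q (z \<tau>)"
        using \<delta>(2)[OF q zK] by auto
      have "L \<tau> p - k q \<bullet> (hproj p - hproj q) = (k (z \<tau>) - k q) \<bullet> (hproj p - hproj (z \<tau>)) + k q \<bullet> (hproj q - hproj (z \<tau>))"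
        by (simp add: L_def inner_diff_left inner_diff_right)
      moreover have "\<bar>(k (z \<tau>) - k q) \<bullet> (hproj p - hproj (z \<tau>))\<bar> \<le> \<eta> * (C * hdist p q)"
      proof -
        have "\<bar>(k (z \<tau>) - k q) \<bullet> (hproj p - hproj (z \<tau>))\<bar> \<le> norm (k (z \<tau>) - k q) * norm (hproj p - hproj (z \<tau>))"
          by (rule Cauchy_Schwarz_ineq2)
        also have "\<dots> \<le> \<eta> * (C * hdist p q)"
          using k1 zp norm_hproj_diff_le[of p "z \<tau>"] \<eta> by (intro mult_mono) (auto simp: norm_minus_commute)
        finally show ?thesis .
      qed
      moreover have "\<eta> * hdist q (z \<tau>) \<le> \<eta> * ((1 + C) * hdist p q)" using zq \<eta> by simp
      ultimately have "\<bar>L \<tau> p - k q \<bullet> (hproj p - hproj q)\<bar> \<le> \<eta> * (C * hdist p q) + \<eta> * ((1 + C) * hdist p q)"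
        using k2 by linarith
      also have "\<dots> \<le> 2 * (1 + C) * \<eta> * hdist p q"
      proof -
        have "0 \<le> \<eta> * hdist p q" using \<eta> by simp
        then show ?thesis by (simp add: algebra_simps)
      qed
      finally show ?thesis using k1 by (simp add: norm_minus_commute)
    qed
    have val: "\<bar>f p - k q \<bullet> (hproj p - hproj q)\<bar> \<le> \<epsilon> * hdist p q"
      if p: "p \<notin> K" and q: "q \<in> K" and pq: "hdist p q < d" for p q
    proof -
      define S where "S = {\<tau>. \<theta> \<tau> p \<noteq> 0 \<or> hgrad (\<theta> \<tau>) p \<noteq> 0}"
      have S: "finite S" "card S \<le> N" using card[OF p] by (auto simp: S_def)
      have "hsetdist p K < \<rho>" using hsetdist_le[OF q, of p] pq by (simp add: d_def)
      then have s1: "(\<Sum>\<tau>\<in>S. \<theta> \<tau> p) = 1" using S(1) by (intro sum1[OF p]) (auto simp: S_def)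
      have "f p = F S p" using S(1) by (intro f_eq) (auto simp: S_def)
      then have "f p - k q \<bullet> (hproj p - hproj q) = (\<Sum>\<tau>\<in>S. \<theta> \<tau> p * L \<tau> p) - (\<Sum>\<tau>\<in>S. \<theta> \<tau> p) * (k q \<bullet> (hproj p - hproj q))"
        unfolding s1 by (simp add: F_def)
      also have "\<dots> = (\<Sum>\<tau>\<in>S. \<theta> \<tau> p * (L \<tau> p - k q \<bullet> (hproj p - hproj q)))"
        by (simp add: sum_distrib_right right_diff_distrib sum_subtractf)
      also have "\<bar>\<dots>\<bar> \<le> (\<Sum>\<tau>\<in>S. 1 * (2 * (1 + C) * \<eta> * hdist p q))"
      proof (rule order_trans[OF sum_abs], rule sum_mono)
        fix \<tau> assume "\<tau> \<in> S"
        then show "\<bar>\<theta> \<tau> p * (L \<tau> p - k q \<bullet> (hproj p - hproj q))\<bar> \<le> 1 * (2 * (1 + C) * \<eta> * hdist p q)"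
          unfolding abs_mult using L_diff[OF p q pq, of \<tau>] \<theta>_le[of \<tau> p]
          by (intro mult_mono) (auto simp: S_def)
      qed
      also have "\<dots> = real (card S) * (2 * (1 + C)) * (\<eta> * hdist p q)" by simp
      also have "\<dots> \<le> M * (\<eta> * hdist p q)"
      proof (rule mult_right_mono)
        have "real (card S) * (2 * (1 + C)) \<le> (real N + 1) * (1 + 2 * (1 + C) * (1 + C))"
          using S(2) C by (intro mult_mono) (auto simp: algebra_simps)
        then show "real (card S) * (2 * (1 + C)) \<le> M" by (simp add: M_def)
      qed (use \<eta> in simp)
      also have "\<dots> = \<epsilon> * hdist p q" using \<eta>M by (simp add: mult.commute mult.left_commute mult.assoc[symmetric])
      finally show ?thesis .
    qed
    have grd: "norm (g p - k q) \<le> \<epsilon>"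
      if p: "p \<notin> K" and q: "q \<in> K" and pq: "hdist p q < d" for p q
    proof -
      \<comment> \<open>Gradients of the weights are of the order of 1 over the distance to K, so
        the affine function to be subtracted is based at a nearest point; q itself may be much
        farther away.\<close>
      obtain q' where q': "q' \<in> K" "hsetdist p K = hdist p q'" using hsetdist_attained[OF K False] by blast
      have pq': "hdist p q' < d" using hsetdist_le[OF q, of p] q'(2) pq by simp
      have qq': "hdist q' q < \<delta>"
        using hdist_triangle[of q' q p] pq pq' by (simp add: hdist_commute d_def)
      obtain e T where e: "e > 0" "finite T" "\<And>p'. hdist p' p < e \<Longrightarrow> p' \<notin> K"
        "\<And>p' \<tau>. hdist p' p < e \<Longrightarrow> \<tau> \<notin> T \<Longrightarrow> \<theta> \<tau> p' = 0"
        "\<And>p'. hdist p' p < e \<Longrightarrow> has_hgrad f (hgrad (F T) p') p'"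
        using local_F[OF p] by metis
      define S where "S = {\<tau>. \<theta> \<tau> p \<noteq> 0 \<or> hgrad (\<theta> \<tau>) p \<noteq> 0}"
      have S: "finite S" "card S \<le> N" using card[OF p] by (auto simp: S_def)
      have s1: "(\<Sum>\<tau>\<in>T. \<theta> \<tau> p') = 1" if "hdist p' p < min e (\<rho> - hdist p q)" for p'
      proof (rule sum1)
        have "hdist p' p < e" using that by simp
        then show "p' \<notin> K" "finite T" "\<forall>\<tau>. \<tau> \<notin> T \<longrightarrow> \<theta> \<tau> p' = 0" using e by blast+
        show "hsetdist p' K < \<rho>" using hsetdist_le[OF q, of p'] hdist_triangle[of p' q p] that by simp
      qed
      \<comment> \<open>The weights sum to 1 in a neighbourhood of p, so their gradients sum to 0
        and an affine function can be subtracted from every term at no cost.\<close>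
      have "has_hgrad (\<lambda>p'. \<Sum>\<tau>\<in>T. \<theta> \<tau> p') 0 p"
      proof (rule has_hgrad_local[OF has_hgrad_const[of 1]])
        show "min e (\<rho> - hdist p q) > 0" using e(1) pq by (simp add: d_def)
        show "(\<Sum>\<tau>\<in>T. \<theta> \<tau> p') = 1" if "hdist p' p < min e (\<rho> - hdist p q)" for p'
          by (rule s1[OF that])
      qed
      then have s0: "(\<Sum>\<tau>\<in>T. hgrad (\<theta> \<tau>) p) = 0"
        using hgrad_eq[of "\<lambda>p'. \<Sum>\<tau>\<in>T. \<theta> \<tau> p'" 0 p] hgrad_sum[of T \<theta> p, OF e(2) \<theta>_C1] by simp
      have s1p: "(\<Sum>\<tau>\<in>T. \<theta> \<tau> p) = 1" using s1[of p] e(1) pq by (simp add: d_def)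
      have "g p = hgrad (F T) p" using hgrad_eq[OF f_grad[OF p]] hgrad_eq[OF e(5)[of p]] e(1) by simp
      also have "\<dots> = (\<Sum>\<tau>\<in>T. \<theta> \<tau> p *\<^sub>R k (z \<tau>) + L \<tau> p *\<^sub>R hgrad (\<theta> \<tau>) p)"
        unfolding F_def using e(2) by (subst hgrad_sum) (auto simp: hgrad_mult hC1_mult \<theta>_C1 L_C1 L_grad)
      finally have "g p - k q' = (\<Sum>\<tau>\<in>T. \<theta> \<tau> p *\<^sub>R k (z \<tau>) + L \<tau> p *\<^sub>R hgrad (\<theta> \<tau>) p)
          - (\<Sum>\<tau>\<in>T. \<theta> \<tau> p) *\<^sub>R k q' - (k q' \<bullet> (hproj p - hproj q')) *\<^sub>R (\<Sum>\<tau>\<in>T. hgrad (\<theta> \<tau>) p)"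
        unfolding s0 s1p by simp
      also have "\<dots> = (\<Sum>\<tau>\<in>T. \<theta> \<tau> p *\<^sub>R (k (z \<tau>) - k q') + (L \<tau> p - k q' \<bullet> (hproj p - hproj q')) *\<^sub>R hgrad (\<theta> \<tau>) p)"
        by (simp only: scaleR_sum_left scaleR_sum_right sum_subtractf[symmetric] scaleR_diff_right scaleR_diff_left)
           (simp add: algebra_simps)
      also have "\<dots> = (\<Sum>\<tau>\<in>T \<inter> S. \<theta> \<tau> p *\<^sub>R (k (z \<tau>) - k q') + (L \<tau> p - k q' \<bullet> (hproj p - hproj q')) *\<^sub>R hgrad (\<theta> \<tau>) p)"
        using e(2) by (intro sum.mono_neutral_right) (auto simp: S_def)
      also have "norm \<dots> \<le> (\<Sum>\<tau>\<in>T \<inter> S. \<eta> * (1 + 2 * (1 + C) * C))"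
      proof (rule sum_norm_le)
        fix \<tau> assume "\<tau> \<in> T \<inter> S"
        then have Ld: "norm (k (z \<tau>) - k q') \<le> \<eta>" "\<bar>L \<tau> p - k q' \<bullet> (hproj p - hproj q')\<bar> \<le> 2 * (1 + C) * \<eta> * hdist p q'"
          using L_diff[OF p q'(1) pq', of \<tau>] by (auto simp: S_def)
        have a: "norm (\<theta> \<tau> p *\<^sub>R (k (z \<tau>) - k q')) \<le> 1 * \<eta>"
          unfolding norm_scaleR real_norm_def using Ld(1) \<theta>_le[of \<tau> p] by (intro mult_mono) auto
        have "norm ((L \<tau> p - k q' \<bullet> (hproj p - hproj q')) *\<^sub>R hgrad (\<theta> \<tau>) p) \<le> (2 * (1 + C) * \<eta> * hdist p q') * norm (hgrad (\<theta> \<tau>) p)"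
          unfolding norm_scaleR real_norm_def using Ld(2) by (intro mult_right_mono) auto
        also have "\<dots> = 2 * (1 + C) * \<eta> * (norm (hgrad (\<theta> \<tau>) p) * hsetdist p K)" by (simp add: q'(2))
        also have "\<dots> \<le> 2 * (1 + C) * \<eta> * C"
          using grad_le[OF p] C \<eta> by (intro mult_left_mono) auto
        finally show "norm (\<theta> \<tau> p *\<^sub>R (k (z \<tau>) - k q') + (L \<tau> p - k q' \<bullet> (hproj p - hproj q')) *\<^sub>R hgrad (\<theta> \<tau>) p)
            \<le> \<eta> * (1 + 2 * (1 + C) * C)"
          using a norm_triangle_le[of "\<theta> \<tau> p *\<^sub>R (k (z \<tau>) - k q')" "(L \<tau> p - k q' \<bullet> (hproj p - hproj q')) *\<^sub>R hgrad (\<theta> \<tau>) p"]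
          by (simp add: algebra_simps)
      qed
      also have "\<dots> = real (card (T \<inter> S)) * (1 + 2 * (1 + C) * C) * \<eta>" by simp
      also have "\<dots> \<le> (M - 1) * \<eta>"
      proof (rule mult_right_mono)
        have "card (T \<inter> S) \<le> card S" using S(1) by (intro card_mono) auto
        then have "real (card (T \<inter> S)) \<le> real N + 1" using S(2) by linarith
        then have "real (card (T \<inter> S)) * (1 + 2 * (1 + C) * C) \<le> (real N + 1) * (1 + 2 * (1 + C) * (1 + C))"
          using C by (intro mult_mono) (auto simp: algebra_simps)
        then show "real (card (T \<inter> S)) * (1 + 2 * (1 + C) * C) \<le> M - 1" by (simp add: M_def)
      qed (use \<eta> in simp)
      finally have "norm (g p - k q') \<le> (M - 1) * \<eta>" .
      moreover have "norm (k q' - k q) \<le> \<eta>" using \<delta>(2)[OF q'(1) q qq'] by simp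
      moreover have "norm (g p - k q) \<le> norm (g p - k q') + norm (k q' - k q)"
        using norm_triangle_ineq[of "g p - k q'" "k q' - k q"] by simp
      moreover have "(M - 1) * \<eta> + \<eta> = \<epsilon>" using \<eta>M by (simp add: algebra_simps)
      ultimately show ?thesis by linarith
    qed
    show ?thesis using d val grd by blast
  qed
  have K_grad: "has_hgrad f (k q) q" if q: "q \<in> K" for q
    unfolding has_hgrad_iff
  proof (intro allI impI)
    fix \<epsilon> :: real assume \<epsilon>: "\<epsilon> > 0"
    obtain d1 where d1: "d1 > 0" "\<And>p q. p \<notin> K \<Longrightarrow> q \<in> K \<Longrightarrow> hdist p q < d1 \<Longrightarrow> \<bar>f p - k q \<bullet> (hproj p - hproj q)\<bar> \<le> \<epsilon> * hdist p q"
      using est[OF \<epsilon>] by metis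
    obtain d2 where d2: "d2 > 0" "\<And>x y. x \<in> K \<Longrightarrow> y \<in> K \<Longrightarrow> hdist x y < d2 \<Longrightarrow> \<bar>k x \<bullet> (hproj x - hproj y)\<bar> \<le> \<epsilon> * hdist x y"
      using whitney[OF \<epsilon>] by metis
    have "\<bar>f p - f q - k q \<bullet> (hproj p - hproj q)\<bar> \<le> \<epsilon> * hdist p q" if p: "hdist p q < min d1 d2" for p
    proof (cases "p \<in> K")
      case True
      have "\<bar>k q \<bullet> (hproj q - hproj p)\<bar> \<le> \<epsilon> * hdist p q"
        using d2(2)[OF q True] p by (simp add: hdist_commute)
      moreover have "k q \<bullet> (hproj q - hproj p) = - (k q \<bullet> (hproj p - hproj q))" by (simp add: inner_diff_right)
      ultimately show ?thesis using f_K[OF q] f_K[OF True] by simp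
    next
      case False
      then show ?thesis using d1(2)[OF False q] p f_K[OF q] by simp
    qed
    then show "\<exists>d>0. \<forall>p. hdist p q < d \<longrightarrow> \<bar>f p - f q - k q \<bullet> (hproj p - hproj q)\<bar> \<le> \<epsilon> * hdist p q"
      using d1(1) d2(1) by (intro exI[of _ "min d1 d2"]) auto
  qed
  have K_cont: "isCont g q" if q: "q \<in> K" for q
    unfolding isCont_def
  proof (rule tendstoI)
    fix \<epsilon>' :: real assume \<epsilon>': "\<epsilon>' > 0"
    define \<epsilon> where "\<epsilon> = \<epsilon>' / 2"
    have \<epsilon>: "\<epsilon> > 0" "\<epsilon> < \<epsilon>'" using \<epsilon>' by (auto simp: \<epsilon>_def)
    obtain d1 where d1: "d1 > 0" "\<And>p q. p \<notin> K \<Longrightarrow> q \<in> K \<Longrightarrow> hdist p q < d1 \<Longrightarrow> norm (g p - k q) \<le> \<epsilon>"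
      using est[OF \<epsilon>(1)] by metis
    obtain d2 where d2: "d2 > 0" "\<And>x y. x \<in> K \<Longrightarrow> y \<in> K \<Longrightarrow> hdist x y < d2 \<Longrightarrow> norm (k x - k y) \<le> \<epsilon>"
      using whitney[OF \<epsilon>(1)] by metis
    have "dist (g p) (g q) < \<epsilon>'" if "hdist p q < min d1 d2" for p
    proof (cases "p \<in> K")
      case True then show ?thesis using d2(2)[OF True q] that \<epsilon> q by (simp add: g_def dist_norm)
    next
      case False then show ?thesis using d1(2)[OF False q] that \<epsilon> q by (simp add: g_def dist_norm)
    qed
    then show "\<forall>\<^sub>F p in at q. dist (g p) (g q) < \<epsilon>'"
      unfolding eventually_at_hdist using d1(1) d2(1) by (intro exI[of _ "min d1 d2"]) auto
  qed
  show ?thesis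
  proof (rule that[of g f])
    show "continuous_on UNIV g" using K_cont g_cont continuous_at_imp_continuous_on by blast
    show "has_hgrad f (g q) q" for q using f_grad K_grad[of q] by (cases "q \<in> K") (auto simp: g_def)
    show "f q = 0" "g q = k q" if "q \<in> K" for q using that f_K by (auto simp: g_def)
  qed
qed

section \<open>Separated families and volumes of tubes\<close>

text \<open>Well-founded recursion along a well-order that first compares \<open>lev\<close>: a
  point is taken if no earlier taken point is related to it. A rejected point thus has an earlier
  taken relative, of no larger level. This is Vitali's selection by decreasing size, low levels
  standing for wide tubes.\<close>

lemma greedy_selection:
  fixes lev :: "'a \<Rightarrow> nat"
  assumes sym: "\<And>x y. R x y \<Longrightarrow> R y x"
  shows "\<exists>I\<subseteq>A. (\<forall>x\<in>I. \<forall>y\<in>I. x \<noteq> y \<longrightarrow> \<not> R x y) \<and> (\<forall>y\<in>A. \<exists>x\<in>I. lev x \<le> lev y \<and> (x = y \<or> R x y))"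
proof -
  obtain r :: "'a rel" where "well_order_on UNIV r" using well_order_on by blast
  then have wo: "wf (r - Id)" and tot: "total_on UNIV r"
    by (auto simp: well_order_on_def linear_order_on_def partial_order_on_def)
  define S where "S = inv_image (less_than <*lex*> (r - Id)) (\<lambda>x. (lev x, x))"
  have wf: "wf S" unfolding S_def by (intro wf_inv_image wf_lex_prod wf_less_than wo)
  have S_lev: "(y, x) \<in> S \<Longrightarrow> lev y \<le> lev x" for x y by (auto simp: S_def)
  have S_total: "x \<noteq> y \<Longrightarrow> (x, y) \<in> S \<or> (y, x) \<in> S" for x y
    using tot by (auto simp: S_def total_on_def)
  define F where "F f x \<longleftrightarrow> x \<in> A \<and> (\<forall>y. (y, x) \<in> S \<longrightarrow> f y \<longrightarrow> \<not> R y x)" for f x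
  define sel where "sel = wfrec S F"
  have sel: "sel x \<longleftrightarrow> x \<in> A \<and> (\<forall>y. (y, x) \<in> S \<longrightarrow> sel y \<longrightarrow> \<not> R y x)" for x
  proof -
    have "sel x = F (cut sel S x) x" unfolding sel_def by (rule wfrec[OF wf])
    then show ?thesis unfolding F_def by (simp add: cut_apply cong: imp_cong)
  qed
  define I where "I = {x. sel x}"
  have a: "I \<subseteq> A" unfolding I_def using sel by blast
  have b: "\<not> R x y" if "x \<in> I" "y \<in> I" "x \<noteq> y" for x y
    using that S_total[OF that(3)] sel[of x] sel[of y] sym[of x y] unfolding I_def by blast
  have c: "\<exists>x\<in>I. lev x \<le> lev y \<and> (x = y \<or> R x y)" if y: "y \<in> A" for y
  proof (cases "sel y")
    case True then show ?thesis by (auto simp: I_def)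
  next
    case False
    then obtain x where "(x, y) \<in> S" "sel x" "R x y" using sel[of y] y by blast
    then show ?thesis using S_lev[of x y] unfolding I_def by blast
  qed
  show ?thesis using a b c by (intro exI[of _ I] conjI ballI impI)
qed

text \<open>A grid of mesh \<open>3 * r\<close> along an orthonormal basis, with K points per
  direction. The triangle inequality over m directions keeps it in the ball of radius l, and
  rounding down loses at most a factor 2, which turns 3 into 6.\<close>

lemma subspace_grid:
  fixes W :: "'a::euclidean_space set"
  assumes W: "subspace W" "dim W = m" and m: "0 < m" and r: "0 < r" "3 * r * real m \<le> l"
  obtains G where "finite G" "G \<subseteq> W" "\<And>w. w \<in> G \<Longrightarrow> norm w \<le> l"
    "\<And>w w'. w \<in> G \<Longrightarrow> w' \<in> G \<Longrightarrow> w \<noteq> w' \<Longrightarrow> 3 * r \<le> dist w w'"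
    "(l / (6 * real m * r)) ^ m \<le> real (card G)"
proof -
  obtain B where B: "B \<subseteq> W" "pairwise orthogonal B" "\<And>x. x \<in> B \<Longrightarrow> norm x = 1" "independent B" "card B = m" "span B = W"
    using orthonormal_basis_subspace[OF W(1)] W(2) by metis
  have finB: "finite B" using B(4) independent_imp_finite by blast
  define K where "K = nat \<lfloor>l / (3 * r * real m)\<rfloor>"
  have q: "l / (3 * r * real m) \<ge> 1" using r m by (simp add: le_divide_eq)
  have K1: "real K \<le> l / (3 * r * real m)" using q unfolding K_def by linarith
  have K2: "l / (6 * real m * r) \<le> real K"
  proof -
    have "l / (3 * r * real m) < real K + 1" using q unfolding K_def by linarith
    moreover have "real K \<ge> 1"
    proof -
      have "\<lfloor>l / (3 * r * real m)\<rfloor> \<ge> 1" using q by simp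
      then show ?thesis unfolding K_def by linarith
    qed
    ultimately have "l / (3 * r * real m) \<le> 2 * real K" by linarith
    moreover have e: "l / (6 * real m * r) = l / (3 * r * real m) / 2" by (simp add: mult.commute mult.left_commute)
    ultimately show ?thesis unfolding e by simp
  qed
  define F where "F = PiE B (\<lambda>_. {..<K})"
  define w where "w f = (\<Sum>b\<in>B. (3 * r * real (f b)) *\<^sub>R b)" for f :: "'a \<Rightarrow> nat"
  have inner: "w f \<bullet> b = 3 * r * real (f b)" if b: "b \<in> B" for f b
  proof -
    have "w f \<bullet> b = (\<Sum>b'\<in>B. if b' = b then 3 * r * real (f b) else 0)"
      unfolding w_def inner_sum_left
    proof (intro sum.cong refl)
      fix b' assume "b' \<in> B"
      then show "(3 * r * real (f b')) *\<^sub>R b' \<bullet> b = (if b' = b then 3 * r * real (f b) else 0)"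
        using b B(2,3) by (auto simp: pairwise_def orthogonal_def dot_square_norm)
    qed
    then show ?thesis using b finB by simp
  qed
  have sep: "3 * r \<le> dist (w f) (w f')" if "f b \<noteq> f' b" "b \<in> B" for f f' b
  proof -
    have "1 \<le> \<bar>real (f b) - real (f' b)\<bar>" using that(1) by linarith
    then have "3 * r * 1 \<le> 3 * r * \<bar>real (f b) - real (f' b)\<bar>" using r(1) mult_left_mono[of 1 _ "3 * r"] by simp
    also have "\<dots> = \<bar>(w f - w f') \<bullet> b\<bar>"
    proof -
      have "(w f - w f') \<bullet> b = 3 * r * (real (f b) - real (f' b))"
        unfolding inner_diff_left inner[OF that(2)] by (simp add: right_diff_distrib)
      then show ?thesis using r(1) by (simp add: abs_mult)
    qed
    also have "\<dots> \<le> norm (w f - w f') * norm b" by (rule Cauchy_Schwarz_ineq2)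
    finally show ?thesis using B(3)[OF that(2)] by (simp add: dist_norm)
  qed
  have ne: "\<exists>b\<in>B. f b \<noteq> f' b" if "f \<in> F" "f' \<in> F" "f \<noteq> f'" for f f'
    using that PiE_ext[of f B _ f'] unfolding F_def by blast
  have inj: "inj_on w F"
  proof (rule inj_onI, rule ccontr)
    fix f f' assume "f \<in> F" "f' \<in> F" "w f = w f'" "f \<noteq> f'"
    then show False using ne[of f f'] sep[of f _ f'] r by force
  qed
  show ?thesis
  proof (rule that[of "w ` F"])
    show "finite (w ` F)" unfolding F_def using finB by (intro finite_imageI finite_PiE) auto
    show "w ` F \<subseteq> W"
    proof clarify
      fix f
      have "w f \<in> span B" unfolding w_def by (intro span_sum span_scale span_base)
      then show "w f \<in> W" using B(6) by simp
    qed
    show "norm v \<le> l" if v: "v \<in> w ` F" for v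
    proof -
      obtain f where f: "f \<in> F" "v = w f" using v by auto
      have "norm (w f) \<le> (\<Sum>b\<in>B. 3 * r * real K)"
        unfolding w_def
      proof (rule sum_norm_le)
        fix b assume b: "b \<in> B"
        then have "real (f b) \<le> real K" using f(1) by (auto simp: F_def PiE_def Pi_def less_imp_le)
        then show "norm ((3 * r * real (f b)) *\<^sub>R b) \<le> 3 * r * real K"
          using r B(3)[OF b] by simp
      qed
      also have "\<dots> = 3 * r * real m * real K" by (simp add: B(5))
      also have "\<dots> \<le> 3 * r * real m * (l / (3 * r * real m))" using K1 r by (intro mult_left_mono) auto
      also have "\<dots> = l" using r m by simp
      finally show ?thesis using f by simp
    qed
    show "3 * r \<le> dist v v'" if "v \<in> w ` F" "v' \<in> w ` F" "v \<noteq> v'" for v v'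
      using that ne sep by blast
    have cK: "card (w ` F) = K ^ m"
      using inj finB by (simp add: card_image F_def card_PiE B(5))
    show "(l / (6 * real m * r)) ^ m \<le> real (card (w ` F))"
    proof -
      have "0 \<le> 3 * r * real m" using r m by simp
      then have "0 \<le> l" using r(2) by linarith
      then have "0 \<le> l / (6 * real m * r)" using r(1) by (intro divide_nonneg_nonneg) auto
      then have "(l / (6 * real m * r)) ^ m \<le> real K ^ m" by (rule power_mono[OF K2])
      then show "(l / (6 * real m * r)) ^ m \<le> real (card (w ` F))" using cK by simp
    qed
  qed
qed

text \<open>Fubini: each fibre over A is an interval of length \<open>2 * \<rho>\<close>, and g only
  moves its centre. Two-sided translates of a ball have this form.\<close>

lemma emeasure_slab:
  fixes A :: "'n::finite hvec set" and g :: "'n hvec \<Rightarrow> real"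
  assumes A: "A \<in> sets borel" and g: "continuous_on UNIV g" and \<rho>: "0 \<le> \<rho>"
  shows "{p. hproj p \<in> A \<and> \<bar>hcen p - g (hproj p)\<bar> \<le> \<rho>} \<in> sets lborel"
    and "emeasure lborel {p. hproj p \<in> A \<and> \<bar>hcen p - g (hproj p)\<bar> \<le> \<rho>} = ennreal (2 * \<rho>) * emeasure lborel A"
proof -
  define S where "S = {p. hproj p \<in> A \<and> \<bar>hcen p - g (hproj p)\<bar> \<le> \<rho>}"
  have "closed {p. \<bar>hcen p - g (hproj p)\<bar> \<le> \<rho>}"
    by (intro closed_Collect_le continuous_intros continuous_on_compose2[OF g]) auto
  moreover have "hproj -` A \<in> sets (borel :: 'n heis measure)"
  proof -
    have "(hproj :: 'n heis \<Rightarrow> 'n hvec) \<in> borel_measurable borel"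
      by (intro borel_measurable_continuous_onI continuous_intros)
    from measurable_sets[OF this A] show ?thesis by simp
  qed
  moreover have "S = hproj -` A \<inter> {p. \<bar>hcen p - g (hproj p)\<bar> \<le> \<rho>}" by (auto simp: S_def)
  ultimately have S: "S \<in> sets borel" by auto
  then show "{p. hproj p \<in> A \<and> \<bar>hcen p - g (hproj p)\<bar> \<le> \<rho>} \<in> sets lborel" by (simp add: S_def)
  have slice: "emeasure lborel (Pair y -` (Pair x -` S)) = ennreal (2 * \<rho>) * indicator A (x, y)" for x y
  proof (cases "(x, y) \<in> A")
    case True
    then have "Pair y -` (Pair x -` S) = {g (x, y) - \<rho>..g (x, y) + \<rho>}"
      by (auto simp: S_def abs_le_iff)
    then show ?thesis using True \<rho> by simp
  next
    case False
    then have "Pair y -` (Pair x -` S) = {}" by (auto simp: S_def)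
    then show ?thesis using False by simp
  qed
  have S2: "S \<in> sets (lborel \<Otimes>\<^sub>M (lborel :: ((real ^ 'n) \<times> real) measure))" using S unfolding lborel_prod by simp
  have Sx: "Pair x -` S \<in> sets (lborel \<Otimes>\<^sub>M (lborel :: real measure))" for x
    using sets_Pair1[OF S2, of x] unfolding lborel_prod .
  have A2: "A \<in> sets (lborel \<Otimes>\<^sub>M lborel)" using A unfolding lborel_prod by simp
  have meas: "(\<lambda>x. emeasure lborel (Pair x -` A)) \<in> borel_measurable lborel"
    using lborel.measurable_emeasure_Pair[OF A2] .
  have Ax: "emeasure lborel (Pair x -` A) = (\<integral>\<^sup>+y. indicator A (x, y) \<partial>lborel)" for x
  proof -
    have "Pair x -` A \<in> sets lborel" using sets_Pair1[OF A2, of x] .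
    then show ?thesis by (simp add: nn_integral_indicator[symmetric] indicator_def)
  qed
  have mi: "(\<lambda>y. indicator A (x, y) :: ennreal) \<in> borel_measurable lborel" for x
  proof -
    have "Pair x -` A \<in> sets lborel" using sets_Pair1[OF A2, of x] .
    then have "(indicator (Pair x -` A) :: _ \<Rightarrow> ennreal) \<in> borel_measurable lborel" by simp
    moreover have "(indicator (Pair x -` A) :: _ \<Rightarrow> ennreal) = (\<lambda>y. indicator A (x, y))" by (auto simp: indicator_def)
    ultimately show ?thesis by simp
  qed
  have "emeasure lborel S = emeasure (lborel \<Otimes>\<^sub>M lborel) S" by (simp add: lborel_prod)
  also have "\<dots> = (\<integral>\<^sup>+x. emeasure lborel (Pair x -` S) \<partial>lborel)"
    by (rule lborel.emeasure_pair_measure_alt[OF S2])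
  also have "\<dots> = (\<integral>\<^sup>+x. emeasure (lborel \<Otimes>\<^sub>M lborel) (Pair x -` S) \<partial>lborel)" by (simp add: lborel_prod)
  also have "\<dots> = (\<integral>\<^sup>+x. (\<integral>\<^sup>+y. emeasure lborel (Pair y -` (Pair x -` S)) \<partial>lborel) \<partial>lborel)"
    by (simp only: lborel.emeasure_pair_measure_alt[OF Sx])
  also have "\<dots> = (\<integral>\<^sup>+x. ennreal (2 * \<rho>) * emeasure lborel (Pair x -` A) \<partial>lborel)"
    by (simp only: slice Ax nn_integral_cmult[OF mi])
  also have "\<dots> = ennreal (2 * \<rho>) * (\<integral>\<^sup>+x. emeasure lborel (Pair x -` A) \<partial>lborel)"
    by (rule nn_integral_cmult[OF meas])
  also have "(\<integral>\<^sup>+x. emeasure lborel (Pair x -` A) \<partial>lborel) = emeasure lborel A"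
    using lborel.emeasure_pair_measure_alt[OF A2] by (simp add: lborel_prod)
  finally show "emeasure lborel {p. hproj p \<in> A \<and> \<bar>hcen p - g (hproj p)\<bar> \<le> \<rho>} = ennreal (2 * \<rho>) * emeasure lborel A"
    by (simp add: S_def)
qed

lemma emeasure_translated_ball:
  fixes x w :: "'n::finite heis"
  assumes r: "0 \<le> r"
  shows "{p. hnorm (hinv x \<odot> p \<odot> hinv w) \<le> r} \<in> sets lborel"
    and "emeasure lborel {p. hnorm (hinv x \<odot> p \<odot> hinv w) \<le> r}
      = ennreal (2 * unit_ball_vol (2 * CARD('n)) * r ^ (2 * CARD('n) + 2))"
proof -
  \<comment> \<open>Left and right translation act on the central coordinate by a shear that depends
    on the horizontal part, so the set is a slab of height \<open>2 * r\<^sup>2\<close> over a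
    Euclidean ball; this yields the exponent 2n + 2.\<close>
  define g where "g z = hcen x + hcen w + 2 * hform (hproj x) z + 2 * hform (z - hproj x) (hproj w)" for z
  have g: "continuous_on UNIV g" unfolding g_def by (intro continuous_intros)
  have eq: "{p. hnorm (hinv x \<odot> p \<odot> hinv w) \<le> r}
      = {p. hproj p \<in> cball (hproj x + hproj w) r \<and> \<bar>hcen p - g (hproj p)\<bar> \<le> r\<^sup>2}"
  proof -
    have a: "norm (hproj (hinv x \<odot> p \<odot> hinv w)) = dist (hproj x + hproj w) (hproj p)" for p
      unfolding dist_norm norm_minus_commute[of "hproj x + hproj w"] by (simp add: algebra_simps)
    have b: "hcen (hinv x \<odot> p \<odot> hinv w) = hcen p - g (hproj p)" for p
      by (simp add: g_def hform_minus hform_diff hform_add)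
    show ?thesis by (simp only: hnorm_le_iff[OF r] a b mem_cball)
  qed
  have b: "emeasure lborel (cball (hproj x + hproj w) r) = ennreal (unit_ball_vol (2 * CARD('n)) * r ^ (2 * CARD('n)))"
  proof -
    have D: "DIM('n hvec) = 2 * CARD('n)" by simp
    show ?thesis using emeasure_cball[OF r, of "hproj x + hproj w"] unfolding D .
  qed
  show "{p. hnorm (hinv x \<odot> p \<odot> hinv w) \<le> r} \<in> sets lborel"
    unfolding eq by (rule emeasure_slab[OF _ g]) auto
  have "emeasure lborel {p. hnorm (hinv x \<odot> p \<odot> hinv w) \<le> r}
      = ennreal (2 * r\<^sup>2) * ennreal (unit_ball_vol (2 * CARD('n)) * r ^ (2 * CARD('n)))"
    unfolding eq b[symmetric] by (rule emeasure_slab[OF _ g]) auto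
  also have "\<dots> = ennreal ((2 * r\<^sup>2) * (unit_ball_vol (2 * CARD('n)) * r ^ (2 * CARD('n))))"
    by (intro ennreal_mult'[symmetric]) auto
  also have "(2 * r\<^sup>2) * (unit_ball_vol (2 * CARD('n)) * r ^ (2 * CARD('n)))
      = 2 * unit_ball_vol (2 * CARD('n)) * r ^ (2 * CARD('n) + 2)"
    by (simp add: power_add power2_eq_square)
  finally show "emeasure lborel {p. hnorm (hinv x \<odot> p \<odot> hinv w) \<le> r}
      = ennreal (2 * unit_ball_vol (2 * CARD('n)) * r ^ (2 * CARD('n) + 2))" .
qed

section \<open>Cone points without lower density\<close>

lemma hausdorff_UN_le:
  assumes "0 < d" "finite F"
  shows "hausdorff d (\<Union>x\<in>F. Z x) \<le> (\<Sum>x\<in>F. hausdorff d (Z x))"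
  using assms(2)
proof (induction F rule: finite_induct)
  case (insert x F)
  have "hausdorff d (\<Union>y\<in>insert x F. Z y) \<le> hausdorff d (Z x) + hausdorff d (\<Union>y\<in>F. Z y)"
    using hausdorff_Un_le[OF assms(1)] by simp
  also have "\<dots> \<le> hausdorff d (Z x) + (\<Sum>y\<in>F. hausdorff d (Z y))" by (rule add_left_mono[OF insert.IH])
  finally show ?case using insert.hyps by simp
qed (simp add: hausdorff_empty assms)

lemma hausdorff_singleton:
  assumes "0 < d" shows "hausdorff d {x} = 0"
proof -
  have "hdiam {x} = 0" using hdiam_leI[of "{x}" 0] by simp
  then have "hausdorff_pre d \<delta> {x} \<le> 0" for \<delta>
    using hausdorff_pre_le_cover[of "{x}" "\<lambda>_. {x}" \<delta> d] assms by (simp add: zero_power)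
  then have "hausdorff d {x} \<le> 0" unfolding hausdorff_eq_pre by (intro SUP_least)
  then show ?thesis by simp
qed

text \<open>A tube \<open>x \<cdot> B(0, ch) \<cdot> W\<^sub>\<delta>\<close> contains about \<open>(\<delta> / h)\<^sup>m\<close> disjoint translates of \<open>B(0, ch)\<close>, centred at a
  grid in \<open>W\<close>, and so has volume at least a multiple of \<open>h\<^sup>d \<delta>\<^sup>m\<close>.\<close>

lemma disjoint_tubes_sum:
  fixes W :: "'n::finite hvec set"
  assumes W: "subspace W" "dim W = m" and m: "0 < m" and dm: "d + m = 2 * CARD('n) + 2"
    and c: "0 < c" "3 * c * real m \<le> 1" and \<delta>: "0 < \<delta>" and J: "finite J"
    and h: "\<And>x. x \<in> J \<Longrightarrow> 0 < h x \<and> h x \<le> \<delta>"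
    and J_diam: "\<And>x y. x \<in> J \<Longrightarrow> y \<in> J \<Longrightarrow> hdist x y \<le> \<delta>"
    and disj: "\<And>x y p v w. x \<in> J \<Longrightarrow> y \<in> J \<Longrightarrow> x \<noteq> y \<Longrightarrow> v \<in> W \<Longrightarrow> w \<in> W \<Longrightarrow> norm v \<le> \<delta> \<Longrightarrow> norm w \<le> \<delta> \<Longrightarrow>
      hnorm (hinv x \<odot> p \<odot> hinv (hlift v)) \<le> c * h x \<Longrightarrow> hnorm (hinv y \<odot> p \<odot> hinv (hlift w)) \<le> c * h y \<Longrightarrow> False"
  shows "(\<Sum>x\<in>J. h x ^ d) \<le> 3 ^ (2 * CARD('n) + 2) * (6 * real m) ^ m / c ^ d * \<delta> ^ d"
proof (cases "J = {}")
  case True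
  then show ?thesis using c \<delta> by simp
next
  case False
  then obtain a where a: "a \<in> J" by auto
  define \<beta> where "\<beta> = 2 * unit_ball_vol (2 * CARD('n))"
  have \<beta>: "\<beta> > 0" using unit_ball_vol_pos[of "2 * CARD('n)"] by (simp add: \<beta>_def)
  define D where "D = 2 * CARD('n) + 2"
  have m1: "1 \<le> real m" using m by simp
  have c1: "c \<le> 1/3"
  proof -
    have "3 * c * 1 \<le> 3 * c * real m" using c m1 by (intro mult_left_mono) auto
    then show ?thesis using c by linarith
  qed
  have ch: "0 < c * h x" "c * h x \<le> \<delta>" "3 * (c * h x) * real m \<le> \<delta>" if "x \<in> J" for x
  proof -
    show "0 < c * h x" using c h[OF that] by simp
    have "c * h x \<le> 1 * \<delta>" using c c1 h[OF that] by (intro mult_mono) auto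
    then show "c * h x \<le> \<delta>" by simp
    have "(3 * c * real m) * h x \<le> 1 * \<delta>" using c h[OF that] by (intro mult_mono) auto
    then show "3 * (c * h x) * real m \<le> \<delta>" by (simp add: mult_ac)
  qed
  define good where "good x G \<longleftrightarrow> finite G \<and> G \<subseteq> W \<and> (\<forall>w\<in>G. norm w \<le> \<delta>) \<and> (\<forall>w\<in>G. \<forall>w'\<in>G. w \<noteq> w' \<longrightarrow> 3 * (c * h x) \<le> dist w w') \<and>
      (\<delta> / (6 * real m * (c * h x))) ^ m \<le> real (card G)" for x G
  have "\<exists>G. good x G" if "x \<in> J" for x
    unfolding good_def using subspace_grid[OF W m ch(1,3)[OF that]] by metis
  then obtain G where "\<And>x. x \<in> J \<Longrightarrow> good x (G x)" by metis
  then have G: "\<And>x. x \<in> J \<Longrightarrow> finite (G x)" "\<And>x. x \<in> J \<Longrightarrow> G x \<subseteq> W"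
    "\<And>x w. x \<in> J \<Longrightarrow> w \<in> G x \<Longrightarrow> norm w \<le> \<delta>"
    "\<And>x w w'. x \<in> J \<Longrightarrow> w \<in> G x \<Longrightarrow> w' \<in> G x \<Longrightarrow> w \<noteq> w' \<Longrightarrow> 3 * (c * h x) \<le> dist w w'"
    "\<And>x. x \<in> J \<Longrightarrow> (\<delta> / (6 * real m * (c * h x))) ^ m \<le> real (card (G x))"
    unfolding good_def by blast+
  define P where "P x w = {p. hnorm (hinv x \<odot> p \<odot> hinv (hlift w)) \<le> c * h x}" for x w
  have P_sets: "P x w \<in> sets lborel" if "x \<in> J" for x w
    unfolding P_def using ch(1)[OF that] by (intro emeasure_translated_ball(1)) simp
  have P_vol: "emeasure lborel (P x w) = ennreal (\<beta> * (c * h x) ^ D)" if "x \<in> J" for x w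
    unfolding P_def \<beta>_def D_def using ch(1)[OF that] by (intro emeasure_translated_ball(2)) simp
  have P_disj: "disjoint_family_on (P x) (G x)" if x: "x \<in> J" for x
    unfolding disjoint_family_on_def
  proof (intro ballI impI)
    fix v w assume vw: "v \<in> G x" "w \<in> G x" "v \<noteq> w"
    show "P x v \<inter> P x w = {}"
    proof (rule ccontr)
      assume "\<not> ?thesis"
      then obtain p where p: "p \<in> P x v" "p \<in> P x w" by blast
      have "norm (hproj p - hproj x - v) \<le> c * h x" "norm (hproj p - hproj x - w) \<le> c * h x"
        using p norm_hproj_le[of "hinv x \<odot> p \<odot> hinv (hlift v)"] norm_hproj_le[of "hinv x \<odot> p \<odot> hinv (hlift w)"]
        by (auto simp: P_def)
      then have "norm ((hproj p - hproj x - w) - (hproj p - hproj x - v)) \<le> c * h x + c * h x"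
        by (meson add_mono norm_triangle_ineq4 order_trans)
      then have "dist v w \<le> 2 * (c * h x)" by (simp add: dist_norm)
      then show False using G(4)[OF x vw] ch(1)[OF x] by linarith
    qed
  qed
  define U where "U x = (\<Union>w\<in>G x. P x w)" for x
  have U_sets: "U x \<in> sets lborel" if "x \<in> J" for x
    unfolding U_def using G(1)[OF that] P_sets[OF that] by (intro sets.finite_UN) auto
  \<comment> \<open>Grid cardinality times ball volume is
    \<open>(\<delta> / h x) ^ m * h x ^ (d + m)\<close> up to constants, that is
    \<open>\<delta> ^ m * h x ^ d\<close>; \<open>K0\<close> collects the constants.\<close>
  define K0 where "K0 = \<beta> * c ^ d / (6 * real m) ^ m"
  have K0: "K0 > 0" using \<beta> c m by (simp add: K0_def)
  have U_vol: "ennreal (K0 * \<delta> ^ m * h x ^ d) \<le> emeasure lborel (U x)" if x: "x \<in> J" for x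
  proof -
    have "K0 * \<delta> ^ m * h x ^ d = (\<delta> / (6 * real m * (c * h x))) ^ m * (\<beta> * (c * h x) ^ D)"
    proof -
      have D: "D = d + m" using dm by (simp add: D_def)
      have hx: "h x > 0" using h[OF x] by simp
      show ?thesis
        unfolding K0_def D using c hx m
        by (simp add: power_add power_divide power_mult_distrib divide_simps)
    qed
    also have "\<dots> \<le> real (card (G x)) * (\<beta> * (c * h x) ^ D)"
      using G(5)[OF x] \<beta> ch(1)[OF x] by (intro mult_right_mono) auto
    finally have "ennreal (K0 * \<delta> ^ m * h x ^ d) \<le> ennreal (real (card (G x)) * (\<beta> * (c * h x) ^ D))"
      by (rule ennreal_leI)
    also have "\<dots> = (\<Sum>w\<in>G x. emeasure lborel (P x w))"
      using \<beta> ch(1)[OF x] by (simp add: P_vol[OF x] ennreal_mult' ennreal_of_nat_eq_real_of_nat)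
    also have "\<dots> = emeasure lborel (U x)"
      unfolding U_def using G(1)[OF x] P_sets[OF x] P_disj[OF x] by (intro sum_emeasure) auto
    finally show ?thesis .
  qed
  have U_disj: "disjoint_family_on U J"
    unfolding disjoint_family_on_def
  proof (intro ballI impI)
    fix x y assume xy: "x \<in> J" "y \<in> J" "x \<noteq> y"
    show "U x \<inter> U y = {}"
    proof (rule ccontr)
      assume "\<not> ?thesis"
      then obtain p v w where "v \<in> G x" "w \<in> G y" "p \<in> P x v" "p \<in> P y w" unfolding U_def by blast
      then show False
        using disj[OF xy, of v w p] G(2)[OF xy(1)] G(2)[OF xy(2)] G(3)[OF xy(1), of v] G(3)[OF xy(2), of w]
        by (auto simp: P_def)
    qed
  qed
  \<comment> \<open>A point of a tube is within \<open>c * h x + \<delta>\<close>, at most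
    \<open>2 * \<delta>\<close>, of its base, and the bases are within \<delta> of a.\<close>
  have U_sub: "U x \<subseteq> {p. hnorm (hinv a \<odot> p \<odot> hinv 0) \<le> 3 * \<delta>}" if x: "x \<in> J" for x
  proof
    fix p assume "p \<in> U x"
    then obtain w where w: "w \<in> G x" "hnorm (hinv x \<odot> p \<odot> hinv (hlift w)) \<le> c * h x" by (auto simp: U_def P_def)
    have "hinv x \<odot> p = (hinv x \<odot> p \<odot> hinv (hlift w)) \<odot> hlift w"
      by (simp add: hmult_assoc hmult_hinv hmult_zero)
    then have "hnorm (hinv x \<odot> p) \<le> c * h x + norm w"
      using hnorm_hmult_le[of "hinv x \<odot> p \<odot> hinv (hlift w)" "hlift w"] w(2) by simp
    then have "hdist p x \<le> 2 * \<delta>" using G(3)[OF x w(1)] ch(2)[OF x] by (simp add: hdist_def)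
    then have "hdist p a \<le> 3 * \<delta>" using hdist_triangle[of p a x] J_diam[OF x a] by linarith
    moreover have "hinv 0 = (0 :: 'n heis)" by (rule heis_eqI) simp_all
    ultimately show "p \<in> {p. hnorm (hinv a \<odot> p \<odot> hinv 0) \<le> 3 * \<delta>}" by (simp add: hmult_zero hdist_def)
  qed
  have "ennreal (\<Sum>x\<in>J. K0 * \<delta> ^ m * h x ^ d) = (\<Sum>x\<in>J. ennreal (K0 * \<delta> ^ m * h x ^ d))"
    using K0 \<delta> h by (intro sum_ennreal[symmetric] mult_nonneg_nonneg) (auto simp: less_imp_le)
  also have "\<dots> \<le> (\<Sum>x\<in>J. emeasure lborel (U x))" by (intro sum_mono U_vol)
  also have "\<dots> = emeasure lborel (\<Union>x\<in>J. U x)" using J U_sets U_disj by (intro sum_emeasure) auto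
  also have "\<dots> \<le> emeasure lborel {p. hnorm (hinv a \<odot> p \<odot> hinv 0) \<le> 3 * \<delta>}"
    using U_sub \<delta> by (intro emeasure_mono emeasure_translated_ball(1) UN_least) auto
  also have "\<dots> = ennreal (\<beta> * (3 * \<delta>) ^ D)"
    unfolding \<beta>_def D_def using \<delta> by (intro emeasure_translated_ball(2)) simp
  finally have "(\<Sum>x\<in>J. K0 * \<delta> ^ m * h x ^ d) \<le> \<beta> * (3 * \<delta>) ^ D"
    using \<beta> \<delta> by (subst (asm) ennreal_le_iff) auto
  then have "K0 * \<delta> ^ m * (\<Sum>x\<in>J. h x ^ d) \<le> \<beta> * (3 * \<delta>) ^ D" by (simp add: sum_distrib_left)
  then have "(\<Sum>x\<in>J. h x ^ d) \<le> \<beta> * (3 * \<delta>) ^ D / (K0 * \<delta> ^ m)"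
    using K0 \<delta> by (simp add: pos_le_divide_eq mult.commute)
  also have "\<dots> = 3 ^ D * (6 * real m) ^ m / c ^ d * \<delta> ^ d"
  proof -
    have D: "D = d + m" using dm by (simp add: D_def)
    show ?thesis
      unfolding K0_def power_mult_distrib[of 3] using \<beta> \<delta> c m
      by (simp add: D power_add divide_simps)
  qed
  finally show ?thesis by (simp add: D_def)
qed

text \<open>If the tubes of x and y meet and \<open>h y \<le> h x\<close>, isotropy merges the two
  translations along W, so \<open>hinv x \<odot> y\<close> is the lift of an element of W up to
  errors of size \<open>c * h x\<close>. When y is in the wide cone at x, N is small on that
  element, and the lower bound of N on W makes it short; y is then so near x that it lies outside
  the narrow cone at \<open>z x\<close>.\<close>

lemma cone_points_local_bound:
  fixes W :: "'n::finite hvec set" and N :: "'n hvec \<Rightarrow> real"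
  assumes W: "subspace W" "dim W = m" and iso: "\<And>v w. v \<in> W \<Longrightarrow> w \<in> W \<Longrightarrow> hform v w = 0"
    and m: "0 < m" and dm: "d + m = 2 * CARD('n) + 2" and d0: "0 < d"
    and N_add: "\<And>v w. N (v + w) \<le> N v + N w" and N_minus: "\<And>v. N (- v) = N v"
    and L: "0 < L" "\<And>v. N v \<le> L * norm v"
    and c0: "0 < c0" "\<And>w. w \<in> W \<Longrightarrow> c0 * norm w \<le> N w" and s: "0 < s" "4 * s \<le> c0"
  obtains C where "0 < C" "\<And>\<epsilon> \<delta> (A :: 'n heis set) S. 0 \<le> \<epsilon> \<Longrightarrow> 0 < \<delta> \<Longrightarrow> S \<subseteq> A \<Longrightarrow>
     (\<forall>x\<in>S. \<forall>y\<in>S. hdist x y \<le> \<delta>) \<Longrightarrow>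
     (\<forall>x\<in>S. \<exists>y\<in>A. x \<noteq> y \<and> hdist x y \<le> \<delta> \<and> 2 * s * hdist x y < N (hproj y - hproj x)) \<Longrightarrow>
     (\<forall>p\<in>A. \<forall>r. 0 < r \<and> r \<le> 2 * \<delta> \<longrightarrow>
        hausdorff d {q\<in>A. hdist p q \<le> r \<and> s * hdist p q < N (hproj q - hproj p)} \<le> ennreal (\<epsilon> * r ^ d)) \<Longrightarrow>
     hausdorff d S \<le> ennreal (C * \<epsilon> * \<delta> ^ d)"
proof -
  \<comment> \<open>Replacing x by a point within \<open>\<tau> * h x\<close> costs at most
    \<open>(L + s) * \<tau> * h x = s / 2 * h x\<close> in the cone inequality. This is less than
    the surplus \<open>s * hdist x (z x)\<close>, since \<open>z x\<close> is farther than
    \<open>h x / 2\<close> from x.\<close>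
  define \<tau> where "\<tau> = s / (2 * (L + s))"
  have \<tau>: "0 < \<tau>" "\<tau> \<le> 1" "(L + s) * \<tau> = s / 2" using L(1) s(1) by (auto simp: \<tau>_def divide_simps)
  \<comment> \<open>Solving \<open>c0 * norm u \<le> 2 * s * (2 * (c * h x) + norm u) + 2 * L * (c *
    h x)\<close> for \<open>norm u\<close>, with \<open>4 * s \<le> c0\<close> absorbing the term on
    the right, gives \<open>(4 * L + 8 * s) / c0\<close> times \<open>c * h x\<close>; the two
    errors add 2.\<close>
  define C1 where "C1 = 2 + (4 * L + 8 * s) / c0"
  have C1: "C1 > 0" using L(1) s(1) c0(1) by (auto simp: C1_def intro!: add_pos_nonneg)
  \<comment> \<open>The first bound brings related points within \<open>\<tau> * h x\<close>, the
    second is what \<open>disjoint_tubes_sum\<close> requires of its grid.\<close>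
  define c where "c = min (\<tau> / C1) (1 / (3 * real m))"
  have c: "0 < c" "3 * c * real m \<le> 1" "C1 * c \<le> \<tau>"
  proof -
    show "0 < c" using \<tau> C1 m by (simp add: c_def)
    have "c \<le> 1 / (3 * real m)" by (simp add: c_def)
    then have "c * (3 * real m) \<le> 1" using m by (simp add: le_divide_eq)
    then show "3 * c * real m \<le> 1" by (simp add: mult_ac)
    have "c \<le> \<tau> / C1" by (simp add: c_def)
    then show "C1 * c \<le> \<tau>" using C1 by (simp add: le_divide_eq mult.commute)
  qed
  define C3 where "C3 = 3 ^ (2 * CARD('n) + 2) * (6 * real m) ^ m / c ^ d"
  have C3: "C3 > 0" using c m by (simp add: C3_def)
  \<comment> \<open>Each selected point is charged for two sets, of radius \<open>h x\<close> around
    x and \<open>2 * h x\<close> around \<open>z x\<close>.\<close>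
  define C where "C = (1 + 2 ^ d) * C3"
  have Cpos: "C > 0" using C3 by (simp add: C_def add_pos_pos)
  have N_tri: "N (u - v) \<le> N u + N v" for u v using N_add[of u "- v"] N_minus[of v] by simp
  show ?thesis
  proof (rule that[OF Cpos])
    fix \<epsilon> \<delta> and A S :: "'n heis set"
    assume \<epsilon>: "0 \<le> \<epsilon>" and \<delta>: "0 < \<delta>" and SA: "S \<subseteq> A" and S_diam: "\<forall>x\<in>S. \<forall>y\<in>S. hdist x y \<le> \<delta>"
      and bad: "\<forall>x\<in>S. \<exists>y\<in>A. x \<noteq> y \<and> hdist x y \<le> \<delta> \<and> 2 * s * hdist x y < N (hproj y - hproj x)"
      and dens: "\<forall>p\<in>A. \<forall>r. 0 < r \<and> r \<le> 2 * \<delta> \<longrightarrow>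
        hausdorff d {q\<in>A. hdist p q \<le> r \<and> s * hdist p q < N (hproj q - hproj p)} \<le> ennreal (\<epsilon> * r ^ d)"
    define H where "H j = \<delta> * (1/2) ^ j" for j :: nat
    have H_pos: "H j > 0" for j using \<delta> by (simp add: H_def)
    have H_Suc: "H (Suc j) = H j / 2" for j by (simp add: H_def)
    have H_mono: "H j \<le> H i" if "i \<le> j" for i j
      unfolding H_def using \<delta> that by (intro mult_left_mono power_decreasing) auto
    have H_le: "H j \<le> \<delta>" for j using H_mono[of 0 j] by (simp add: H_def)
    have scale: "\<exists>j. H (Suc j) < t \<and> t \<le> H j" if t: "0 < t" "t \<le> \<delta>" for t
    proof -
      obtain n where n: "(1/2) ^ n < t / \<delta>" using real_arch_pow_inv[of "t / \<delta>" "1/2"] t \<delta> by auto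
      then have ex: "\<exists>j. H j < t" using \<delta> by (auto simp: H_def pos_less_divide_eq mult.commute)
      define j where "j = (LEAST j. H j < t)"
      have j: "H j < t" unfolding j_def by (rule LeastI_ex[OF ex])
      have "j \<noteq> 0" using j t by (cases "j = 0") (auto simp: H_def)
      then obtain i where i: "j = Suc i" by (cases j) auto
      have "\<not> H i < t" using not_less_Least[of i "\<lambda>j. H j < t"] i by (simp add: j_def)
      then show ?thesis using j i by (intro exI[of _ i]) auto
    qed
    define Q where "Q x j y \<longleftrightarrow> y \<in> A \<and> H (Suc j) < hdist x y \<and> hdist x y \<le> H j \<and> 2 * s * hdist x y < N (hproj y - hproj x)" for x j y
    have Q_ex: "\<exists>j. Q x j y" if "y \<in> A" "x \<noteq> y" "hdist x y \<le> \<delta>" "2 * s * hdist x y < N (hproj y - hproj x)" for x y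
      using scale[OF hdist_pos[OF that(2)] that(3)] that by (auto simp: Q_def)
    \<comment> \<open>The largest distance of a bad companion need not be attained. The least dyadic
      level with a companion replaces it, within a factor 2.\<close>
    define lev where "lev x = (LEAST j. \<exists>y. Q x j y)" for x
    define h where "h x = H (lev x)" for x
    have lev: "\<exists>y. Q x (lev x) y" if xS: "x \<in> S" for x
    proof -
      obtain y where "y \<in> A" "x \<noteq> y" "hdist x y \<le> \<delta>" "2 * s * hdist x y < N (hproj y - hproj x)" using bad xS by blast
      then have "\<exists>j. \<exists>y. Q x j y" using Q_ex by blast
      then show ?thesis unfolding lev_def by (rule LeastI_ex)
    qed
    have h_max: "hdist x y \<le> h x"
      if y: "y \<in> A" "x \<noteq> y" "hdist x y \<le> \<delta>" "2 * s * hdist x y < N (hproj y - hproj x)" for x y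
    proof -
      obtain j where j: "Q x j y" using Q_ex[OF y] by blast
      then have "lev x \<le> j" unfolding lev_def by (intro Least_le) blast
      then have "H j \<le> h x" unfolding h_def by (rule H_mono)
      then show ?thesis using j by (simp add: Q_def)
    qed
    obtain z where z: "\<And>x. x \<in> S \<Longrightarrow> Q x (lev x) (z x)" using lev by metis
    have zA: "z x \<in> A" "h x / 2 < hdist x (z x)" "hdist x (z x) \<le> h x" "2 * s * hdist x (z x) < N (hproj (z x) - hproj x)" if "x \<in> S" for x
      using z[OF that] by (auto simp: Q_def h_def H_Suc)
    have h_pos: "0 < h x" "h x \<le> \<delta>" for x unfolding h_def by (rule H_pos, rule H_le)
    define T where "T x p \<longleftrightarrow> (\<exists>w\<in>W. norm w \<le> \<delta> \<and> hnorm (hinv x \<odot> p \<odot> hinv (hlift w)) \<le> c * h x)" for x p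
    define R where "R x y \<longleftrightarrow> (\<exists>p. T x p \<and> T y p)" for x y
    \<comment> \<open>A selected point must also lie in its own \<open>Z x\<close>; reflexivity lets
      \<open>conflict\<close> cover this case.\<close>
    have R_refl: "R x x" for x
    proof -
      have "T x x" unfolding T_def
      proof (intro bexI[of _ 0] conjI)
        have "hinv x \<odot> x \<odot> hinv (hlift 0) = 0" by (rule heis_eqI) (simp_all add: hform_minus)
        then have "hnorm (hinv x \<odot> x \<odot> hinv (hlift 0)) = 0" by (simp only: hnorm_zero_iff)
        then show "hnorm (hinv x \<odot> x \<odot> hinv (hlift 0)) \<le> c * h x"
          using mult_pos_pos[OF c(1) h_pos(1)[of x]] by linarith
      qed (use \<delta> subspace_0[OF W(1)] in auto)
      then show ?thesis unfolding R_def by blast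
    qed
    define Z where "Z x = {q\<in>A. hdist x q \<le> h x \<and> s * hdist x q < N (hproj q - hproj x)}
        \<union> {q\<in>A. hdist (z x) q \<le> 2 * h x \<and> s * hdist (z x) q < N (hproj q - hproj (z x))}" for x
    have conflict: "y \<in> Z x" if x: "x \<in> S" and y: "y \<in> S" and R: "R x y" and hy: "h y \<le> h x" for x y
    proof (cases "x \<noteq> y \<and> 2 * s * hdist x y < N (hproj y - hproj x)")
      case True
      have yA: "y \<in> A" using y SA by auto
      have "hdist x y \<le> h x" using h_max[OF yA] True S_diam x y by blast
      moreover have "s * hdist x y \<le> 2 * s * hdist x y" using s(1) by simp
      ultimately show ?thesis using True yA unfolding Z_def by (intro UnI1) auto
    next
      case False
      \<comment> \<open>The case \<open>x = y\<close> falls here; the inequality F then reads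
        \<open>N 0 \<le> 0\<close>.\<close>
      have N0: "N 0 \<le> 0" using L(2)[of 0] by simp
      have F: "N (hproj y - hproj x) \<le> 2 * s * hdist x y"
        using False N0 by (cases "x = y") auto
      obtain p v w where p: "v \<in> W" "w \<in> W" "hnorm (hinv x \<odot> p \<odot> hinv (hlift v)) \<le> c * h x"
        "hnorm (hinv y \<odot> p \<odot> hinv (hlift w)) \<le> c * h y"
        using R unfolding R_def T_def by blast
      define b where "b = hinv x \<odot> p \<odot> hinv (hlift v)"
      define b' where "b' = hinv y \<odot> p \<odot> hinv (hlift w)"
      define u where "u = v - w"
      have u: "u \<in> W" unfolding u_def using W(1) p by (intro subspace_diff)
      have hb: "hnorm b \<le> c * h x" using p by (simp add: b_def)
      have "c * h y \<le> c * h x" using hy c by simp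
      then have hb': "hnorm b' \<le> c * h x" using p by (simp add: b'_def)
      \<comment> \<open>Otherwise the product of the lifts would carry a central term from
        \<open>hform v w\<close>, which is not controlled by \<open>h x\<close>.\<close>
      have "hform v w = 0" by (rule iso[OF p(1,2)])
      then have lift: "hlift v \<odot> hinv (hlift w) = hlift u"
        by (intro heis_eqI) (simp_all add: u_def hform_minus)
      have xy: "hinv x \<odot> y = b \<odot> hlift u \<odot> hinv b'"
      proof -
        have "b \<odot> hlift u \<odot> hinv b' = hinv x \<odot> p \<odot> (hinv (hlift v) \<odot> (hlift v \<odot> (hinv (hlift w) \<odot> (hlift w \<odot> (hinv p \<odot> y)))))"
          unfolding b_def b'_def lift[symmetric] by (simp only: hinv_hmult hinv_hinv hmult_assoc)
        also have "\<dots> = hinv x \<odot> y" by (simp add: hmult_assoc)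
        finally show ?thesis by simp
      qed
      have dxy: "hdist x y \<le> 2 * (c * h x) + norm u"
      proof -
        have "hdist x y = hnorm (b \<odot> hlift u \<odot> hinv b')"
          unfolding xy[symmetric] hdist_commute[of x] by (simp only: hdist_def)
        also have "\<dots> \<le> hnorm (b \<odot> hlift u) + hnorm (hinv b')" by (rule hnorm_hmult_le)
        also have "\<dots> \<le> hnorm b + norm u + hnorm b'" using hnorm_hmult_le[of b "hlift u"] by simp
        finally show ?thesis using hb hb' by linarith
      qed
      have "u = (hproj y - hproj x) - (hproj b - hproj b')"
      proof -
        have "hproj (hinv x \<odot> y) = hproj (b \<odot> hlift u \<odot> hinv b')" by (simp only: xy)
        then show ?thesis by (simp add: algebra_simps)
      qed
      then have "N u \<le> N (hproj y - hproj x) + (N (hproj b) + N (hproj b'))"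
        using N_tri[of "hproj y - hproj x" "hproj b - hproj b'"] N_tri[of "hproj b" "hproj b'"] by simp
      moreover have "N (hproj b) \<le> L * (c * h x)"
        using L(2)[of "hproj b"] mult_left_mono[OF order_trans[OF norm_hproj_le hb], of L] L(1) by linarith
      moreover have "N (hproj b') \<le> L * (c * h x)"
        using L(2)[of "hproj b'"] mult_left_mono[OF order_trans[OF norm_hproj_le hb'], of L] L(1) by linarith
      moreover have "2 * s * hdist x y \<le> 2 * s * (2 * (c * h x) + norm u)" using dxy s by simp
      ultimately have 1: "c0 * norm u \<le> 2 * s * (2 * (c * h x) + norm u) + 2 * L * (c * h x)"
        using c0(2)[OF u] F by linarith
      have "4 * s * norm u \<le> c0 * norm u" using s by (intro mult_right_mono) auto
      then have "c0 * norm u \<le> (4 * L + 8 * s) * (c * h x)" using 1 by (simp add: algebra_simps)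
      then have "norm u \<le> (4 * L + 8 * s) / c0 * (c * h x)"
        using c0(1) by (simp add: pos_le_divide_eq mult.commute)
      then have "hdist x y \<le> C1 * (c * h x)" using dxy by (simp add: C1_def distrib_right)
      also have "\<dots> \<le> \<tau> * h x" using c(3) h_pos[of x] by (simp add: mult.assoc[symmetric])
      finally have close: "hdist x y \<le> \<tau> * h x" .
      have "\<tau> * h x \<le> h x" using \<tau> h_pos[of x] by simp
      have d1: "hdist (z x) y \<le> hdist x (z x) + \<tau> * h x"
        using hdist_triangle[of "z x" y x] close hdist_commute[of x "z x"] by linarith
      then have d2: "hdist (z x) y \<le> 2 * h x" using zA(3)[OF x] \<open>\<tau> * h x \<le> h x\<close> by linarith
      have "norm (hproj y - hproj x) \<le> \<tau> * h x"
        using norm_hproj_diff_le[of y x] close hdist_commute[of x y] by linarith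
      then have "N (hproj y - hproj x) \<le> L * (\<tau> * h x)"
        using L(2)[of "hproj y - hproj x"] L(1) mult_left_mono[of "norm (hproj y - hproj x)" "\<tau> * h x" L] by linarith
      moreover have "N (hproj (z x) - hproj x) \<le> N (hproj y - hproj x) + N (hproj y - hproj (z x))"
        using N_tri[of "hproj y - hproj x" "hproj y - hproj (z x)"] by simp
      ultimately have "2 * s * hdist x (z x) - L * (\<tau> * h x) < N (hproj y - hproj (z x))"
        using zA(4)[OF x] by linarith
      moreover have "s * hdist (z x) y \<le> s * (hdist x (z x) + \<tau> * h x)" using d1 s(1) by simp
      moreover have "s * (h x / 2) < s * hdist x (z x)" using zA(2)[OF x] s(1) by simp
      moreover have "L * (\<tau> * h x) + s * (\<tau> * h x) = s / 2 * h x"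
        using \<tau>(3) by (metis distrib_right mult.assoc)
      ultimately have "s * hdist (z x) y < N (hproj y - hproj (z x))"
        by (simp add: algebra_simps)
      then show ?thesis using d2 y SA unfolding Z_def by (intro UnI2) auto
    qed
    have Z_le: "hausdorff d (Z x) \<le> ennreal ((1 + 2 ^ d) * \<epsilon> * h x ^ d)" if x: "x \<in> S" for x
    proof -
      have "hausdorff d (Z x) \<le> ennreal (\<epsilon> * h x ^ d) + ennreal (\<epsilon> * (2 * h x) ^ d)"
        unfolding Z_def
      proof (rule order_trans[OF hausdorff_Un_le[OF d0]], rule add_mono)
        show "hausdorff d {q\<in>A. hdist x q \<le> h x \<and> s * hdist x q < N (hproj q - hproj x)} \<le> ennreal (\<epsilon> * h x ^ d)"
          using dens x SA h_pos[of x] by auto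
        show "hausdorff d {q\<in>A. hdist (z x) q \<le> 2 * h x \<and> s * hdist (z x) q < N (hproj q - hproj (z x))} \<le> ennreal (\<epsilon> * (2 * h x) ^ d)"
        proof -
          have "0 < 2 * h x \<and> 2 * h x \<le> 2 * \<delta>" using h_pos[of x] by simp
          then show ?thesis using dens zA(1)[OF x] by blast
        qed
      qed
      also have "\<dots> = ennreal (\<epsilon> * h x ^ d + \<epsilon> * (2 * h x) ^ d)"
        using \<epsilon> h_pos[of x] by (intro ennreal_plus[symmetric]) auto
      also have "\<epsilon> * h x ^ d + \<epsilon> * (2 * h x) ^ d = (1 + 2 ^ d) * \<epsilon> * h x ^ d"
        by (simp add: power_mult_distrib algebra_simps)
      finally show ?thesis .
    qed
    have R_sym: "R x y \<Longrightarrow> R y x" for x y unfolding R_def by blast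
    have "\<exists>I\<subseteq>S. (\<forall>x\<in>I. \<forall>y\<in>I. x \<noteq> y \<longrightarrow> \<not> R x y) \<and> (\<forall>y\<in>S. \<exists>x\<in>I. lev x \<le> lev y \<and> (x = y \<or> R x y))"
      by (rule greedy_selection) (rule R_sym)
    then obtain I where I0: "I \<subseteq> S" and I1: "\<forall>x\<in>I. \<forall>y\<in>I. x \<noteq> y \<longrightarrow> \<not> R x y"
      and I2: "\<forall>y\<in>S. \<exists>x\<in>I. lev x \<le> lev y \<and> (x = y \<or> R x y)"
      by (elim exE conjE) (rule that)
    have I: "I \<subseteq> S" "\<And>x y. x \<in> I \<Longrightarrow> y \<in> I \<Longrightarrow> x \<noteq> y \<Longrightarrow> \<not> R x y"
      "\<And>y. y \<in> S \<Longrightarrow> \<exists>x\<in>I. lev x \<le> lev y \<and> (x = y \<or> R x y)"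
      by (fact I0) (use I1 in blast, use I2 in blast)
    have J_sum: "(\<Sum>x\<in>J. h x ^ d) \<le> C3 * \<delta> ^ d" if J: "finite J" "J \<subseteq> I" for J
      unfolding C3_def
    proof (rule disjoint_tubes_sum[OF W m dm c(1,2) \<delta> J(1)])
      show "0 < h x \<and> h x \<le> \<delta>" for x using h_pos by simp
      show "hdist x y \<le> \<delta>" if "x \<in> J" "y \<in> J" for x y using that S_diam J(2) I(1) by blast
      fix x y p v w assume xy: "x \<in> J" "y \<in> J" "x \<noteq> y" "v \<in> W" "w \<in> W" "norm v \<le> \<delta>" "norm w \<le> \<delta>"
        "hnorm (hinv x \<odot> p \<odot> hinv (hlift v)) \<le> c * h x" "hnorm (hinv y \<odot> p \<odot> hinv (hlift w)) \<le> c * h y"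
      then have "R x y" unfolding R_def T_def by blast
      then show False using I(2)[of x y] xy J(2) by blast
    qed
    \<comment> \<open>Selected points of one level share the value of h, so the packing sum bounds
      their number. The selected set is thus countable and subadditivity applies.\<close>
    define I' where "I' j = {x\<in>I. lev x = j}" for j
    have I'_fin: "finite (I' j)" for j
    proof (rule ccontr)
      assume inf: "infinite (I' j)"
      obtain M :: nat where M: "C3 * \<delta> ^ d / H j ^ d < real M" using reals_Archimedean2 by blast
      obtain J where J: "finite J" "card J = M" "J \<subseteq> I' j" using infinite_arbitrarily_large[OF inf] by blast
      have "(\<Sum>x\<in>J. h x ^ d) = (\<Sum>x\<in>J. H j ^ d)"
        using J(3) by (intro sum.cong refl) (auto simp: I'_def h_def)
      then have "real M * H j ^ d \<le> C3 * \<delta> ^ d"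
        using J_sum[OF J(1)] J by (auto simp: I'_def)
      then show False using M H_pos[of j] by (simp add: pos_divide_less_eq)
    qed
    have "S \<subseteq> (\<Union>j. \<Union>x\<in>I' j. Z x)"
    proof
      fix y assume y: "y \<in> S"
      obtain x where x: "x \<in> I" "lev x \<le> lev y" "x = y \<or> R x y" using I(3)[OF y] by blast
      have "y \<in> Z x" using conflict[of x y] x y I(1) R_refl[of x] H_mono[OF x(2)] unfolding h_def by blast
      then show "y \<in> (\<Union>j. \<Union>x\<in>I' j. Z x)" using x(1) unfolding I'_def by blast
    qed
    then have "hausdorff d S \<le> hausdorff d (\<Union>j. \<Union>x\<in>I' j. Z x)" by (rule hausdorff_mono)
    also have "\<dots> \<le> (\<Sum>j. hausdorff d (\<Union>x\<in>I' j. Z x))" by (rule hausdorff_countable_subadditive)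
    also have "\<dots> \<le> (\<Sum>j. \<Sum>x\<in>I' j. ennreal ((1 + 2 ^ d) * \<epsilon> * h x ^ d))"
    proof (intro suminf_le summableI)
      fix j
      have "hausdorff d (\<Union>x\<in>I' j. Z x) \<le> (\<Sum>x\<in>I' j. hausdorff d (Z x))" by (rule hausdorff_UN_le[OF d0 I'_fin])
      also have "\<dots> \<le> (\<Sum>x\<in>I' j. ennreal ((1 + 2 ^ d) * \<epsilon> * h x ^ d))"
        using I(1) by (intro sum_mono Z_le) (auto simp: I'_def)
      finally show "hausdorff d (\<Union>x\<in>I' j. Z x) \<le> (\<Sum>x\<in>I' j. ennreal ((1 + 2 ^ d) * \<epsilon> * h x ^ d))" .
    qed
    also have "\<dots> \<le> ennreal (C * \<epsilon> * \<delta> ^ d)"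
    proof (rule suminf_le_const[OF summableI])
      fix k
      have fin: "finite (\<Union>j<k. I' j)" using I'_fin by auto
      have "(\<Sum>j<k. \<Sum>x\<in>I' j. ennreal ((1 + 2 ^ d) * \<epsilon> * h x ^ d)) = (\<Sum>x\<in>(\<Union>j<k. I' j). ennreal ((1 + 2 ^ d) * \<epsilon> * h x ^ d))"
        using I'_fin by (intro sum.UNION_disjoint[symmetric]) (auto simp: I'_def)
      also have "\<dots> = ennreal (\<Sum>x\<in>(\<Union>j<k. I' j). (1 + 2 ^ d) * \<epsilon> * h x ^ d)"
        using \<epsilon> h_pos by (intro sum_ennreal mult_nonneg_nonneg) (auto simp: less_imp_le)
      also have "\<dots> \<le> ennreal (C * \<epsilon> * \<delta> ^ d)"
      proof (rule ennreal_leI)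
        have "(\<Sum>x\<in>(\<Union>j<k. I' j). (1 + 2 ^ d) * \<epsilon> * h x ^ d) = (1 + 2 ^ d) * \<epsilon> * (\<Sum>x\<in>(\<Union>j<k. I' j). h x ^ d)"
          by (simp add: sum_distrib_left)
        also have "\<dots> \<le> (1 + 2 ^ d) * \<epsilon> * (C3 * \<delta> ^ d)"
          using \<epsilon> J_sum[OF fin] by (intro mult_left_mono) (auto simp: I'_def)
        finally show "(\<Sum>x\<in>(\<Union>j<k. I' j). (1 + 2 ^ d) * \<epsilon> * h x ^ d) \<le> C * \<epsilon> * \<delta> ^ d"
          by (simp add: C_def mult_ac)
      qed
      finally show "(\<Sum>j<k. \<Sum>x\<in>I' j. ennreal ((1 + 2 ^ d) * \<epsilon> * h x ^ d)) \<le> ennreal (C * \<epsilon> * \<delta> ^ d)" .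
    qed
    finally show "hausdorff d S \<le> ennreal (C * \<epsilon> * \<delta> ^ d)" .
  qed
qed

text \<open>\<open>\<epsilon>\<close> is chosen so small that the bad set \<open>B\<close> satisfies \<open>H(B) \<le> H(B) / 2\<close>.\<close>

lemma cone_points_null:
  fixes W :: "'n::finite hvec set" and N :: "'n hvec \<Rightarrow> real"
  assumes W: "subspace W" "dim W = m" and iso: "\<And>v w. v \<in> W \<Longrightarrow> w \<in> W \<Longrightarrow> hform v w = 0"
    and m: "0 < m" and dm: "d + m = 2 * CARD('n) + 2" and d0: "0 < d"
    and N_add: "\<And>v w. N (v + w) \<le> N v + N w" and N_minus: "\<And>v. N (- v) = N v"
    and L: "0 < L" "\<And>v. N v \<le> L * norm v"
    and c0: "0 < c0" "\<And>w. w \<in> W \<Longrightarrow> c0 * norm w \<le> N w" and s: "0 < s" "4 * s \<le> c0"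
  obtains \<epsilon> where "0 < \<epsilon>" "\<And>(A :: 'n heis set) \<rho>. 0 < \<rho> \<Longrightarrow> hausdorff d A < \<infinity> \<Longrightarrow>
     (\<forall>p\<in>A. \<forall>r. 0 < r \<and> r < \<rho> \<longrightarrow>
        hausdorff d {q\<in>A. hdist p q \<le> r \<and> s * hdist p q < N (hproj q - hproj p)} \<le> ennreal (\<epsilon> * r ^ d)) \<Longrightarrow>
     hausdorff d {x\<in>A. \<forall>\<delta>>0. \<exists>y\<in>A. x \<noteq> y \<and> hdist x y \<le> \<delta> \<and> 2 * s * hdist x y < N (hproj y - hproj x)} = 0"
proof -
  obtain C where C: "0 < C" and bound: "\<And>\<epsilon> \<delta> (A :: 'n heis set) S. 0 \<le> \<epsilon> \<Longrightarrow> 0 < \<delta> \<Longrightarrow> S \<subseteq> A \<Longrightarrow>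
     (\<forall>x\<in>S. \<forall>y\<in>S. hdist x y \<le> \<delta>) \<Longrightarrow>
     (\<forall>x\<in>S. \<exists>y\<in>A. x \<noteq> y \<and> hdist x y \<le> \<delta> \<and> 2 * s * hdist x y < N (hproj y - hproj x)) \<Longrightarrow>
     (\<forall>p\<in>A. \<forall>r. 0 < r \<and> r \<le> 2 * \<delta> \<longrightarrow>
        hausdorff d {q\<in>A. hdist p q \<le> r \<and> s * hdist p q < N (hproj q - hproj p)} \<le> ennreal (\<epsilon> * r ^ d)) \<Longrightarrow>
     hausdorff d S \<le> ennreal (C * \<epsilon> * \<delta> ^ d)"
    by (rule cone_points_local_bound[OF assms], assumption+, rule that) assumption+
  \<comment> \<open>The factor \<open>2 ^ d\<close> offsets the normalisation of
    \<open>hausdorff\<close> that appears in \<open>hausdorff_le_of_local_bound\<close>.\<close>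
  define \<epsilon> where "\<epsilon> = 1 / (2 * C * 2 ^ d)"
  have \<epsilon>: "\<epsilon> > 0" using C by (simp add: \<epsilon>_def)
  have C\<epsilon>: "C * \<epsilon> * 2 ^ d = 1/2" using C by (simp add: \<epsilon>_def)
  show ?thesis
  proof (rule that[OF \<epsilon>])
    fix A :: "'n heis set" and \<rho> :: real
    assume \<rho>: "0 < \<rho>" and fin: "hausdorff d A < \<infinity>" and dens: "\<forall>p\<in>A. \<forall>r. 0 < r \<and> r < \<rho> \<longrightarrow>
        hausdorff d {q\<in>A. hdist p q \<le> r \<and> s * hdist p q < N (hproj q - hproj p)} \<le> ennreal (\<epsilon> * r ^ d)"
    define B where "B = {x\<in>A. \<forall>\<delta>>0. \<exists>y\<in>A. x \<noteq> y \<and> hdist x y \<le> \<delta> \<and> 2 * s * hdist x y < N (hproj y - hproj x)}"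
    \<comment> \<open>Radii up to \<open>2 * D\<close> occur in \<open>bound\<close>, and
      \<open>2 * D \<le> 2 * \<rho> / 3 < \<rho>\<close>.\<close>
    have loc: "hausdorff d (B \<inter> S) \<le> ennreal (C * \<epsilon>) * hdiam S ^ d" if S: "hdiam S \<le> ennreal (\<rho> / 3)" for S
    proof -
      have "hdiam S \<noteq> \<infinity>" using S by (auto simp: top_unique)
      then obtain D where D: "D \<ge> 0" "hdiam S = ennreal D" by (cases "hdiam S") auto
      have dist: "hdist x y \<le> D" if "x \<in> S" "y \<in> S" for x y
        using hdist_le_hdiam[OF that] D by simp
      show ?thesis
      proof (cases "D = 0")
        \<comment> \<open>\<open>bound\<close> asks for a positive diameter; a set of diameter 0 has
          at most one point.\<close>
        case True
        have "B \<inter> S \<subseteq> {x}" if "x \<in> B \<inter> S" for x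
        proof
          fix y assume "y \<in> B \<inter> S"
          then have "hdist x y \<le> 0" using dist[of x y] that True by simp
          then show "y \<in> {x}" using hdist_pos[of x y] by force
        qed
        then have "hausdorff d (B \<inter> S) = 0"
          using hausdorff_singleton[OF d0] hausdorff_null_subset hausdorff_empty[OF d0] by (metis all_not_in_conv)
        then show ?thesis by simp
      next
        case False
        then have Dpos: "D > 0" using D by simp
        have "D \<le> \<rho> / 3" using S D \<rho> by simp
        have "hausdorff d (B \<inter> S) \<le> ennreal (C * \<epsilon> * D ^ d)"
        proof (rule bound[of \<epsilon> D "B \<inter> S" A])
          show "B \<inter> S \<subseteq> A" by (auto simp: B_def)
          show "\<forall>x\<in>B \<inter> S. \<forall>y\<in>B \<inter> S. hdist x y \<le> D" using dist by blast
          show "\<forall>x\<in>B \<inter> S. \<exists>y\<in>A. x \<noteq> y \<and> hdist x y \<le> D \<and> 2 * s * hdist x y < N (hproj y - hproj x)"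
            using Dpos unfolding B_def by blast
          show "\<forall>p\<in>A. \<forall>r. 0 < r \<and> r \<le> 2 * D \<longrightarrow>
             hausdorff d {q\<in>A. hdist p q \<le> r \<and> s * hdist p q < N (hproj q - hproj p)} \<le> ennreal (\<epsilon> * r ^ d)"
          proof (intro ballI allI impI)
            fix p r assume "p \<in> A" "0 < r \<and> r \<le> 2 * D"
            moreover have "r < \<rho>" using calculation \<open>D \<le> \<rho> / 3\<close> \<rho> by linarith
            ultimately show "hausdorff d {q\<in>A. hdist p q \<le> r \<and> s * hdist p q < N (hproj q - hproj p)} \<le> ennreal (\<epsilon> * r ^ d)"
              using dens by blast
          qed
        qed (use \<epsilon> Dpos in auto)
        also have "\<dots> = ennreal (C * \<epsilon>) * hdiam S ^ d"
          using C \<epsilon> D by (simp add: ennreal_mult' ennreal_power)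
        finally show ?thesis .
      qed
    qed
    have "hausdorff d B \<le> ennreal (C * \<epsilon> * 2 ^ d) * hausdorff d B"
      using \<rho> C \<epsilon> by (intro hausdorff_le_of_local_bound[of "\<rho> / 3"] loc) auto
    then have half: "hausdorff d B \<le> ennreal (1/2) * hausdorff d B" by (simp only: C\<epsilon>)
    have "hausdorff d B < \<infinity>" using hausdorff_mono[of B A d] fin by (auto simp: B_def order_le_less_trans)
    then obtain b where b: "b \<ge> 0" "hausdorff d B = ennreal b" by (cases "hausdorff d B") auto
    have "ennreal (1/2) * ennreal b = ennreal (1/2 * b)" by (rule ennreal_mult'[symmetric]) simp
    then have "ennreal b \<le> ennreal (1/2 * b)" using half unfolding b(2) by (simp only:)
    then have "b \<le> 1/2 * b" using b(1) by (subst (asm) ennreal_le_iff) auto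
    then have "b = 0" using b by simp
    then show "hausdorff d {x\<in>A. \<forall>\<delta>>0. \<exists>y\<in>A. x \<noteq> y \<and> hdist x y \<le> \<delta> \<and> 2 * s * hdist x y < N (hproj y - hproj x)} = 0"
      using b unfolding B_def by simp
  qed
qed

section \<open>Homogeneous subgroups\<close>

lemma homogeneous_subgroup_closed:
  assumes "homogeneous_subgroup S"
  shows "0 \<in> S" "p \<in> S \<Longrightarrow> q \<in> S \<Longrightarrow> p \<odot> q \<in> S" "p \<in> S \<Longrightarrow> hinv p \<in> S" "0 < r \<Longrightarrow> p \<in> S \<Longrightarrow> dil r p \<in> S"
proof -
  have S: "subgroup S heis_group" using assms by (simp add: homogeneous_subgroup_def)
  show "0 \<in> S" using subgroup.one_closed[OF S] by simp
  show "p \<in> S \<Longrightarrow> q \<in> S \<Longrightarrow> p \<odot> q \<in> S" using subgroup.m_closed[OF S] by simp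
  show "p \<in> S \<Longrightarrow> hinv p \<in> S" using subgroup.m_inv_closed[OF S] by (simp add: inv_heis_group)
  show "0 < r \<Longrightarrow> p \<in> S \<Longrightarrow> dil r p \<in> S" using assms by (auto simp: homogeneous_subgroup_def)
qed

lemma homogeneous_subgroup_subspace_hproj:
  assumes "homogeneous_subgroup S"
  shows "subspace (hproj ` S)"
  unfolding subspace_def
proof (intro conjI ballI allI)
  note S = homogeneous_subgroup_closed[OF assms]
  have "hproj 0 \<in> hproj ` S" using S(1) by (rule imageI)
  then show zero: "0 \<in> hproj ` S" by simp
  show "x + y \<in> hproj ` S" if xy: "x \<in> hproj ` S" "y \<in> hproj ` S" for x y
  proof -
    obtain p q where "p \<in> S" "x = hproj p" "q \<in> S" "y = hproj q" using xy by blast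
    then show ?thesis using S(2)[of p q] by (metis hproj_hmult imageI)
  qed
  show "c *\<^sub>R x \<in> hproj ` S" if x: "x \<in> hproj ` S" for c x
  proof -
    obtain p where p: "p \<in> S" "x = hproj p" using x by blast
    consider "c > 0" | "c = 0" | "c < 0" by linarith
    then show ?thesis
    proof cases
      case 1 then show ?thesis using S(4)[OF 1 p(1)] p by (metis hproj_dil imageI)
    next
      case 2 then show ?thesis using zero by simp
    next
      case 3
      then have "dil (- c) (hinv p) \<in> S" using S(3,4) p by simp
      moreover have "hproj (dil (- c) (hinv p)) = c *\<^sub>R x" by (simp add: p)
      ultimately show ?thesis by (metis imageI)
    qed
  qed
qed

text \<open>If \<open>(z, t) \<in> S\<close> then comparing \<open>\<delta>\<^sub>2 (z, t) = (2 z, 4 t)\<close> with \<open>(z, t)\<^sup>2 = (2 z, 2 t)\<close> puts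
  \<open>(0, 2 t)\<close> into \<open>S\<close>.\<close>

lemma homogeneous_subgroup_center:
  assumes S: "homogeneous_subgroup S" and p: "p \<in> S" "hcen p \<noteq> 0"
  shows "(0, 0, t) \<in> S"
proof -
  note cl = homogeneous_subgroup_closed[OF S]
  define c where "c = 2 * hcen p"
  have c0: "c \<noteq> 0" using p by (simp add: c_def)
  have "hinv (p \<odot> p) \<odot> dil 2 p \<in> S" using cl p by simp
  moreover have "hinv (p \<odot> p) \<odot> dil 2 p = (0, 0, c)"
    by (rule heis_eqI) (simp_all add: c_def hform_add hform_minus hform_diff hform_scale zero_prod_def scaleR_2)
  ultimately have c: "(0, 0, c) \<in> S" by simp
  have pos: "(0, 0, r * c) \<in> S" if "r > 0" for r
    using cl(4)[of "sqrt r" "(0, 0, c)"] c that by simp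
  have neg: "(0, 0, - r * c) \<in> S" if "r > 0" for r
    using cl(3)[OF pos[OF that]] by simp
  define r where "r = t / c"
  have t: "t = r * c" using c0 by (simp add: r_def)
  consider "r > 0" | "r = 0" | "r < 0" by linarith
  then show ?thesis
  proof cases
    case 1 then show ?thesis using pos t by simp
  next
    case 2 then show ?thesis using cl(1) t by (simp add: zero_prod_def)
  next
    case 3 then show ?thesis using neg[of "- r"] t by simp
  qed
qed

text \<open>One nonzero central coordinate puts the whole centre into S, and S is then a preimage
  under \<open>hproj\<close>. Otherwise S consists of lifts, and closure under products makes the
  form vanish, as \<open>2 * hform\<close> is the central coordinate of a product of lifts.\<close>

lemma homogeneous_subgroup_cases:
  fixes S :: "'n::finite heis set"
  assumes S: "homogeneous_subgroup S"
  obtains (vertical) "S = {p. hproj p \<in> hproj ` S}" "dim S = dim (hproj ` S) + 1"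
  | (horizontal) "S = hlift ` (hproj ` S)" "dim S = dim (hproj ` S)"
      "\<And>z w. z \<in> hproj ` S \<Longrightarrow> w \<in> hproj ` S \<Longrightarrow> hform z w = 0"
proof -
  note cl = homogeneous_subgroup_closed[OF S]
  note sub = homogeneous_subgroup_subspace_hproj[OF S]
  show thesis
  proof (cases "\<exists>p\<in>S. hcen p \<noteq> 0")
    case True
    then have cen: "(0, 0, t) \<in> S" for t using homogeneous_subgroup_center[OF S] by blast
    have eq: "S = {p. hproj p \<in> hproj ` S}"
    proof
      show "{p. hproj p \<in> hproj ` S} \<subseteq> S"
      proof
        fix p assume "p \<in> {p. hproj p \<in> hproj ` S}"
        then obtain q where q: "q \<in> S" "hproj p = hproj q" by blast
        have "p = q \<odot> (0, 0, hcen p - hcen q)"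
          by (rule heis_eqI) (simp_all add: q zero_prod_def[symmetric])
        then show "p \<in> S" using cl(2)[OF q(1) cen[of "hcen p - hcen q"]] by simp
      qed
    qed auto
    define f where "f zt = (fst (fst zt), snd (fst zt), snd zt)" for zt :: "'n hvec \<times> real"
    have f: "linear f" by (rule linearI) (simp_all add: f_def)
    have "S = f ` (hproj ` S \<times> UNIV)"
    proof -
      have "p \<in> f ` (hproj ` S \<times> UNIV)" if "p \<in> S" for p
        using that by (intro image_eqI[of _ _ "(hproj p, hcen p)"]) (auto simp: f_def intro: heis_cases)
      moreover have "f (z, t) \<in> S" if "z \<in> hproj ` S" for z t
        using that by (subst eq) (simp add: f_def)
      ultimately show ?thesis by blast
    qed
    moreover have "inj f" by (rule injI) (auto simp: f_def prod_eq_iff)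
    ultimately have "dim S = dim (hproj ` S \<times> (UNIV :: real set))"
      using dim_image_eq[OF f] by (metis inj_on_subset subset_UNIV)
    also have "\<dots> = dim (hproj ` S) + 1"
      using sub by (subst dim_Times) auto
    finally show ?thesis using vertical eq by blast
  next
    case False
    then have h0: "hcen p = 0" if "p \<in> S" for p using that by blast
    have lift: "hlift (hproj p) = p" if "p \<in> S" for p using h0[OF that] by (intro heis_eqI) auto
    have eq: "S = hlift ` (hproj ` S)" using lift by (auto simp: image_image)
    have lin: "linear (hlift :: 'n hvec \<Rightarrow> _)" by (rule linearI) (simp_all add: hlift_def)
    have "inj (hlift :: 'n hvec \<Rightarrow> _)" by (rule injI) (metis hproj_hlift)
    then have "dim (hlift ` (hproj ` S)) = dim (hproj ` S)"
      using dim_image_eq[OF lin] inj_on_subset by blast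
    then have "dim S = dim (hproj ` S)" using eq by simp
    moreover have "hform z w = 0" if zw: "z \<in> hproj ` S" "w \<in> hproj ` S" for z w
    proof -
      obtain p q where "p \<in> S" "z = hproj p" "q \<in> S" "w = hproj q" using zw by blast
      then show ?thesis using h0[of "p \<odot> q"] h0[of p] h0[of q] cl(2)[of p q] by simp
    qed
    ultimately show ?thesis using horizontal eq by blast
  qed
qed

text \<open>\<open>hrot\<close> maps U injectively into its orthogonal complement, so twice the
  dimension is at most 2n.\<close>

lemma isotropic_dim_le:
  fixes U :: "'n::finite hvec set"
  assumes U: "subspace U" and iso: "\<And>z w. z \<in> U \<Longrightarrow> w \<in> U \<Longrightarrow> hform z w = 0"
  shows "dim U \<le> CARD('n)"
proof -
  have lin: "linear (hrot :: 'n hvec \<Rightarrow> _)" using bounded_linear_hrot bounded_linear.linear by blast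
  have "inj (hrot :: 'n hvec \<Rightarrow> _)" by (rule injI) (auto simp: hrot_def prod_eq_iff)
  then have "dim (hrot ` U) = dim U" using dim_image_eq[OF lin] inj_on_subset by blast
  moreover have "hrot ` U \<subseteq> {y \<in> UNIV. \<forall>x\<in>U. orthogonal x y}"
    using iso by (auto simp: orthogonal_def hform_inner inner_commute)
  then have "dim (hrot ` U) \<le> dim {y \<in> UNIV. \<forall>x\<in>U. orthogonal x y}" by (rule dim_subset)
  moreover have "dim {y \<in> UNIV. \<forall>x\<in>U. orthogonal x y} + dim U = dim (UNIV :: 'n hvec set)"
    using U by (intro dim_subspace_orthogonal_to_vectors) auto
  moreover have "dim (UNIV :: 'n hvec set) = 2 * CARD('n)" by simp
  ultimately show ?thesis by linarith
qed

text \<open>Isotropic subspaces have dimension at most n < k, so V cannot be horizontal; being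
  vertical it contains the centre, and its complement must be horizontal. The
  \<open>\<kappa> i\<close> form an orthonormal basis of the complement of the horizontal part of V;
  they vanish on V and so bound the distance to V from below. The constant c measures how
  transversal W is to V.\<close>

lemma hgrassmannian_frame:
  fixes V :: "'n::finite heis set"
  assumes V: "V \<in> hgrassmannian k" and k: "CARD('n) + 1 \<le> k" "k \<le> 2 * CARD('n)"
    and m: "m = 2 * CARD('n) + 1 - k"
  obtains \<kappa> :: "nat \<Rightarrow> 'n hvec" and W c
  where "\<And>i. i < m \<Longrightarrow> norm (\<kappa> i) = 1" "\<And>i j. i < m \<Longrightarrow> j < m \<Longrightarrow> i \<noteq> j \<Longrightarrow> \<kappa> i \<bullet> \<kappa> j = 0"
    "\<And>i x. i < m \<Longrightarrow> \<bar>\<kappa> i \<bullet> hproj x\<bar> \<le> hsetdist x V"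
    "subspace W" "dim W = m" "\<And>v w. v \<in> W \<Longrightarrow> w \<in> W \<Longrightarrow> hform v w = 0"
    "0 < c" "\<And>w. w \<in> W \<Longrightarrow> c * norm w \<le> (\<Sum>i<m. \<bar>\<kappa> i \<bullet> w\<bar>)"
proof -
  obtain W' where hV: "homogeneous_subgroup V" and dV: "dim V = k" and hW: "homogeneous_subgroup W'"
    and dW: "dim W' = m" and int: "V \<inter> W' = {0}"
    using V m by (auto simp: hgrassmannian_def)
  define U where "U = hproj ` V"
  define W where "W = hproj ` W'"
  have U: "subspace U" unfolding U_def by (rule homogeneous_subgroup_subspace_hproj[OF hV])
  have W: "subspace W" unfolding W_def by (rule homogeneous_subgroup_subspace_hproj[OF hW])
  have vert: "V = {p. hproj p \<in> U}" "dim V = dim U + 1"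
  proof -
    show "V = {p. hproj p \<in> U}" "dim V = dim U + 1"
      using hV
    proof (atomize (full), cases rule: homogeneous_subgroup_cases)
      case vertical then show "V = {p. hproj p \<in> U} \<and> dim V = dim U + 1" unfolding U_def by blast
    next
      case horizontal
      then have "dim U \<le> CARD('n)" unfolding U_def by (intro isotropic_dim_le U[unfolded U_def]) auto
      then show "V = {p. hproj p \<in> U} \<and> dim V = dim U + 1" using horizontal(2) dV k unfolding U_def by simp
    qed
  qed
  have horiz: "W' = hlift ` W" "dim W' = dim W" "\<And>z w. z \<in> W \<Longrightarrow> w \<in> W \<Longrightarrow> hform z w = 0"
  proof (atomize (full))
    show "W' = hlift ` W \<and> dim W' = dim W \<and> (\<forall>z w. z \<in> W \<longrightarrow> w \<in> W \<longrightarrow> hform z w = 0)"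
      using hW
    proof (cases rule: homogeneous_subgroup_cases)
      case vertical
      have "0 \<in> W" "0 \<in> U" using W U by (auto simp: subspace_0)
      moreover have "hproj (0, 0, 1) = (0 :: 'n hvec)" by (simp add: zero_prod_def)
      ultimately have "(0, 0, 1) \<in> V \<inter> W'"
        unfolding vert(1) by (subst vertical(1)) (simp add: W_def[symmetric])
      then show ?thesis using int by (simp add: zero_prod_def)
    next
      case horizontal then show ?thesis unfolding W_def by blast
    qed
  qed
  have WU: "w = 0" if "w \<in> W" "w \<in> U" for w
  proof -
    have "hlift w \<in> V \<inter> W'" using that vert(1) horiz(1) by auto
    then have "hlift w = 0" using int by simp
    then show ?thesis by (metis hproj_hlift hproj_zero)
  qed
  define P where "P = U\<^sup>\<bottom>"
  have P: "subspace P" unfolding P_def by (rule subspace_orthogonal_comp)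
  have "dim P + dim U = dim (UNIV :: 'n hvec set)"
    using dim_subspace_orthogonal_to_vectors[OF U subspace_UNIV] by (simp add: P_def orthogonal_comp_def)
  moreover have "dim (UNIV :: 'n hvec set) = 2 * CARD('n)" by simp
  ultimately have dP: "dim P = m" using vert(2) dV m k by linarith
  obtain B where B: "B \<subseteq> P" "pairwise orthogonal B" "\<And>x. x \<in> B \<Longrightarrow> norm x = 1" "independent B" "card B = dim P" "span B = P"
    using orthonormal_basis_subspace[OF P] by metis
  have finB: "finite B" using B(4) independent_imp_finite by blast
  obtain \<kappa> where \<kappa>: "bij_betw \<kappa> {0..<m} B" using ex_bij_betw_nat_finite[OF finB] B(5) dP by auto
  have \<kappa>B: "\<kappa> i \<in> B" if "i < m" for i using \<kappa> that by (auto simp: bij_betw_def)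
  have \<kappa>_norm: "norm (\<kappa> i) = 1" if "i < m" for i using B(3) \<kappa>B[OF that] by blast
  have \<kappa>_orth: "\<kappa> i \<bullet> \<kappa> j = 0" if "i < m" "j < m" "i \<noteq> j" for i j
  proof -
    have "\<kappa> i \<noteq> \<kappa> j" using \<kappa> that by (auto simp: bij_betw_def inj_on_def)
    then show ?thesis using B(2) \<kappa>B that by (auto simp: pairwise_def orthogonal_def)
  qed
  have \<kappa>_dist: "\<bar>\<kappa> i \<bullet> hproj x\<bar> \<le> hsetdist x V" if i: "i < m" for i x
  proof (rule hsetdist_greatest)
    show "V \<noteq> {}" using int by auto
    fix q assume "q \<in> V"
    then have "hproj q \<in> U" using vert(1) by blast
    moreover have "\<kappa> i \<in> U\<^sup>\<bottom>" using \<kappa>B[OF i] B(1) by (auto simp: P_def)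
    ultimately have "\<kappa> i \<bullet> hproj q = 0" by (auto simp: orthogonal_comp_def orthogonal_def inner_commute)
    then have "\<bar>\<kappa> i \<bullet> hproj x\<bar> = \<bar>\<kappa> i \<bullet> (hproj x - hproj q)\<bar>" by (simp add: inner_diff_right)
    also have "\<dots> \<le> norm (\<kappa> i) * norm (hproj x - hproj q)" by (rule Cauchy_Schwarz_ineq2)
    also have "\<dots> \<le> hdist x q" using \<kappa>_norm[OF i] norm_hproj_diff_le[of x q] by simp
    finally show "\<bar>\<kappa> i \<bullet> hproj x\<bar> \<le> hdist x q" .
  qed
  \<comment> \<open>Orthogonal projection to P. It is injective on W because W and U meet only in 0,
    and an injective linear map on a subspace is bounded below.\<close>
  define f where "f z = (\<Sum>i<m. (\<kappa> i \<bullet> z) *\<^sub>R \<kappa> i)" for z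
  have f_inner: "f z \<bullet> \<kappa> j = \<kappa> j \<bullet> z" if j: "j < m" for z j
  proof -
    have "f z \<bullet> \<kappa> j = (\<Sum>i<m. if i = j then \<kappa> j \<bullet> z else 0)"
      unfolding f_def inner_sum_left
      using \<kappa>_orth \<kappa>_norm j by (intro sum.cong refl) (auto simp: dot_square_norm)
    then show ?thesis using j by simp
  qed
  have bl: "bounded_linear f"
    unfolding f_def by (intro bounded_linear_sum bounded_linear_scaleR_left[THEN bounded_linear_compose] bounded_linear_inner_right)
  have "w = 0" if w: "w \<in> W" "f w = 0" for w
  proof -
    have "\<kappa> i \<bullet> w = 0" if "i < m" for i using f_inner[OF that, of w] w(2) by simp
    then have "orthogonal w b" if "b \<in> B" for b
      using that \<kappa> by (auto simp: bij_betw_def orthogonal_def inner_commute)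
    then have "orthogonal w y" if "y \<in> span B" for y
      using orthogonal_to_span[OF that, of w] by blast
    then have "w \<in> P\<^sup>\<bottom>" using B(6) by (auto simp: orthogonal_comp_def orthogonal_def inner_commute)
    then have "w \<in> U" unfolding P_def by (simp add: orthogonal_comp_self[OF U])
    then show ?thesis using WU w by blast
  qed
  then obtain c where c: "c > 0" "\<And>w. w \<in> W \<Longrightarrow> c * norm w \<le> norm (f w)"
    using injective_imp_isometric[OF closed_subspace[OF W] W bl] by (auto simp: mult.commute)
  have c_sum: "c * norm w \<le> (\<Sum>i<m. \<bar>\<kappa> i \<bullet> w\<bar>)" if "w \<in> W" for w
  proof -
    have "norm (f w) \<le> (\<Sum>i<m. \<bar>\<kappa> i \<bullet> w\<bar>)"
      unfolding f_def by (rule sum_norm_le) (simp add: \<kappa>_norm)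
    then show ?thesis using c(2)[OF that] by linarith
  qed
  show ?thesis
  proof (rule that[of \<kappa> W c])
    show "dim W = m" using horiz(2) dW by simp
  qed (fact \<kappa>_norm \<kappa>_orth \<kappa>_dist W horiz(3) c(1) c_sum)+
qed

section \<open>Rectifiability\<close>

text \<open>Each frame has its own transversality constant, so Lindelof's theorem first provides
  countably many reference frames, dense relative to these constants. A point is classified by a
  reference frame a near its own, by a scale \<open>1 / (t + 1)\<close> below which its density is
  at most \<open>\<epsilon> a\<close>, and, off the null sets of \<open>cone_points_null\<close>, by
  a scale \<open>1 / (u + 1)\<close> below which its class stays in the cone. The label encodes
  these three numbers.\<close>

lemma cone_level_decomposition:
  fixes E :: "'n::finite heis set" and \<kappa> :: "'n heis \<Rightarrow> nat \<Rightarrow> 'n hvec"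
  assumes dm: "d + m = 2 * CARD('n) + 2" and m: "0 < m" and d: "0 < d" and fin: "hausdorff d E < \<infinity>"
    and \<kappa>: "\<And>p i. p \<in> E \<Longrightarrow> i < m \<Longrightarrow> norm (\<kappa> p i) = 1"
    and W: "\<And>p. p \<in> E \<Longrightarrow> subspace (W p)" "\<And>p. p \<in> E \<Longrightarrow> dim (W p) = m"
      "\<And>p v w. p \<in> E \<Longrightarrow> v \<in> W p \<Longrightarrow> w \<in> W p \<Longrightarrow> hform v w = 0"
    and c: "\<And>p. p \<in> E \<Longrightarrow> 0 < c p" "\<And>p w. p \<in> E \<Longrightarrow> w \<in> W p \<Longrightarrow> c p * norm w \<le> (\<Sum>i<m. \<bar>\<kappa> p i \<bullet> w\<bar>)"
    and cone: "\<And>p s \<epsilon>. p \<in> E \<Longrightarrow> 0 < s \<Longrightarrow> s < 1 \<Longrightarrow> 0 < \<epsilon> \<Longrightarrow> \<exists>R>0. \<forall>r. 0 < r \<longrightarrow> r < R \<longrightarrow>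
      hausdorff d {q\<in>E. hdist p q \<le> r \<and> s * hdist p q < (\<Sum>i<m. \<bar>\<kappa> p i \<bullet> (hproj q - hproj p)\<bar>)} \<le> ennreal (\<epsilon> * r ^ d)"
    and \<sigma>: "0 < \<sigma>" "\<sigma> \<le> 1"
  shows "\<exists>Z (l :: 'n heis \<Rightarrow> nat) k \<rho>. hausdorff d Z = 0 \<and> (\<forall>a. 0 < \<rho> a) \<and>
     (\<forall>p\<in>E - Z. (\<Sum>i<m. norm (\<kappa> p i - k (l p) i)) \<le> \<sigma>) \<and>
     (\<forall>p\<in>E - Z. \<forall>q\<in>E - Z. l p = l q \<longrightarrow> hdist p q \<le> \<rho> (l p) \<longrightarrow>
        (\<Sum>i<m. \<bar>k (l p) i \<bullet> (hproj q - hproj p)\<bar>) \<le> \<sigma> * hdist p q)"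
proof (cases "E = {}")
  case True
  then show ?thesis
    by (intro exI[of _ "{}"] exI[of _ "\<lambda>_. 0"] exI[of _ "\<lambda>_ _. 0"] exI[of _ "\<lambda>_. 1"]) (simp add: hausdorff_empty d)
next
  case False
  define D where "D k k' = (\<Sum>i<m. norm (k i - k' i))" for k k' :: "nat \<Rightarrow> 'n hvec"
  define N where "N k z = (\<Sum>i<m. \<bar>k i \<bullet> z\<bar>)" for k :: "nat \<Rightarrow> 'n hvec" and z
  have N_diff: "N k z \<le> N k' z + D k k' * norm z" for k k' z
  proof -
    have "N k z \<le> (\<Sum>i<m. \<bar>k' i \<bullet> z\<bar> + norm (k i - k' i) * norm z)"
      unfolding N_def
    proof (rule sum_mono)
      fix i
      have "\<bar>k i \<bullet> z\<bar> \<le> \<bar>k' i \<bullet> z\<bar> + \<bar>(k i - k' i) \<bullet> z\<bar>" by (simp add: inner_diff_left)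
      also have "\<dots> \<le> \<bar>k' i \<bullet> z\<bar> + norm (k i - k' i) * norm z" by (intro add_left_mono Cauchy_Schwarz_ineq2)
      finally show "\<bar>k i \<bullet> z\<bar> \<le> \<bar>k' i \<bullet> z\<bar> + norm (k i - k' i) * norm z" .
    qed
    then show ?thesis by (simp add: N_def D_def sum.distrib sum_distrib_right)
  qed
  have N_add: "N k (v + w) \<le> N k v + N k w" for k v w
    unfolding N_def sum.distrib[symmetric] by (intro sum_mono) (simp add: inner_add_right)
  have N_minus: "N k (- v) = N k v" for k v by (simp add: N_def)
  have N_le: "N (\<kappa> p) v \<le> real m * norm v" if "p \<in> E" for p v
  proof -
    have "\<bar>\<kappa> p i \<bullet> v\<bar> \<le> norm v" if "i < m" for i
      using Cauchy_Schwarz_ineq2[of "\<kappa> p i" v] \<kappa>[OF \<open>p \<in> E\<close> that] by simp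
    then have "N (\<kappa> p) v \<le> (\<Sum>i<m. norm v)" unfolding N_def by (intro sum_mono) simp
    then show ?thesis by simp
  qed
  \<comment> \<open>\<open>\<sigma> / 2\<close> because the resulting cone has opening
    \<open>2 * s\<close>; \<open>c p / 4\<close> is the requirement of
    \<open>cone_points_null\<close>.\<close>
  define s where "s p = min (\<sigma> / 2) (c p / 4)" for p
  have s: "0 < s p" "s p \<le> \<sigma> / 2" "4 * s p \<le> c p" if "p \<in> E" for p
    using \<sigma> c(1)[OF that] by (auto simp: s_def)
  \<comment> \<open>Replacing the frame of a point by a reference frame changes N by at most half of
    s times the distance; the cone hypothesis is therefore used with opening
    \<open>s / 2\<close>.\<close>
  define \<O> where "\<O> p = {k. D k (\<kappa> p) < s p / 2}" for p
  have \<O>_open: "open (\<O> p)" for p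
    unfolding \<O>_def D_def by (intro open_Collect_less continuous_intros continuous_on_product_coordinates)
  obtain F where F: "F \<subseteq> \<O> ` E" "countable F" "\<Union>F = \<Union>(\<O> ` E)"
    using Lindelof[of "\<O> ` E"] \<O>_open by blast
  then obtain P where P: "countable P" "P \<subseteq> E" "F = \<O> ` P"
    by (metis countable_subset_image)
  have in_O: "\<kappa> p \<in> \<O> p" if "p \<in> E" for p using s(1)[OF that] by (simp add: \<O>_def D_def)
  have P_cover: "\<exists>p'\<in>P. \<kappa> p \<in> \<O> p'" if "p \<in> E" for p
    using in_O[OF that] that F(3) P(3) by blast
  have P_ne: "P \<noteq> {}" using P_cover False by blast
  define rp where "rp = from_nat_into P"
  have rp: "rp a \<in> E" for a using from_nat_into[OF P_ne] P(2) by (auto simp: rp_def)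
  have rp_cover: "\<exists>a. \<kappa> p \<in> \<O> (rp a)" if "p \<in> E" for p
    using P_cover[OF that] from_nat_into_surj[OF P(1)] unfolding rp_def by metis
  define bad where "bad a A = {x\<in>A. \<forall>\<delta>>0. \<exists>y\<in>A. x \<noteq> y \<and> hdist x y \<le> \<delta> \<and>
      2 * s (rp a) * hdist x y < N (\<kappa> (rp a)) (hproj y - hproj x)}" for a A
  define small where "small a \<epsilon> \<longleftrightarrow> 0 < \<epsilon> \<and> (\<forall>(A :: 'n heis set) \<rho>. 0 < \<rho> \<longrightarrow> hausdorff d A < \<infinity> \<longrightarrow>
     (\<forall>p\<in>A. \<forall>r. 0 < r \<and> r < \<rho> \<longrightarrow>
        hausdorff d {q\<in>A. hdist p q \<le> r \<and> s (rp a) * hdist p q < N (\<kappa> (rp a)) (hproj q - hproj p)} \<le> ennreal (\<epsilon> * r ^ d)) \<longrightarrow>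
     hausdorff d (bad a A) = 0)" for a and \<epsilon> :: real
  have "\<exists>\<epsilon>. small a \<epsilon>" for a
  proof -
    have cN: "c (rp a) * norm w \<le> N (\<kappa> (rp a)) w" if "w \<in> W (rp a)" for w
      using c(2)[OF rp that] by (simp add: N_def)
    have m': "0 < real m" using m by simp
    obtain \<epsilon> where e: "0 < \<epsilon>" and *: "\<And>(A :: 'n heis set) \<rho>. 0 < \<rho> \<Longrightarrow> hausdorff d A < \<infinity> \<Longrightarrow>
       (\<forall>p\<in>A. \<forall>r. 0 < r \<and> r < \<rho> \<longrightarrow>
          hausdorff d {q\<in>A. hdist p q \<le> r \<and> s (rp a) * hdist p q < N (\<kappa> (rp a)) (hproj q - hproj p)} \<le> ennreal (\<epsilon> * r ^ d)) \<Longrightarrow>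
       hausdorff d {x\<in>A. \<forall>\<delta>>0. \<exists>y\<in>A. x \<noteq> y \<and> hdist x y \<le> \<delta> \<and> 2 * s (rp a) * hdist x y < N (\<kappa> (rp a)) (hproj y - hproj x)} = 0"
      by (rule cone_points_null[OF W(1,2)[OF rp[of a]] W(3)[OF rp[of a]] m dm d N_add[of "\<kappa> (rp a)"]
            N_minus[of "\<kappa> (rp a)"] m' N_le[OF rp[of a]] c(1)[OF rp[of a]] cN s(1,3)[OF rp[of a]]], assumption+, rule that) assumption+
    show ?thesis unfolding small_def bad_def using e * by (intro exI[of _ \<epsilon>] conjI allI impI)
  qed
  then obtain \<epsilon> where "\<And>a. small a (\<epsilon> a)" by metis
  then have \<epsilon>: "\<And>a. 0 < \<epsilon> a" and null: "\<And>a (A :: 'n heis set) \<rho>. 0 < \<rho> \<Longrightarrow> hausdorff d A < \<infinity> \<Longrightarrow>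
     \<forall>p\<in>A. \<forall>r. 0 < r \<and> r < \<rho> \<longrightarrow>
        hausdorff d {q\<in>A. hdist p q \<le> r \<and> s (rp a) * hdist p q < N (\<kappa> (rp a)) (hproj q - hproj p)} \<le> ennreal (\<epsilon> a * r ^ d) \<Longrightarrow>
     hausdorff d (bad a A) = 0"
    unfolding small_def by blast+
  define A where "A a t = {p\<in>E. \<kappa> p \<in> \<O> (rp a) \<and> (\<forall>r. 0 < r \<and> r < 1 / real (Suc t) \<longrightarrow>
      hausdorff d {q\<in>E. hdist p q \<le> r \<and> s (rp a) * hdist p q < N (\<kappa> (rp a)) (hproj q - hproj p)} \<le> ennreal (\<epsilon> a * r ^ d))}" for a t
  have A_cover: "\<exists>a t. p \<in> A a t" if p: "p \<in> E" for p
  proof -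
    obtain a where a: "\<kappa> p \<in> \<O> (rp a)" using rp_cover[OF p] by blast
    have sa: "0 < s (rp a) / 2" "s (rp a) / 2 < 1" using s(1,2)[OF rp, of a] \<sigma> by auto
    obtain R where R: "R > 0" "\<And>r. 0 < r \<Longrightarrow> r < R \<Longrightarrow>
      hausdorff d {q\<in>E. hdist p q \<le> r \<and> s (rp a) / 2 * hdist p q < (\<Sum>i<m. \<bar>\<kappa> p i \<bullet> (hproj q - hproj p)\<bar>)} \<le> ennreal (\<epsilon> a * r ^ d)"
      using cone[OF p sa \<epsilon>[of a]] by blast
    obtain t where t: "1 / real (Suc t) < R" using R(1) nat_approx_posE by blast
    have "p \<in> A a t"
      unfolding A_def
    proof (intro CollectI conjI allI impI)
      fix r assume r: "0 < r \<and> r < 1 / real (Suc t)"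
      have "{q\<in>E. hdist p q \<le> r \<and> s (rp a) * hdist p q < N (\<kappa> (rp a)) (hproj q - hproj p)}
        \<subseteq> {q\<in>E. hdist p q \<le> r \<and> s (rp a) / 2 * hdist p q < (\<Sum>i<m. \<bar>\<kappa> p i \<bullet> (hproj q - hproj p)\<bar>)}"
      proof clarify
        fix x y u assume q: "s (rp a) * hdist p (x, y, u) < N (\<kappa> (rp a)) (hproj (x, y, u) - hproj p)"
        define q where "q = (x, y, u)"
        have "D (\<kappa> (rp a)) (\<kappa> p) = D (\<kappa> p) (\<kappa> (rp a))" unfolding D_def by (simp add: norm_minus_commute)
        then have "D (\<kappa> (rp a)) (\<kappa> p) \<le> s (rp a) / 2" using a by (simp add: \<O>_def)
        moreover have "norm (hproj q - hproj p) \<le> hdist p q" using norm_hproj_diff_le[of q p] by (simp add: hdist_commute)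
        ultimately have "D (\<kappa> (rp a)) (\<kappa> p) * norm (hproj q - hproj p) \<le> s (rp a) / 2 * hdist p q"
          using s(1)[OF rp, of a] by (intro mult_mono) auto
        then have "s (rp a) / 2 * hdist p q < N (\<kappa> p) (hproj q - hproj p)"
          using N_diff[of "\<kappa> (rp a)" "hproj q - hproj p" "\<kappa> p"] q unfolding q_def[symmetric] by linarith
        then show "s (rp a) / 2 * hdist p (x, y, u) < (\<Sum>i<m. \<bar>\<kappa> p i \<bullet> (hproj (x, y, u) - hproj p)\<bar>)"
          unfolding q_def[symmetric] N_def .
      qed
      then show "hausdorff d {q\<in>E. hdist p q \<le> r \<and> s (rp a) * hdist p q < N (\<kappa> (rp a)) (hproj q - hproj p)} \<le> ennreal (\<epsilon> a * r ^ d)"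
        using R(2)[of r] r t hausdorff_mono order_trans by (meson less_trans)
    qed (use p a in auto)
    then show ?thesis by blast
  qed
  have bad_null: "hausdorff d (bad a (A a t)) = 0" for a t
  proof (rule null[of "1 / real (Suc t)"])
    have AE: "A a t \<subseteq> E" by (auto simp: A_def)
    then show "hausdorff d (A a t) < \<infinity>" using hausdorff_mono[of "A a t" E d] fin by (simp add: order_le_less_trans)
    show "\<forall>p\<in>A a t. \<forall>r. 0 < r \<and> r < 1 / real (Suc t) \<longrightarrow>
        hausdorff d {q\<in>A a t. hdist p q \<le> r \<and> s (rp a) * hdist p q < N (\<kappa> (rp a)) (hproj q - hproj p)} \<le> ennreal (\<epsilon> a * r ^ d)"
    proof (intro ballI allI impI)
      fix p r assume pr: "p \<in> A a t" "0 < r \<and> r < 1 / real (Suc t)"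
      have "hausdorff d {q\<in>A a t. hdist p q \<le> r \<and> s (rp a) * hdist p q < N (\<kappa> (rp a)) (hproj q - hproj p)}
        \<le> hausdorff d {q\<in>E. hdist p q \<le> r \<and> s (rp a) * hdist p q < N (\<kappa> (rp a)) (hproj q - hproj p)}"
        using AE by (intro hausdorff_mono) blast
      also have "\<dots> \<le> ennreal (\<epsilon> a * r ^ d)" using pr unfolding A_def by blast
      finally show "hausdorff d {q\<in>A a t. hdist p q \<le> r \<and> s (rp a) * hdist p q < N (\<kappa> (rp a)) (hproj q - hproj p)} \<le> ennreal (\<epsilon> a * r ^ d)" .
    qed
  qed simp
  define Z where "Z = (\<Union>a. \<Union>t. bad a (A a t))"
  have Z: "hausdorff d Z = 0" unfolding Z_def by (intro hausdorff_null_UN bad_null)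
  define coded where "coded p a t u \<longleftrightarrow> p \<in> A a t \<and>
      (\<forall>y\<in>A a t. hdist p y \<le> 1 / real (Suc u) \<longrightarrow> N (\<kappa> (rp a)) (hproj y - hproj p) \<le> 2 * s (rp a) * hdist p y)" for p a t u
  have "\<exists>a t u. coded p a t u" if p: "p \<in> E - Z" for p
  proof -
    obtain a t where at: "p \<in> A a t" using A_cover p by blast
    then have "p \<notin> bad a (A a t)" using p unfolding Z_def by blast
    then obtain \<delta> where \<delta>: "\<delta> > 0" "\<And>y. y \<in> A a t \<Longrightarrow> p \<noteq> y \<Longrightarrow> hdist p y \<le> \<delta> \<Longrightarrow>
        N (\<kappa> (rp a)) (hproj y - hproj p) \<le> 2 * s (rp a) * hdist p y"
      using at unfolding bad_def by (auto simp: not_less)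
    obtain u where u: "1 / real (Suc u) < \<delta>" using \<delta>(1) nat_approx_posE by blast
    have "N (\<kappa> (rp a)) (hproj y - hproj p) \<le> 2 * s (rp a) * hdist p y" if "y \<in> A a t" "hdist p y \<le> 1 / real (Suc u)" for y
      using \<delta>(2)[of y] that u by (cases "p = y") (auto simp: N_def)
    then show ?thesis using at unfolding coded_def by blast
  qed
  then obtain fa ft fu where "\<And>p. p \<in> E - Z \<Longrightarrow> coded p (fa p) (ft p) (fu p)" by metis
  then have code: "\<And>p. p \<in> E - Z \<Longrightarrow> p \<in> A (fa p) (ft p)"
    "\<And>p y. p \<in> E - Z \<Longrightarrow> y \<in> A (fa p) (ft p) \<Longrightarrow> hdist p y \<le> 1 / real (Suc (fu p)) \<Longrightarrow>
      N (\<kappa> (rp (fa p))) (hproj y - hproj p) \<le> 2 * s (rp (fa p)) * hdist p y"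
    unfolding coded_def by blast+
  define l where "l p = to_nat (fa p, ft p, fu p)" for p
  define k where "k a = \<kappa> (rp (fst (from_nat a :: nat \<times> nat \<times> nat)))" for a
  define \<rho> where "\<rho> a = 1 / real (Suc (snd (snd (from_nat a :: nat \<times> nat \<times> nat))))" for a
  have k_l: "k (l p) = \<kappa> (rp (fa p))" and \<rho>_l: "\<rho> (l p) = 1 / real (Suc (fu p))" for p
    by (simp_all add: k_def \<rho>_def l_def)
  show ?thesis
  proof (intro exI[of _ Z] exI[of _ l] exI[of _ k] exI[of _ \<rho>] conjI ballI allI impI)
    show "hausdorff d Z = 0" by (rule Z)
    show "0 < \<rho> a" for a by (simp add: \<rho>_def)
    show "(\<Sum>i<m. norm (\<kappa> p i - k (l p) i)) \<le> \<sigma>" if "p \<in> E - Z" for p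
    proof -
      have "D (\<kappa> p) (\<kappa> (rp (fa p))) < s (rp (fa p)) / 2" using code(1)[OF that] by (simp add: A_def \<O>_def)
      then show ?thesis using s(1,2)[OF rp, of "fa p"] \<sigma>(1) unfolding k_l D_def by linarith
    qed
    show "(\<Sum>i<m. \<bar>k (l p) i \<bullet> (hproj q - hproj p)\<bar>) \<le> \<sigma> * hdist p q"
      if p: "p \<in> E - Z" and q: "q \<in> E - Z" and pq: "l p = l q" "hdist p q \<le> \<rho> (l p)" for p q
    proof -
      have "fa q = fa p" "ft q = ft p" using pq(1) by (auto simp: l_def)
      then have "q \<in> A (fa p) (ft p)" using code(1)[OF q] by simp
      then have "N (k (l p)) (hproj q - hproj p) \<le> 2 * s (rp (fa p)) * hdist p q"
        unfolding k_l using pq(2) code(2)[OF p] by (simp add: \<rho>_l)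
      also have "\<dots> \<le> \<sigma> * hdist p q" using s(2)[OF rp, of "fa p"] by (intro mult_right_mono) auto
      finally show ?thesis by (simp add: N_def)
    qed
  qed
qed

text \<open>Near a point of K the gradients are within a total of 1/2 of an orthonormal system, so
  the linear system for the differentials is a solvable perturbation of the identity. This gives
  surjectivity on a whole neighbourhood of K, as \<open>H_regular\<close> demands.\<close>

lemma H_regular_from_gradients:
  fixes f :: "nat \<Rightarrow> 'n::finite heis \<Rightarrow> real"
  assumes k: "k \<le> 2 * CARD('n)" and m: "m = 2 * CARD('n) + 1 - k"
    and g: "\<And>i. i < m \<Longrightarrow> continuous_on UNIV (g i)" "\<And>i q. i < m \<Longrightarrow> has_hgrad (f i) (g i q) q"
    and f: "\<And>i q. i < m \<Longrightarrow> q \<in> K \<Longrightarrow> f i q = 0"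
    and on: "\<And>i q. i < m \<Longrightarrow> q \<in> K \<Longrightarrow> norm (g i q) = 1"
      "\<And>i j q. i < m \<Longrightarrow> j < m \<Longrightarrow> i \<noteq> j \<Longrightarrow> q \<in> K \<Longrightarrow> g i q \<bullet> g j q = 0"
  shows "\<exists>S. K \<subseteq> S \<and> H_regular k S"
proof -
  define U where "U = (\<Union>p\<in>K. {q. (\<Sum>i<m. norm (g i q - g i p)) < 1/2})"
  have U: "open U"
    unfolding U_def by (intro open_UN ballI open_Collect_less continuous_intros g(1)) auto
  have KU: "K \<subseteq> U" unfolding U_def by force
  have pd: "pansu_differential (f i) q v = g i q \<bullet> hproj v" if "i < m" for i q v
    using pansu_differential_eq[OF has_hgrad_pansu[OF g(2)[OF that, of q]]] by simp
  have surj: "\<exists>v. \<forall>i<m. pansu_differential (f i) q v = c i" if q: "q \<in> U" for q and c :: "nat \<Rightarrow> real"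
  proof -
    obtain p where p: "p \<in> K" "(\<Sum>i<m. norm (g i q - g i p)) < 1/2" using q by (auto simp: U_def)
    \<comment> \<open>Built so that \<open>T z \<bullet> g j p = g j q \<bullet> z\<close>;
      surjectivity of T therefore prescribes all components at once.\<close>
    define T where "T z = z + (\<Sum>i<m. ((g i q - g i p) \<bullet> z) *\<^sub>R g i p)" for z
    have lin: "linear T"
      by (rule linearI)
        (simp_all add: T_def inner_add_right sum.distrib scaleR_add_left scaleR_add_right scaleR_sum_right)
    have "z = 0" if "T z = 0" for z
    proof -
      define w where "w = (\<Sum>i<m. ((g i q - g i p) \<bullet> z) *\<^sub>R g i p)"
      have "z = - w" using that unfolding T_def w_def[symmetric] eq_neg_iff_add_eq_0 .
      then have "norm z = norm w" by simp
      also have "\<dots> \<le> (\<Sum>i<m. norm (g i q - g i p) * norm z)"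
        unfolding w_def
      proof (rule sum_norm_le)
        fix i assume "i \<in> {..<m}"
        then show "norm (((g i q - g i p) \<bullet> z) *\<^sub>R g i p) \<le> norm (g i q - g i p) * norm z"
          using Cauchy_Schwarz_ineq2[of "g i q - g i p" z] on(1)[of i p] p(1) by simp
      qed
      also have "\<dots> \<le> 1/2 * norm z" unfolding sum_distrib_right[symmetric] using p(2) by (intro mult_right_mono) auto
      finally show ?thesis by simp
    qed
    then have "inj T" using linear_injective_0[OF lin] by blast
    then have "surj T" using linear_injective_imp_surjective[OF lin] by simp
    then obtain z where z: "T z = (\<Sum>i<m. c i *\<^sub>R g i p)" by (metis surjD)
    have "g j q \<bullet> z = c j" if j: "j < m" for j
    proof -
      have pick: "(\<Sum>i<m. a i *\<^sub>R g i p) \<bullet> g j p = a j" for a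
      proof -
        have "(\<Sum>i<m. a i *\<^sub>R g i p) \<bullet> g j p = (\<Sum>i<m. if i = j then a j else 0)"
          unfolding inner_sum_left using on p(1) j
          by (intro sum.cong refl) (auto simp: dot_square_norm)
        then show ?thesis using j by simp
      qed
      have "T z \<bullet> g j p = c j" unfolding z by (rule pick)
      then have "z \<bullet> g j p + (g j q - g j p) \<bullet> z = c j" unfolding T_def inner_add_left pick .
      then show ?thesis by (simp add: inner_diff_left inner_commute[of z])
    qed
    then show ?thesis by (intro exI[of _ "hlift z"]) (simp add: pd)
  qed
  define S where "S = {q\<in>U. \<forall>i<m. f i q = 0}"
  have C1: "C1H_on U (f i)" if "i < m" for i
    using g(2)[OF that] by (intro C1H_onI[of U "g i"] continuous_on_subset[OF g(1)[OF that]]) auto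
  have "H_regular k S"
    unfolding H_regular_def Let_def m[symmetric]
  proof -
    have "\<exists>U f. open U \<and> p \<in> U \<and> (\<forall>i<m. C1H_on U (f i)) \<and>
        (\<forall>q\<in>U. \<forall>c :: nat \<Rightarrow> real. \<exists>v. \<forall>i<m. pansu_differential (f i) q v = c i) \<and>
        S \<inter> U = {q \<in> U. \<forall>i<m. f i q = 0}" if "p \<in> S" for p
      using that U C1 surj by (intro exI[of _ U] exI[of _ f]) (auto simp: S_def)
    then show "if k = 2 * CARD('n) + 1 then open S else \<forall>p\<in>S. \<exists>U f. open U \<and> p \<in> U \<and> (\<forall>i<m. C1H_on U (f i)) \<and>
        (\<forall>q\<in>U. \<forall>c :: nat \<Rightarrow> real. \<exists>v. \<forall>i<m. pansu_differential (f i) q v = c i) \<and>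
        S \<inter> U = {q \<in> U. \<forall>i<m. f i q = 0}"
      using k by simp
  qed
  moreover have "K \<subseteq> S" using KU f by (auto simp: S_def)
  ultimately show ?thesis by blast
qed

text \<open>Labels are locally constant for the Euclidean distance, whereas Whitney's condition is
  in \<open>hdist\<close>. Left translation shears Euclidean distances without bound, so the
  comparison rests on compactness.\<close>

lemma hdist_imp_dist_small:
  fixes K :: "'n::finite heis set"
  assumes K: "compact K" and e: "0 < e"
  shows "\<exists>\<delta>>0. \<forall>x\<in>K. \<forall>y\<in>K. hdist x y < \<delta> \<longrightarrow> dist x y < e"
proof (rule ccontr)
  assume "\<not> ?thesis"
  then have "\<forall>\<delta>>0. \<exists>x\<in>K. \<exists>y\<in>K. hdist x y < \<delta> \<and> \<not> dist x y < e" by blast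
  then have "\<exists>x\<in>K. \<exists>y\<in>K. hdist x y < 1 / real (Suc n) \<and> e \<le> dist x y" for n
    unfolding not_less by simp
  then obtain x y where xy: "\<And>n. x n \<in> K" "\<And>n. y n \<in> K" "\<And>n. hdist (x n) (y n) < 1 / real (Suc n)" "\<And>n. e \<le> dist (x n) (y n)"
    by metis
  have "seq_compact (K \<times> K)" using K by (intro compact_imp_seq_compact compact_Times)
  moreover have "\<forall>n. (x n, y n) \<in> K \<times> K" using xy by simp
  ultimately obtain z r where r: "strict_mono (r :: nat \<Rightarrow> nat)" and lim: "((\<lambda>n. (x n, y n)) \<circ> r) \<longlonglongrightarrow> z"
    by (rule seq_compactE)
  define a b where "a = fst z" and "b = snd z"
  have a: "(\<lambda>n. x (r n)) \<longlonglongrightarrow> a" using tendsto_fst[OF lim] by (simp add: comp_def a_def)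
  have b: "(\<lambda>n. y (r n)) \<longlonglongrightarrow> b" using tendsto_snd[OF lim] by (simp add: comp_def b_def)
  have "(\<lambda>n. 1 / real (Suc (r n))) \<longlonglongrightarrow> 0"
    using LIMSEQ_subseq_LIMSEQ[OF LIMSEQ_inverse_real_of_nat r] by (simp add: comp_def inverse_eq_divide)
  then have "(\<lambda>n. hdist (x (r n)) (y (r n))) \<longlonglongrightarrow> 0"
  proof (rule Lim_null_comparison[rotated])
    have "norm (hdist (x (r n)) (y (r n))) \<le> 1 / real (Suc (r n))" for n
      using xy(3)[of "r n"] hdist_nonneg[of "x (r n)" "y (r n)"] unfolding real_norm_def by linarith
    then show "\<forall>\<^sub>F n in sequentially. norm (hdist (x (r n)) (y (r n))) \<le> 1 / real (Suc (r n))"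
      by (rule always_eventually[OF allI])
  qed
  moreover have "(\<lambda>n. hdist (x (r n)) (y (r n))) \<longlonglongrightarrow> hdist a b" by (rule tendsto_hdist[OF a b])
  ultimately have "hdist a b = 0" using LIMSEQ_unique by blast
  then have "a = b" by simp
  moreover have "e \<le> dist a b"
    using tendsto_dist[OF a b] xy(4) by (intro LIMSEQ_le_const) auto
  ultimately show False using e by simp
qed

text \<open>Points of K need not lie in A; they are limits of points of A with the same first
  labels. Covectors at such points converge, since label j confines them to a ball of radius
  \<open>(1/2) ^ j\<close>, and flatness, a closed condition, passes to the limit. As labels are
  locally constant on K, the limit covectors satisfy Whitney's condition.\<close>

lemma regular_surface_through_piece:
  fixes A :: "'n::finite heis set" and M :: "'n heis measure" and \<kappa> :: "'n heis \<Rightarrow> nat \<Rightarrow> 'n hvec"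
  assumes k: "k \<le> 2 * CARD('n)" and m: "m = 2 * CARD('n) + 1 - k"
    and M: "sets M = sets borel" "emeasure M (space M) \<noteq> \<infinity>" and \<eta>: "0 < \<eta>"
    and \<kappa>: "\<And>p i. p \<in> A \<Longrightarrow> i < m \<Longrightarrow> norm (\<kappa> p i) = 1"
      "\<And>p i j. p \<in> A \<Longrightarrow> i < m \<Longrightarrow> j < m \<Longrightarrow> i \<noteq> j \<Longrightarrow> \<kappa> p i \<bullet> \<kappa> p j = 0"
    and \<rho>: "\<And>j a. 0 < \<rho> j a"
    and close: "\<And>j p. p \<in> A \<Longrightarrow> (\<Sum>i<m. norm (\<kappa> p i - kk j (l j p) i)) \<le> (1/2) ^ j"
    and flat: "\<And>j p q. p \<in> A \<Longrightarrow> q \<in> A \<Longrightarrow> l j p = l j q \<Longrightarrow> hdist p q \<le> \<rho> j (l j p) \<Longrightarrow>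
       (\<Sum>i<m. \<bar>kk j (l j p :: nat) i \<bullet> (hproj q - hproj p)\<bar>) \<le> (1/2) ^ j * hdist p q"
  shows "\<exists>K S. compact K \<and> outer_measure_of M A \<le> emeasure M K + ennreal \<eta> \<and> K \<subseteq> S \<and> H_regular k S"
proof -
  obtain K l' where K: "compact K" and meas: "outer_measure_of M A \<le> emeasure M K + ennreal \<eta>"
    and cl: "\<And>j x. x \<in> K \<Longrightarrow> x \<in> closure {p\<in>A. \<forall>i<j. l i p = l' i x}"
    and loc: "\<And>j :: nat. \<exists>e>0. \<forall>x\<in>K. \<forall>y\<in>K. dist x y < e \<longrightarrow> (l' j x :: nat) = l' j y"
    by (rule locally_constant_selection[OF M \<eta>, of A l], rule that) assumption+
  define Y where "Y j x = {p\<in>A. \<forall>i<j. l i p = l' i x}" for j x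
  define c where "c j x = kk j (l' j x)" for j x
  define P where "P j x = (SOME p. p \<in> Y j x)" for j x
  have P: "P j x \<in> Y j x" if "x \<in> K" for j x
  proof -
    have "Y j x \<noteq> {}" using cl[OF that, of j] unfolding Y_def[symmetric] by (metis closure_empty empty_iff)
    then show ?thesis unfolding P_def by (rule some_in_eq[THEN iffD2])
  qed
  have near: "norm (\<kappa> p i - c j x i) \<le> (1/2) ^ j" if "p \<in> Y n x" "j < n" "i < m" for p i j n x
  proof -
    have p: "p \<in> A" "l j p = l' j x" using that by (auto simp: Y_def)
    have "norm (\<kappa> p i - kk j (l j p) i) \<le> (\<Sum>i<m. norm (\<kappa> p i - kk j (l j p) i))"
      using that(3) by (intro member_le_sum) auto
    then show ?thesis using close[OF p(1), of j] p(2) by (simp add: c_def)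
  qed
  \<comment> \<open>\<open>Suc n\<close> makes the labels 0, ..., n agree with those of x, so that
    \<open>u_near\<close> holds for all \<open>j \<le> n\<close>.\<close>
  define u where "u x i n = \<kappa> (P (Suc n) x) i" for x i n
  have u_near: "norm (u x i n - c j x i) \<le> (1/2) ^ j" if "x \<in> K" "i < m" "j \<le> n" for x i j n
    unfolding u_def using near[OF P[OF that(1), of "Suc n"], of j i] that by simp
  have small: "\<exists>j. (1/2 :: real) ^ j < e" if "e > 0" for e
    using that by (intro real_arch_pow_inv) auto
  have u_conv: "convergent (u x i)" if x: "x \<in> K" and i: "i < m" for x i
  proof (rule Cauchy_convergent, rule metric_CauchyI)
    fix e :: real assume "e > 0"
    then obtain j where j: "(1/2 :: real) ^ j < e / 2" using small[of "e / 2"] by auto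
    have "dist (u x i a) (u x i b) < e" if "a \<ge> j" "b \<ge> j" for a b
    proof -
      have "dist (u x i a) (u x i b) \<le> norm (u x i a - c j x i) + norm (u x i b - c j x i)"
        unfolding dist_norm[symmetric] by (rule dist_triangle2)
      then show ?thesis using u_near[OF x i that(1)] u_near[OF x i that(2)] j by linarith
    qed
    then show "\<exists>N. \<forall>a\<ge>N. \<forall>b\<ge>N. dist (u x i a) (u x i b) < e" by blast
  qed
  define kt where "kt x i = lim (u x i)" for x i
  have u_lim: "u x i \<longlonglongrightarrow> kt x i" if "x \<in> K" "i < m" for x i
    using u_conv[OF that] by (simp add: kt_def convergent_LIMSEQ_iff)
  have kt_c: "norm (kt x i - c j x i) \<le> (1/2) ^ j" if "x \<in> K" "i < m" for x i j
  proof (rule LIMSEQ_le_const2)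
    show "(\<lambda>n. norm (u x i n - c j x i)) \<longlonglongrightarrow> norm (kt x i - c j x i)"
      by (intro tendsto_intros u_lim that)
    show "\<exists>N. \<forall>n\<ge>N. norm (u x i n - c j x i) \<le> (1/2) ^ j" using u_near[OF that] by blast
  qed
  have PA: "P n x \<in> A" if "x \<in> K" for n x using P[OF that, of n] by (simp add: Y_def)
  have kt_norm: "norm (kt x i) = 1" if "x \<in> K" "i < m" for x i
  proof -
    have "(\<lambda>n. norm (u x i n)) \<longlonglongrightarrow> norm (kt x i)" by (intro tendsto_intros u_lim that)
    moreover have "(\<lambda>n. norm (u x i n)) = (\<lambda>_. 1)" using \<kappa>(1) PA that by (auto simp: u_def)
    ultimately show ?thesis by (simp add: LIMSEQ_const_iff)
  qed
  have kt_orth: "kt x i \<bullet> kt x j = 0" if "x \<in> K" "i < m" "j < m" "i \<noteq> j" for x i j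
  proof -
    have "(\<lambda>n. u x i n \<bullet> u x j n) \<longlonglongrightarrow> kt x i \<bullet> kt x j" by (intro tendsto_intros u_lim that)
    moreover have "(\<lambda>n. u x i n \<bullet> u x j n) = (\<lambda>_. 0)" using \<kappa>(2) PA that by (auto simp: u_def)
    ultimately show ?thesis by (simp add: LIMSEQ_const_iff)
  qed
  \<comment> \<open>The condition on the distance is strict, so it holds eventually along
    approximating sequences and the inequality survives in the limit.\<close>
  have c_flat: "\<bar>c j x i \<bullet> (hproj x - hproj y)\<bar> \<le> (1/2) ^ j * hdist x y"
    if x: "x \<in> K" and y: "y \<in> K" and xy: "l' j x = l' j y" "hdist x y < \<rho> j (l' j x)" and i: "i < m" for x y i j
  proof -
    obtain s where s: "\<And>n. s n \<in> Y (Suc j) x" "s \<longlonglongrightarrow> x"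
      using cl[OF x, of "Suc j"] unfolding closure_sequential Y_def by blast
    obtain t where t: "\<And>n. t n \<in> Y (Suc j) y" "t \<longlonglongrightarrow> y"
      using cl[OF y, of "Suc j"] unfolding closure_sequential Y_def by blast
    have dl: "(\<lambda>n. hdist (t n) (s n)) \<longlonglongrightarrow> hdist y x" by (intro tendsto_intros s t)
    have hl: "isCont hproj p" for p :: "'n heis"
      using continuous_on_hproj[OF continuous_on_id, of UNIV] continuous_on_eq_continuous_at[OF open_UNIV] by blast
    have sl: "(\<lambda>n. hproj (s n)) \<longlonglongrightarrow> hproj x" and tl: "(\<lambda>n. hproj (t n)) \<longlonglongrightarrow> hproj y"
      using isCont_tendsto_compose[OF hl s(2)] isCont_tendsto_compose[OF hl t(2)] by auto
    have "\<forall>\<^sub>F n in sequentially. hdist (t n) (s n) < \<rho> j (l' j x)"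
      using order_tendstoD(2)[OF dl] xy(2) by (simp add: hdist_commute)
    then have "\<forall>\<^sub>F n in sequentially. \<bar>c j x i \<bullet> (hproj (s n) - hproj (t n))\<bar> \<le> (1/2) ^ j * hdist (t n) (s n)"
    proof eventually_elim
      case (elim n)
      have st: "s n \<in> A" "t n \<in> A" "l j (s n) = l' j x" "l j (t n) = l' j x"
        using s(1)[of n] t(1)[of n] xy(1) by (auto simp: Y_def)
      have "\<bar>c j x i \<bullet> (hproj (s n) - hproj (t n))\<bar> \<le> (\<Sum>i<m. \<bar>c j x i \<bullet> (hproj (s n) - hproj (t n))\<bar>)"
        using i by (intro member_le_sum[of i "{..<m}" "\<lambda>i. \<bar>c j x i \<bullet> (hproj (s n) - hproj (t n))\<bar>"]) auto
      also have "\<dots> \<le> (1/2) ^ j * hdist (t n) (s n)"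
        using flat[OF st(2,1), of j] st(3,4) elim by (simp add: c_def)
      finally show ?case .
    qed
    moreover have "(\<lambda>n. \<bar>c j x i \<bullet> (hproj (s n) - hproj (t n))\<bar>) \<longlonglongrightarrow> \<bar>c j x i \<bullet> (hproj x - hproj y)\<bar>"
      by (intro tendsto_intros sl tl)
    moreover have "(\<lambda>n. (1/2) ^ j * hdist (t n) (s n)) \<longlonglongrightarrow> (1/2) ^ j * hdist y x"
      by (intro tendsto_intros s t)
    ultimately have "\<bar>c j x i \<bullet> (hproj x - hproj y)\<bar> \<le> (1/2) ^ j * hdist y x"
      using tendsto_le[OF sequentially_bot] by blast
    then show ?thesis by (simp add: hdist_commute)
  qed
  have fin_image: "finite (l' j ` K)" for j
  proof -
    obtain e where e: "e > 0" "\<And>x y. x \<in> K \<Longrightarrow> y \<in> K \<Longrightarrow> dist x y < e \<Longrightarrow> l' j x = l' j y" using loc[of j] by blast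
    obtain F where F: "F \<subseteq> K" "finite F" "K \<subseteq> (\<Union>x\<in>F. ball x e)"
      using e(1) by (rule_tac compactE_image[OF K, of K "\<lambda>x. ball x e"]) auto
    have "l' j ` K \<subseteq> l' j ` F"
    proof
      fix a assume "a \<in> l' j ` K"
      then obtain x where x: "x \<in> K" "a = l' j x" by blast
      then obtain y where y: "y \<in> F" "dist y x < e" using F(3) by (auto simp: mem_ball)
      then have "l' j y = l' j x" using e(2)[of y x] x F(1) by blast
      then show "a \<in> l' j ` F" using y(1) x(2) by (metis imageI)
    qed
    then show ?thesis using F(2) finite_surj by blast
  qed
  have whitney: "\<exists>\<delta>>0. \<forall>x\<in>K. \<forall>y\<in>K. hdist x y < \<delta> \<longrightarrow>
      norm (kt x i - kt y i) \<le> \<epsilon> \<and> \<bar>kt x i \<bullet> (hproj x - hproj y)\<bar> \<le> \<epsilon> * hdist x y" if i: "i < m" and \<epsilon>: "\<epsilon> > 0" for i \<epsilon>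
  proof -
    obtain j where "(1/2 :: real) ^ j < \<epsilon> / 2" using small[of "\<epsilon> / 2"] \<epsilon> by auto
    then have j: "2 * (1/2 :: real) ^ j \<le> \<epsilon>" by simp
    obtain e where e: "e > 0" "\<And>x y. x \<in> K \<Longrightarrow> y \<in> K \<Longrightarrow> dist x y < e \<Longrightarrow> l' j x = l' j y" using loc[of j] by blast
    obtain \<delta>1 where \<delta>1: "\<delta>1 > 0" "\<And>x y. x \<in> K \<Longrightarrow> y \<in> K \<Longrightarrow> hdist x y < \<delta>1 \<Longrightarrow> dist x y < e"
      using hdist_imp_dist_small[OF K e(1)] by blast
    \<comment> \<open>Labels take finitely many values on K, so one positive radius serves all of
      them; the inserted 1 covers an empty K.\<close>
    define \<rho>0 where "\<rho>0 = Min (insert 1 (\<rho> j ` l' j ` K))"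
    have \<rho>0: "\<rho>0 > 0" unfolding \<rho>0_def using fin_image[of j] \<rho> by (subst Min_gr_iff) auto
    have \<rho>0_le: "\<rho>0 \<le> \<rho> j (l' j x)" if "x \<in> K" for x
      unfolding \<rho>0_def using fin_image[of j] that by (intro Min_le) auto
    have "norm (kt x i - kt y i) \<le> \<epsilon> \<and> \<bar>kt x i \<bullet> (hproj x - hproj y)\<bar> \<le> \<epsilon> * hdist x y"
      if x: "x \<in> K" and y: "y \<in> K" and xy: "hdist x y < min \<delta>1 \<rho>0" for x y
    proof
      have eq: "l' j x = l' j y" using e(2)[OF x y] \<delta>1(2)[OF x y] xy by simp
      then have cxy: "c j x = c j y" by (simp add: c_def)
      have "norm (kt x i - kt y i) \<le> norm (kt x i - c j x i) + norm (kt y i - c j x i)"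
        unfolding dist_norm[symmetric] by (rule dist_triangle2)
      also have "\<dots> \<le> (1/2) ^ j + (1/2) ^ j"
        using kt_c[OF x i, of j] kt_c[OF y i, of j] unfolding cxy by (rule add_mono)
      finally show "norm (kt x i - kt y i) \<le> \<epsilon>" using j by simp
      have "\<bar>(kt x i - c j x i) \<bullet> (hproj x - hproj y)\<bar> \<le> norm (kt x i - c j x i) * norm (hproj x - hproj y)"
        by (rule Cauchy_Schwarz_ineq2)
      also have "\<dots> \<le> (1/2) ^ j * hdist x y"
        using kt_c[OF x i, of j] norm_hproj_diff_le[of x y] by (intro mult_mono) auto
      finally have a: "\<bar>(kt x i - c j x i) \<bullet> (hproj x - hproj y)\<bar> \<le> (1/2) ^ j * hdist x y" .
      have "\<bar>c j x i \<bullet> (hproj x - hproj y)\<bar> \<le> (1/2) ^ j * hdist x y"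
        using xy \<rho>0_le[OF x] by (intro c_flat x y eq i) simp
      then have "\<bar>kt x i \<bullet> (hproj x - hproj y)\<bar> \<le> 2 * (1/2) ^ j * hdist x y"
        using a unfolding inner_diff_left by linarith
      also have "\<dots> \<le> \<epsilon> * hdist x y" using j by (rule mult_right_mono) simp
      finally show "\<bar>kt x i \<bullet> (hproj x - hproj y)\<bar> \<le> \<epsilon> * hdist x y" .
    qed
    then show ?thesis using \<delta>1(1) \<rho>0 by (intro exI[of _ "min \<delta>1 \<rho>0"]) simp
  qed
  define ext where "ext i f g \<longleftrightarrow> continuous_on UNIV g \<and> (\<forall>q. has_hgrad f (g q) q) \<and> (\<forall>q\<in>K. f q = 0 \<and> g q = kt q i)"
    for i f and g :: "'n heis \<Rightarrow> 'n hvec"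
  have "\<exists>f g. ext i f g" if i: "i < m" for i
  proof -
    obtain f g where "continuous_on UNIV g" "\<And>q. has_hgrad f (g q) q"
      "\<And>q. q \<in> K \<Longrightarrow> f q = 0" "\<And>q. q \<in> K \<Longrightarrow> g q = kt q i"
      by (rule whitney_extension[OF K whitney[OF i]], assumption, rule that) assumption+
    then show ?thesis unfolding ext_def by blast
  qed
  then obtain f g where "\<And>i. i < m \<Longrightarrow> ext i (f i) (g i)" by metis
  then have fg: "\<And>i. i < m \<Longrightarrow> continuous_on UNIV (g i)" "\<And>i q. i < m \<Longrightarrow> has_hgrad (f i) (g i q) q"
    "\<And>i q. i < m \<Longrightarrow> q \<in> K \<Longrightarrow> f i q = 0" "\<And>i q. i < m \<Longrightarrow> q \<in> K \<Longrightarrow> g i q = kt q i"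
    unfolding ext_def by blast+
  have "\<exists>S. K \<subseteq> S \<and> H_regular k S"
  proof (rule H_regular_from_gradients[OF k m fg(1,2,3)])
    show "norm (g i q) = 1" if "i < m" "q \<in> K" for i q
      unfolding fg(4)[OF that] by (rule kt_norm[OF that(2,1)])
    show "g i q \<bullet> g j q = 0" if "i < m" "j < m" "i \<noteq> j" "q \<in> K" for i j q
      unfolding fg(4)[OF that(1,4)] fg(4)[OF that(2,4)] by (rule kt_orth[OF that(4,1,2,3)])
  qed
  then show ?thesis using K meas by blast
qed

theorem theorem1p1:
  fixes E :: "'n::finite heis set" and k :: nat
  assumes "CARD('n) + 1 \<le> k" and "k \<le> 2 * CARD('n) + 1"
    and "hausdorff_measurable (k + 1) E"
    and "hausdorff (k + 1) E < \<infinity>"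
    and "\<exists>N. hausdorff (k + 1) N = 0 \<and>
           (\<forall>p\<in>E - N. \<exists>V\<in>hgrassmannian k. \<forall>s. 0 < s \<and> s < 1 \<longrightarrow>
              ((\<lambda>r. ennreal (1 / r ^ (k + 1)) *
                     hausdorff (k + 1) (E \<inter> hball p r - hcone p V s)) \<longlongrightarrow> 0) (at_right 0))"
  shows "H_rectifiable k E"
proof (cases "k = 2 * CARD('n) + 1")
  case True
  \<comment> \<open>With no defining functions the surfaces are the open sets, and the whole group
    is one of them.\<close>
  have "E - (\<Union>i :: nat. UNIV) = {}" by simp
  then have "hausdorff (k + 1) (E - (\<Union>i :: nat. UNIV)) = 0" by (simp add: hausdorff_empty)
  moreover have "H_regular k (UNIV :: 'n heis set)" using True by (simp add: H_regular_def)
  ultimately show ?thesis using assms(3) unfolding H_rectifiable_def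
    by (intro conjI exI[of _ "\<lambda>_. UNIV"]) auto
next
  case False
  then have k: "k \<le> 2 * CARD('n)" using assms(2) by simp
  define d where "d = k + 1"
  define m where "m = 2 * CARD('n) + 1 - k"
  have dm: "d + m = 2 * CARD('n) + 2" and m0: "0 < m" and d0: "0 < d" using k by (auto simp: d_def m_def)
  obtain N where N: "hausdorff d N = 0" and tangent: "\<And>p. p \<in> E - N \<Longrightarrow> \<exists>V\<in>hgrassmannian k. \<forall>s. 0 < s \<and> s < 1 \<longrightarrow>
      ((\<lambda>r. ennreal (1 / r ^ d) * hausdorff d (E \<inter> hball p r - hcone p V s)) \<longlongrightarrow> 0) (at_right 0)"
    using assms(5) unfolding d_def by blast
  define E0 where "E0 = E - N"
  define frame where "frame p \<kappa> W c V \<longleftrightarrow> (\<forall>i<m. norm (\<kappa> i) = 1) \<and> (\<forall>i<m. \<forall>j<m. i \<noteq> j \<longrightarrow> \<kappa> i \<bullet> \<kappa> j = 0) \<and>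
      (\<forall>i<m. \<forall>x. \<bar>\<kappa> i \<bullet> hproj x\<bar> \<le> hsetdist x V) \<and>
      subspace W \<and> dim W = m \<and> (\<forall>v\<in>W. \<forall>w\<in>W. hform v w = 0) \<and> 0 < c \<and> (\<forall>w\<in>W. c * norm w \<le> (\<Sum>i<m. \<bar>\<kappa> i \<bullet> w\<bar>)) \<and>
      (\<forall>s. 0 < s \<and> s < 1 \<longrightarrow> ((\<lambda>r. ennreal (1 / r ^ d) * hausdorff d (E \<inter> hball p r - hcone p V s)) \<longlongrightarrow> 0) (at_right 0))"
    for p and \<kappa> :: "nat \<Rightarrow> 'n hvec" and W c V
  have "\<exists>\<kappa> W c V. frame p \<kappa> W c V" if p: "p \<in> E0" for p
  proof -
    obtain V where V: "V \<in> hgrassmannian k" "\<forall>s. 0 < s \<and> s < 1 \<longrightarrow>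
      ((\<lambda>r. ennreal (1 / r ^ d) * hausdorff d (E \<inter> hball p r - hcone p V s)) \<longlongrightarrow> 0) (at_right 0)"
      using tangent p unfolding E0_def by blast
    obtain \<kappa> :: "nat \<Rightarrow> 'n hvec" and W c where f:
      "\<And>i. i < m \<Longrightarrow> norm (\<kappa> i) = 1" "\<And>i j. i < m \<Longrightarrow> j < m \<Longrightarrow> i \<noteq> j \<Longrightarrow> \<kappa> i \<bullet> \<kappa> j = 0"
      "\<And>i x. i < m \<Longrightarrow> \<bar>\<kappa> i \<bullet> hproj x\<bar> \<le> hsetdist x V"
      "subspace W" "dim W = m" "\<And>v w. v \<in> W \<Longrightarrow> w \<in> W \<Longrightarrow> hform v w = 0"
      "0 < c" "\<And>w. w \<in> W \<Longrightarrow> c * norm w \<le> (\<Sum>i<m. \<bar>\<kappa> i \<bullet> w\<bar>)"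
      by (rule hgrassmannian_frame[OF V(1) assms(1) k m_def], rule that) assumption+
    have "frame p \<kappa> W c V" unfolding frame_def using f V(2) by simp
    then show ?thesis by blast
  qed
  then obtain \<kappa> W c V where frame: "\<And>p. p \<in> E0 \<Longrightarrow> frame p (\<kappa> p) (W p) (c p) (V p)" by metis
  have \<kappa>: "norm (\<kappa> p i) = 1" if "p \<in> E0" "i < m" for p i using frame[OF that(1)] that(2) unfolding frame_def by blast
  have \<kappa>_orth: "\<kappa> p i \<bullet> \<kappa> p j = 0" if "p \<in> E0" "i < m" "j < m" "i \<noteq> j" for p i j
    using frame[OF that(1)] that unfolding frame_def by blast
  have cone: "\<exists>R>0. \<forall>r. 0 < r \<longrightarrow> r < R \<longrightarrow>
      hausdorff d {q\<in>E0. hdist p q \<le> r \<and> s * hdist p q < (\<Sum>i<m. \<bar>\<kappa> p i \<bullet> (hproj q - hproj p)\<bar>)} \<le> ennreal (\<epsilon> * r ^ d)"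
    if p: "p \<in> E0" and s: "0 < s" "s < 1" and \<epsilon>: "0 < \<epsilon>" for p s \<epsilon>
  proof -
    \<comment> \<open>The sum has m terms, each at most the distance to V, so on a cone of opening
      \<open>s / m\<close> the sum is at most s times the distance.\<close>
    define s' where "s' = s / real m"
    have m1: "real m \<ge> 1" using m0 by simp
    have s': "0 < s'" "s' < 1" "real m * s' = s"
    proof -
      show "0 < s'" "real m * s' = s" using s m0 by (auto simp: s'_def)
      have "s' \<le> s / 1" unfolding s'_def using s m1 by (intro divide_left_mono) auto
      then show "s' < 1" using s by simp
    qed
    have "((\<lambda>r. ennreal (1 / r ^ d) * hausdorff d (E \<inter> hball p r - hcone p (V p) s')) \<longlongrightarrow> 0) (at_right 0)"
      using frame[OF p] s' unfolding frame_def by blast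
    moreover have "0 < ennreal \<epsilon>" using \<epsilon> by simp
    ultimately have "\<forall>\<^sub>F r in at_right 0. ennreal (1 / r ^ d) * hausdorff d (E \<inter> hball p r - hcone p (V p) s') < ennreal \<epsilon>"
      by (rule order_tendstoD(2))
    then obtain R where R: "R > 0" "\<And>r. 0 < r \<Longrightarrow> r < R \<Longrightarrow>
        ennreal (1 / r ^ d) * hausdorff d (E \<inter> hball p r - hcone p (V p) s') < ennreal \<epsilon>"
      unfolding eventually_at_right_field by blast
    have sub: "{q\<in>E0. hdist p q \<le> r \<and> s * hdist p q < (\<Sum>i<m. \<bar>\<kappa> p i \<bullet> (hproj q - hproj p)\<bar>)}
        \<subseteq> E \<inter> hball p r - hcone p (V p) s'" for r
    proof
      fix q assume q: "q \<in> {q\<in>E0. hdist p q \<le> r \<and> s * hdist p q < (\<Sum>i<m. \<bar>\<kappa> p i \<bullet> (hproj q - hproj p)\<bar>)}"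
      have "q \<notin> hcone p (V p) s'"
      proof
        assume "q \<in> hcone p (V p) s'"
        then have h: "hsetdist (hinv p \<odot> q) (V p) \<le> s' * hdist p q" by (simp add: hcone_def)
        have "\<bar>\<kappa> p i \<bullet> (hproj q - hproj p)\<bar> \<le> s' * hdist p q" if "i < m" for i
        proof -
          have "\<bar>\<kappa> p i \<bullet> hproj (hinv p \<odot> q)\<bar> \<le> hsetdist (hinv p \<odot> q) (V p)"
            using frame[OF p] that unfolding frame_def by blast
          then show ?thesis using h by (simp add: algebra_simps)
        qed
        then have "(\<Sum>i<m. \<bar>\<kappa> p i \<bullet> (hproj q - hproj p)\<bar>) \<le> (\<Sum>i<m. s' * hdist p q)"
          by (intro sum_mono) simp
        also have "\<dots> = s * hdist p q" using s'(3) by (simp add: mult.assoc[symmetric])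
        finally show False using q by simp
      qed
      then show "q \<in> E \<inter> hball p r - hcone p (V p) s'" using q by (simp add: E0_def hball_def)
    qed
    have "hausdorff d {q\<in>E0. hdist p q \<le> r \<and> s * hdist p q < (\<Sum>i<m. \<bar>\<kappa> p i \<bullet> (hproj q - hproj p)\<bar>)} \<le> ennreal (\<epsilon> * r ^ d)"
      if r: "0 < r" "r < R" for r
    proof -
      define H where "H = hausdorff d (E \<inter> hball p r - hcone p (V p) s')"
      have "H = ennreal (r ^ d) * (ennreal (1 / r ^ d) * H)"
      proof -
        have "ennreal (r ^ d) * ennreal (1 / r ^ d) = 1" using r by (simp add: ennreal_mult'[symmetric])
        then show ?thesis by (simp add: mult.assoc[symmetric])
      qed
      also have "\<dots> \<le> ennreal (r ^ d) * ennreal \<epsilon>"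
        using R(2)[OF r] unfolding H_def by (intro mult_left_mono) (auto simp: less_imp_le)
      also have "\<dots> = ennreal (r ^ d * \<epsilon>)" using r by (intro ennreal_mult'[symmetric]) simp
      also have "r ^ d * \<epsilon> = \<epsilon> * r ^ d" by (rule mult.commute)
      finally have "H \<le> ennreal (\<epsilon> * r ^ d)" .
      then show ?thesis using hausdorff_mono[OF sub[of r], of d] unfolding H_def by (rule order_trans[rotated])
    qed
    then show ?thesis using R(1) by blast
  qed
  have finE0: "hausdorff d E0 < \<infinity>"
    using hausdorff_mono[of E0 E d] assms(4) by (auto simp: E0_def d_def order_le_less_trans)
  define level where "level j Z l kk \<rho> \<longleftrightarrow> hausdorff d Z = 0 \<and> (\<forall>a. 0 < \<rho> a) \<and>
     (\<forall>p\<in>E0 - Z. (\<Sum>i<m. norm (\<kappa> p i - kk (l p) i)) \<le> (1/2) ^ j) \<and>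
     (\<forall>p\<in>E0 - Z. \<forall>q\<in>E0 - Z. l p = l q \<longrightarrow> hdist p q \<le> \<rho> (l p) \<longrightarrow>
        (\<Sum>i<m. \<bar>kk (l p) i \<bullet> (hproj q - hproj p)\<bar>) \<le> (1/2) ^ j * hdist p q)"
    for j :: nat and Z and l :: "'n heis \<Rightarrow> nat" and kk :: "nat \<Rightarrow> nat \<Rightarrow> 'n hvec" and \<rho> :: "nat \<Rightarrow> real"
  have "\<exists>Z l kk \<rho>. level j Z l kk \<rho>" for j
    unfolding level_def
  proof (rule cone_level_decomposition[where W = W and c = c, OF dm m0 d0 finE0 \<kappa>])
    show "(1/2 :: real) ^ j \<le> 1" by (rule power_le_one) auto
  qed (use frame cone in \<open>auto simp: frame_def\<close>)
  then obtain Z l kk \<rho> where level: "\<And>j. level j (Z j) (l j) (kk j) (\<rho> j)" by metis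
  define A where "A = E0 - (\<Union>j. Z j)"
  have Znull: "hausdorff d (\<Union>j. Z j) = 0" using level by (intro hausdorff_null_UN) (auto simp: level_def)
  obtain M :: "'n heis measure" where M: "sets M = sets borel" "\<And>B. B \<in> sets borel \<Longrightarrow> emeasure M B = hausdorff d (E \<inter> B)"
    using hausdorff_borel_measure[OF d0, of E] assms(4) unfolding d_def by blast
  have spM: "space M = UNIV" using sets_eq_imp_space_eq[OF M(1)] by simp
  have MU: "emeasure M UNIV = hausdorff d E" using M(2)[of UNIV] by simp
  have finM: "emeasure M (space M) \<noteq> \<infinity>" using assms(4) by (simp add: spM MU d_def)
  \<comment> \<open>A differs from E by null sets only, so every measurable set containing A carries
    the full measure of E. In this way the possibly nonmeasurable A still yields compact sets of
    nearly full measure.\<close>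
  have outer: "hausdorff d E \<le> outer_measure_of M A"
    unfolding outer_measure_of_def
  proof (rule INF_greatest)
    fix B assume B: "B \<in> {B \<in> sets M. A \<subseteq> B}"
    have "E \<subseteq> E \<inter> B \<union> (N \<union> (\<Union>j. Z j))" using B by (auto simp: A_def E0_def)
    then have "hausdorff d E \<le> hausdorff d (E \<inter> B \<union> (N \<union> (\<Union>j. Z j)))" by (rule hausdorff_mono)
    also have "\<dots> \<le> hausdorff d (E \<inter> B) + (hausdorff d N + hausdorff d (\<Union>j. Z j))"
      by (intro order_trans[OF hausdorff_Un_le[OF d0]] add_left_mono hausdorff_Un_le[OF d0])
    also have "\<dots> = emeasure M B" using B by (simp add: N Znull M)
    finally show "hausdorff d E \<le> emeasure M B" .
  qed
  have "\<exists>K S. compact K \<and> outer_measure_of M A \<le> emeasure M K + ennreal (1 / real (Suc n)) \<and> K \<subseteq> S \<and> H_regular k S" for n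
  proof (rule regular_surface_through_piece[OF k m_def M(1) finM, where \<kappa> = \<kappa> and \<rho> = \<rho> and l = l and kk = kk and A = A])
    show "0 < 1 / real (Suc n)" by simp
    show "norm (\<kappa> p i) = 1" if "p \<in> A" "i < m" for p i using \<kappa> that unfolding A_def by blast
    show "\<kappa> p i \<bullet> \<kappa> p j = 0" if "p \<in> A" "i < m" "j < m" "i \<noteq> j" for p i j
      using \<kappa>_orth that unfolding A_def by blast
    show "0 < \<rho> j a" for j a using level[of j] unfolding level_def by blast
    have AZ: "p \<in> E0 - Z j" if "p \<in> A" for p j using that unfolding A_def by blast
    show "(\<Sum>i<m. norm (\<kappa> p i - kk j (l j p) i)) \<le> (1/2) ^ j" if "p \<in> A" for j p
      using level[of j] AZ[OF that, of j] unfolding level_def by blast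
    show "(\<Sum>i<m. \<bar>kk j (l j p) i \<bullet> (hproj q - hproj p)\<bar>) \<le> (1/2) ^ j * hdist p q"
      if "p \<in> A" "q \<in> A" "l j p = l j q" "hdist p q \<le> \<rho> j (l j p)" for j p q
      using level[of j] AZ[OF that(1), of j] AZ[OF that(2), of j] that(3,4) unfolding level_def by blast
  qed
  then obtain K S where KS: "\<And>n. compact (K n)" "\<And>n. outer_measure_of M A \<le> emeasure M (K n) + ennreal (1 / real (Suc n))"
    "\<And>n. K n \<subseteq> S n" "\<And>n. H_regular k (S n)"
    by metis
  \<comment> \<open>Each \<open>K n\<close> misses at most \<open>1 / (n + 1)\<close> of the measure
    of E and lies in the surface \<open>S n\<close>.\<close>
  have "hausdorff d (E - (\<Union>i. S i)) \<le> ennreal (1 / real (Suc n))" for n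
  proof -
    have Kb: "K n \<in> sets borel" using KS(1) by (rule borel_compact)
    have "hausdorff d (E - (\<Union>i. S i)) \<le> hausdorff d (E \<inter> (UNIV - K n))"
      using KS(3)[of n] by (intro hausdorff_mono) auto
    also have "\<dots> = emeasure M (UNIV - K n)" using Kb by (subst M(2)) auto
    also have "\<dots> = emeasure M UNIV - emeasure M (K n)"
    proof (rule emeasure_Diff)
      have "emeasure M (K n) \<le> emeasure M (space M)" by (rule emeasure_space)
      then show "emeasure M (K n) \<noteq> \<infinity>" using finM by (auto simp: top_unique)
    qed (use Kb M(1) in auto)
    also have "\<dots> \<le> ennreal (1 / real (Suc n))"
      using order_trans[OF outer KS(2)[of n]] finM[unfolded spM] unfolding MU
      by (simp add: ennreal_minus_le_iff add.commute)
    finally show ?thesis .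
  qed
  then have small: "hausdorff d (E - (\<Union>i. S i)) \<le> ennreal (1 / real (Suc n))" for n .
  have "hausdorff d (E - (\<Union>i. S i)) = 0"
  proof (rule ccontr)
    assume "hausdorff d (E - (\<Union>i. S i)) \<noteq> 0"
    moreover have "hausdorff d (E - (\<Union>i. S i)) < \<infinity>" using small[of 0] by (auto intro: order_le_less_trans)
    ultimately obtain b where b: "b > 0" "hausdorff d (E - (\<Union>i. S i)) = ennreal b"
      by (cases "hausdorff d (E - (\<Union>i. S i))") auto
    obtain n where "1 / real (Suc n) < b" using b(1) nat_approx_posE by blast
    then show False using small[of n] b by simp
  qed
  then show ?thesis using assms(3) KS(4) unfolding H_rectifiable_def d_def by blast
qed

end
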